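(* Let $\mathcal C$ be a tame and bounded triangulated persistence category. For every object $X$ of $\mathcal C$, the linear map $\tilde q_X$ from the free abelian group generated by $\mathrm{Obj}(\mathcal C)$ to $\Lambda$, defined on objects by $\tilde q_X(N)=\lambda_{\hom_{\mathcal C}(X,T^\bullet N)}$, descends to a homomorphism $q_X:K(\mathcal C)\to\Lambda$. Moreover, the map $\kappa:\mathrm{Obj}(\mathcal C)\times\mathrm{Obj}(\mathcal C)\to\Lambda$ defined by $\kappa(X,Y)=q_X(Y)$ induces a bilinear map of $\Lambda_P$-modules $$\kappa:\overline{K(\mathcal C)}\otimes_{\Lambda_P}K(\mathcal C)\to\Lambda.$$
   Context: Novikov rings: $\Lambda=\{\sum_{k=0}^\infty n_kt^{a_k}\mid n_k\in\mathbb Z,\ a_k\in\mathbb R,\ a_k\to\infty\}$, and $\Lambda_P\subset\Lambda$ is the subring of finite sums. Persistence modules: a persistence module over a field $\mathbf k$ is a family of vector spaces $\{M^s\}_{s\in\mathbb R}$ with maps $i_{s,t}:M^s\to M^t$ ($s\le t$), $i_{t,r}i_{s,t}=i_{s,r}$, $i_{s,s}=\mathrm{id}$; always assumed lower semicontinuous ($i_{s,t}$ is an isomorphism for $t\ge s$ close to $s$) and lower bounded ($M^s=0$ for $s\ll0$). If moreover $\dim M^s<\infty$ for all $s$, then $M$ is isomorphic to a direct sum of interval modules over its barcode $\mathcal B_M=\{(I_j,m_j)\}$, with bars $I_j=[a_j,b_j)$, $-\infty<a_j<b_j\le\infty$, and multiplicities $m_j$; put $\lambda_M=\sum_jm_j\lambda_{I_j}\in\Lambda$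 with $\lambda_{[a,b)}=t^a-t^b$ for $b<\infty$ and $\lambda_{[a,\infty)}=t^a$. For a graded persistence module $M_\bullet$ put $\lambda_{M_\bullet}=\sum_i(-1)^i\lambda_{M_i}$. Triangulated persistence category (TPC): a persistence category $\mathcal C$ is a category whose morphisms are persistence modules $\hom_{\mathcal C}(A,B)=\{\hom^s_{\mathcal C}(A,B)\}_s$ with composition bilinear maps $\hom^r(A,B)\times\hom^s(B,C)\to\hom^{r+s}(A,C)$ compatible with the maps $i_{s,t}$, identities lying in $\hom^0$. $\mathcal C_0$ has the same objects and morphisms $\hom^0_{\mathcal C}$. $\mathcal C$ carries a shift functor: functors $\Sigma^r$, $r\in\mathbb R$, compatible with the persistence structure, $\Sigma^r\Sigma^s=\Sigma^{r+s}$, $\Sigma^0=\mathrm{id}$, with natural isomorphisms $\eta_{r,s}:\Sigma^r\to\Sigma^s$, $(\eta_{r,s})_X\in\hom^{s-r}(\Sigma^rX,\Sigma^sX)$, satisfying the natural compatibility relations, $\eta_{r,r}=\mathrm{id}$. For $r\ge0$ put $\eta_r^X=i_{-r,0}((\eta_{r,0})_X)\in\hom^0(\Sigma^rX,X)$. An object $K$ is $r$-acyclic if $i_{0,r}(\mathrm{id}_K)=0$. $\mathcal C$ is a TPC if moreover $\mathcal C_0$ is triangulated (translation functor $T$), $\Sigma^r$ is triangulated on $\mathcal C_0$, the $\eta_{r,s}$ are compatible with the additive structure, and for every $X$ and $r\ge 0$ there is an exact triangle $\Sigma^rX\xrightarrow{\eta_r^X}X\to K\to T\Sigma^rX$ in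 $\mathcal C_0$ with $K$ $r$-acyclic. $\mathcal C$ is tame if $\dim\hom^s_{\mathcal C}(A,B)<\infty$ for all $A,B,s$, and bounded if for all $X,Y$ there is $l$ with $\hom_{\mathcal C}(X,T^iY)=0$ for $|i|\ge l$. $\hom_{\mathcal C}(X,T^\bullet N)$ is the graded persistence module equal to $\hom_{\mathcal C}(X,T^iN)$ in degree $i$. $K(\mathcal C):=K(\mathcal C_0)$ is the Grothendieck group of the triangulated category $\mathcal C_0$, a $\Lambda_P$-module by $t^r\cdot[A]=[\Sigma^rA]$. $\overline{K(\mathcal C)}$ is the same group with the reversed structure in which $t^r$ acts by $[A]\mapsto[\Sigma^{-r}A]$.
   Formalization: The formal theorem also assumes that in every hom_C(A,B) the structure maps are isomorphisms just to the left of each s, i.e. finitely many bars start below any level; otherwise, e.g. for ⊕_n[-1/n,0), λ_M is not an element of Λ. *)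

theory Defs
  imports
    "HOL-Algebra.Module"
    "HOL-Algebra.Coset"
    "HOL-Algebra.Generated_Groups"
    "HOL-Algebra.Free_Abelian_Groups"
    "HOL-Library.Poly_Mapping"
    "HOL-Library.Groups_Big_Fun"
    "HOL-Library.Extended_Real"
begin

section \<open>Novikov rings\<close>

text \<open>
  A series \<open>\<Sum>\<^sub>k n\<^sub>k t\<^sup>a\<^sub>k\<close> with \<open>a\<^sub>k \<rightarrow> \<infinity>\<close> is encoded by its coefficient function: exactly the functions
  that have only finitely many nonzero values below each level arise.
\<close>

definition novikov :: "(real \<Rightarrow> int) ring" where
  "novikov =
     \<lparr> carrier = {f. \<forall>c. finite {a. a \<le> c \<and> f a \<noteq> 0}},
       monoid.mult = (\<lambda>f g c. Sum_any (\<lambda>a. f a * g (c - a))),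
       monoid.one = (\<lambda>a. if a = 0 then 1 else 0),
       ring.zero = (\<lambda>_. 0),
       ring.add = (\<lambda>f g a. f a + g a) \<rparr>"

definition novikov_P :: "(real \<Rightarrow> int) ring" where
  "novikov_P = novikov \<lparr> carrier := {f. finite {a. f a \<noteq> 0}} \<rparr>"

definition novikov_module :: "(real \<Rightarrow> int, real \<Rightarrow> int) module" where
  "novikov_module =
     \<lparr> carrier = carrier novikov, monoid.mult = monoid.mult novikov, monoid.one = monoid.one novikov,
       ring.zero = ring.zero novikov, ring.add = ring.add novikov, smult = monoid.mult novikov \<rparr>"


section \<open>Persistence modules and barcodes\<close>

definition linear_between ::
    "('k \<Rightarrow> 'v \<Rightarrow> 'v) \<Rightarrow> ('k \<Rightarrow> 'w \<Rightarrow> 'w) \<Rightarrow> 'v::plus set \<Rightarrow> 'w::plus set \<Rightarrow> ('v \<Rightarrow> 'w) \<Rightarrow> bool" where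
  "linear_between sV sW V W f \<longleftrightarrow>
     f \<in> V \<rightarrow> W \<and>
     (\<forall>x\<in>V. \<forall>y\<in>V. f (x + y) = f x + f y) \<and>
     (\<forall>c. \<forall>x\<in>V. f (sV c x) = sW c (f x))"

definition finite_dimensional ::
    "('k::field \<Rightarrow> 'v::ab_group_add \<Rightarrow> 'v) \<Rightarrow> 'v set \<Rightarrow> bool" where
  "finite_dimensional sV V \<longleftrightarrow> (\<exists>B. finite B \<and> Modules.module.span sV B = V)"

text \<open>
  The spaces \<open>M\<^sup>s\<close> are subspaces of one ambient vector space; this is no restriction, because any
  family of vector spaces embeds into its direct sum.
\<close>

record ('k, 'v) pmod =
  pscale :: "'k \<Rightarrow> 'v \<Rightarrow> 'v"
  pspace :: "real \<Rightarrow> 'v set"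
  pmap :: "real \<Rightarrow> real \<Rightarrow> 'v \<Rightarrow> 'v"

locale persistence_module =
  fixes M :: "('k::field, 'v::ab_group_add) pmod"
  assumes ambient: "vector_space (pscale M)"
    and subspaces: "Modules.module.subspace (pscale M) (pspace M s)"
    and linear: "s \<le> t \<Longrightarrow> linear_between (pscale M) (pscale M) (pspace M s) (pspace M t) (pmap M s t)"
    and map_refl: "x \<in> pspace M s \<Longrightarrow> pmap M s s x = x"
    and map_trans: "s \<le> t \<Longrightarrow> t \<le> r \<Longrightarrow> x \<in> pspace M s \<Longrightarrow> pmap M t r (pmap M s t x) = pmap M s r x"
    and lower_semicontinuous:
      "\<exists>\<epsilon>>0. \<forall>t. s \<le> t \<and> t < s + \<epsilon> \<longrightarrow> bij_betw (pmap M s t) (pspace M s) (pspace M t)"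
    and lower_bounded: "\<exists>s\<^sub>0. \<forall>s\<le>s\<^sub>0. pspace M s = {0}"

definition pmod_isomorphic ::
    "('k, 'v::plus) pmod \<Rightarrow> ('k, 'w::plus) pmod \<Rightarrow> bool" where
  "pmod_isomorphic M N \<longleftrightarrow>
     (\<exists>\<phi>. (\<forall>s. linear_between (pscale M) (pscale N) (pspace M s) (pspace N s) (\<phi> s) \<and>
                bij_betw (\<phi> s) (pspace M s) (pspace N s)) \<and>
          (\<forall>s t. s \<le> t \<longrightarrow> (\<forall>x\<in>pspace M s. \<phi> t (pmap M s t x) = pmap N s t (\<phi> s x))))"

text \<open>The pair \<open>(a, b)\<close> stands for the bar \<open>[a, b)\<close>.\<close>

type_synonym bar = "real \<times> ereal"

definition interval_module :: "bar \<Rightarrow> ('k::field, 'k) pmod" where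
  "interval_module I =
     \<lparr> pscale = (*),
       pspace = (\<lambda>s. if fst I \<le> s \<and> ereal s < snd I then UNIV else {0}),
       pmap = (\<lambda>s t x. if ereal t < snd I then x else 0) \<rparr>"

definition direct_sum_pmod ::
    "'j set \<Rightarrow> ('j \<Rightarrow> ('k, 'v::zero) pmod) \<Rightarrow> ('k, 'j \<Rightarrow>\<^sub>0 'v) pmod" where
  "direct_sum_pmod J M =
     \<lparr> pscale = (\<lambda>c. Poly_Mapping.mapp (\<lambda>j. pscale (M j) c)),
       pspace = (\<lambda>s. {x. Poly_Mapping.keys x \<subseteq> J \<and>
                        (\<forall>j\<in>J. Poly_Mapping.lookup x j \<in> pspace (M j) s)}),
       pmap = (\<lambda>s t. Poly_Mapping.mapp (\<lambda>j. pmap (M j) s t)) \<rparr>"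

text \<open>A barcode is given by its multiplicity function.\<close>

definition is_barcode :: "('k::field, 'v::ab_group_add) pmod \<Rightarrow> (bar \<Rightarrow> nat) \<Rightarrow> bool" where
  "is_barcode M m \<longleftrightarrow>
     (\<forall>a b. m (a, b) \<noteq> 0 \<longrightarrow> ereal a < b) \<and>
     pmod_isomorphic M
       (direct_sum_pmod {(I, j). j < m I} (\<lambda>(I, j). interval_module I :: ('k, 'k) pmod))"

definition barcode :: "('k::field, 'v::ab_group_add) pmod \<Rightarrow> bar \<Rightarrow> nat" where
  "barcode M = (SOME m. is_barcode M m)"

definition lambda_bar :: "bar \<Rightarrow> real \<Rightarrow> int" where
  "lambda_bar I x = (if x = fst I then 1 else 0) - (if ereal x = snd I then 1 else 0)"

definition lambda_pmod :: "('k::field, 'v::ab_group_add) pmod \<Rightarrow> real \<Rightarrow> int" where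
  "lambda_pmod M x = Sum_any (\<lambda>I. int (barcode M I) * lambda_bar I x)"

definition lambda_graded :: "(int \<Rightarrow> ('k::field, 'v::ab_group_add) pmod) \<Rightarrow> real \<Rightarrow> int" where
  "lambda_graded M x = Sum_any (\<lambda>i. (if even i then 1 else - 1) * lambda_pmod (M i) x)"


section \<open>Triangulated categories\<close>

text \<open>
  Objects form a whole type, and the morphism spaces are subspaces of one ambient vector space.
  Composition is written in diagrammatic order: \<open>Cmp C A B D f g\<close> is the composite of \<open>f : A \<rightarrow> B\<close> and
  \<open>g : B \<rightarrow> D\<close>. The translation functor, an automorphism of the category, is \<open>Tob\<close> on objects and
  \<open>Tmor\<close> on morphisms. A sextuple \<open>(A, B, D, u, v, w)\<close> in \<open>Exact\<close> is an exact triangle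
  \<open>A \<rightarrow> B \<rightarrow> D \<rightarrow> T A\<close>.
\<close>

record ('k, 'v, 'o) tri_cat =
  Scale :: "'k \<Rightarrow> 'v \<Rightarrow> 'v"
  Hom :: "'o \<Rightarrow> 'o \<Rightarrow> 'v set"
  Cmp :: "'o \<Rightarrow> 'o \<Rightarrow> 'o \<Rightarrow> 'v \<Rightarrow> 'v \<Rightarrow> 'v"
  Idn :: "'o \<Rightarrow> 'v"
  Tob :: "'o \<Rightarrow> 'o"
  Tmor :: "'o \<Rightarrow> 'o \<Rightarrow> 'v \<Rightarrow> 'v"
  Exact :: "('o \<times> 'o \<times> 'o \<times> 'v \<times> 'v \<times> 'v) set"

definition iso_in :: "('k, 'v, 'o) tri_cat \<Rightarrow> 'o \<Rightarrow> 'o \<Rightarrow> 'v \<Rightarrow> bool" where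
  "iso_in C A B f \<longleftrightarrow>
     f \<in> Hom C A B \<and> (\<exists>g\<in>Hom C B A. Cmp C A B A f g = Idn C A \<and> Cmp C B A B g f = Idn C B)"

definition zero_object :: "('k, 'v::zero, 'o) tri_cat \<Rightarrow> 'o \<Rightarrow> bool" where
  "zero_object C Z \<longleftrightarrow> (\<forall>A. Hom C A Z = {0} \<and> Hom C Z A = {0})"

locale additive_category =
  fixes C :: "('k::field, 'v::ab_group_add, 'o) tri_cat"
  assumes ambient: "vector_space (Scale C)"
    and hom_subspace: "Modules.module.subspace (Scale C) (Hom C A B)"
    and comp_linear_left: "g \<in> Hom C B D \<Longrightarrow>
      linear_between (Scale C) (Scale C) (Hom C A B) (Hom C A D) (\<lambda>f. Cmp C A B D f g)"
    and comp_linear_right: "f \<in> Hom C A B \<Longrightarrow>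
      linear_between (Scale C) (Scale C) (Hom C B D) (Hom C A D) (\<lambda>g. Cmp C A B D f g)"
    and comp_assoc: "f \<in> Hom C A B \<Longrightarrow> g \<in> Hom C B D \<Longrightarrow> h \<in> Hom C D E \<Longrightarrow>
      Cmp C A D E (Cmp C A B D f g) h = Cmp C A B E f (Cmp C B D E g h)"
    and id_closed: "Idn C A \<in> Hom C A A"
    and id_left: "f \<in> Hom C A B \<Longrightarrow> Cmp C A A B (Idn C A) f = f"
    and id_right: "f \<in> Hom C A B \<Longrightarrow> Cmp C A B B f (Idn C B) = f"
    and has_zero: "\<exists>Z. zero_object C Z"
    and has_biproducts: "\<exists>P. \<exists>\<iota>\<in>Hom C A P. \<exists>\<kappa>\<in>Hom C B P. \<exists>\<pi>\<in>Hom C P A. \<exists>\<rho>\<in>Hom C P B.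
      Cmp C A P A \<iota> \<pi> = Idn C A \<and> Cmp C B P B \<kappa> \<rho> = Idn C B \<and>
      Cmp C A P B \<iota> \<rho> = 0 \<and> Cmp C B P A \<kappa> \<pi> = 0 \<and>
      Cmp C P A P \<pi> \<iota> + Cmp C P B P \<rho> \<kappa> = Idn C P"

locale triangulated_category = additive_category C
  for C :: "('k::field, 'v::ab_group_add, 'o) tri_cat" +
  assumes T_bij_ob: "bij (Tob C)"
    and T_linear: "linear_between (Scale C) (Scale C) (Hom C A B) (Hom C (Tob C A) (Tob C B)) (Tmor C A B)"
    and T_bij_mor: "bij_betw (Tmor C A B) (Hom C A B) (Hom C (Tob C A) (Tob C B))"
    and T_id: "Tmor C A A (Idn C A) = Idn C (Tob C A)"
    and T_comp: "f \<in> Hom C A B \<Longrightarrow> g \<in> Hom C B D \<Longrightarrow>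
      Tmor C A D (Cmp C A B D f g) =
      Cmp C (Tob C A) (Tob C B) (Tob C D) (Tmor C A B f) (Tmor C B D g)"
    and exact_type: "(A, B, D, u, v, w) \<in> Exact C \<Longrightarrow>
      u \<in> Hom C A B \<and> v \<in> Hom C B D \<and> w \<in> Hom C D (Tob C A)"
    and TR1_id: "zero_object C Z \<Longrightarrow> (A, A, Z, Idn C A, 0, 0) \<in> Exact C"
    and TR1_cone: "u \<in> Hom C A B \<Longrightarrow> \<exists>D v w. (A, B, D, u, v, w) \<in> Exact C"
    and TR1_iso: "(A, B, D, u, v, w) \<in> Exact C \<Longrightarrow>
      u' \<in> Hom C A' B' \<Longrightarrow> v' \<in> Hom C B' D' \<Longrightarrow> w' \<in> Hom C D' (Tob C A') \<Longrightarrow>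
      iso_in C A A' f \<Longrightarrow> iso_in C B B' g \<Longrightarrow> iso_in C D D' h \<Longrightarrow>
      Cmp C A B B' u g = Cmp C A A' B' f u' \<Longrightarrow>
      Cmp C B D D' v h = Cmp C B B' D' g v' \<Longrightarrow>
      Cmp C D (Tob C A) (Tob C A') w (Tmor C A A' f) = Cmp C D D' (Tob C A') h w' \<Longrightarrow>
      (A', B', D', u', v', w') \<in> Exact C"
    and TR2: "u \<in> Hom C A B \<Longrightarrow> v \<in> Hom C B D \<Longrightarrow> w \<in> Hom C D (Tob C A) \<Longrightarrow>
      (A, B, D, u, v, w) \<in> Exact C \<longleftrightarrow> (B, D, Tob C A, v, w, - Tmor C A B u) \<in> Exact C"
    and TR3: "(A, B, D, u, v, w) \<in> Exact C \<Longrightarrow> (A', B', D', u', v', w') \<in> Exact C \<Longrightarrow>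
      f \<in> Hom C A A' \<Longrightarrow> g \<in> Hom C B B' \<Longrightarrow>
      Cmp C A B B' u g = Cmp C A A' B' f u' \<Longrightarrow>
      \<exists>h\<in>Hom C D D'.
        Cmp C B D D' v h = Cmp C B B' D' g v' \<and>
        Cmp C D (Tob C A) (Tob C A') w (Tmor C A A' f) = Cmp C D D' (Tob C A') h w'"
    and TR4: "(X, Y, Z', u, j, k) \<in> Exact C \<Longrightarrow> (Y, Z, X', v, l, i) \<in> Exact C \<Longrightarrow>
      (X, Z, Y', Cmp C X Y Z u v, m, n) \<in> Exact C \<Longrightarrow>
      \<exists>f\<in>Hom C Z' Y'. \<exists>g\<in>Hom C Y' X'.
        (Z', Y', X', f, g, Cmp C X' (Tob C Y) (Tob C Z') i (Tmor C Y Z' j)) \<in> Exact C \<and>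
        Cmp C Z Y' X' m g = l \<and>
        Cmp C Z' Y' (Tob C X) f n = k \<and>
        Cmp C Y' X' (Tob C Y) g i = Cmp C Y' (Tob C X) (Tob C Y) n (Tmor C X Y u) \<and>
        Cmp C Y Z' Y' j f = Cmp C Y Z Y' v m"


section \<open>Triangulated persistence categories\<close>

text \<open>
  \<open>PHom C A B s\<close> is \<open>hom\<^sup>s(A, B)\<close>, with structure maps \<open>PMap C A B s t\<close>. Composition
  \<open>PCmp C r s A B D f g\<close> of \<open>f \<in> hom\<^sup>r(A, B)\<close> and \<open>g \<in> hom\<^sup>s(B, D)\<close> is again diagrammatic. \<open>Sob C r\<close> and
  \<open>Smor C r s A B\<close> are the shift functor \<open>\<Sigma>\<^sup>r\<close> on objects and on \<open>hom\<^sup>s(A, B)\<close>, and \<open>Eta C r s X\<close> is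
  \<open>(\<eta>\<^sub>r\<^sub>,\<^sub>s)\<^sub>X\<close>. The translation functor and the exact triangles only concern the degree-zero part.
\<close>

record ('k, 'v, 'o) pers_cat =
  PScale :: "'k \<Rightarrow> 'v \<Rightarrow> 'v"
  PHom :: "'o \<Rightarrow> 'o \<Rightarrow> real \<Rightarrow> 'v set"
  PMap :: "'o \<Rightarrow> 'o \<Rightarrow> real \<Rightarrow> real \<Rightarrow> 'v \<Rightarrow> 'v"
  PCmp :: "real \<Rightarrow> real \<Rightarrow> 'o \<Rightarrow> 'o \<Rightarrow> 'o \<Rightarrow> 'v \<Rightarrow> 'v \<Rightarrow> 'v"
  PId :: "'o \<Rightarrow> 'v"
  Sob :: "real \<Rightarrow> 'o \<Rightarrow> 'o"
  Smor :: "real \<Rightarrow> real \<Rightarrow> 'o \<Rightarrow> 'o \<Rightarrow> 'v \<Rightarrow> 'v"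
  Eta :: "real \<Rightarrow> real \<Rightarrow> 'o \<Rightarrow> 'v"
  PTob :: "'o \<Rightarrow> 'o"
  PTmor :: "'o \<Rightarrow> 'o \<Rightarrow> 'v \<Rightarrow> 'v"
  PExact :: "('o \<times> 'o \<times> 'o \<times> 'v \<times> 'v \<times> 'v) set"

definition hom_pmod :: "('k, 'v, 'o) pers_cat \<Rightarrow> 'o \<Rightarrow> 'o \<Rightarrow> ('k, 'v) pmod" where
  "hom_pmod C A B = \<lparr> pscale = PScale C, pspace = PHom C A B, pmap = PMap C A B \<rparr>"

definition degree_zero :: "('k, 'v, 'o) pers_cat \<Rightarrow> ('k, 'v, 'o) tri_cat" where
  "degree_zero C =
     \<lparr> Scale = PScale C, Hom = (\<lambda>A B. PHom C A B 0), Cmp = PCmp C 0 0, Idn = PId C,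
       Tob = PTob C, Tmor = PTmor C, Exact = PExact C \<rparr>"

locale persistence_category =
  fixes C :: "('k::field, 'v::ab_group_add, 'o) pers_cat"
  assumes hom_persistence: "persistence_module (hom_pmod C A B)"
    and comp_linear_left: "g \<in> PHom C B D s \<Longrightarrow>
      linear_between (PScale C) (PScale C) (PHom C A B r) (PHom C A D (r + s)) (\<lambda>f. PCmp C r s A B D f g)"
    and comp_linear_right: "f \<in> PHom C A B r \<Longrightarrow>
      linear_between (PScale C) (PScale C) (PHom C B D s) (PHom C A D (r + s)) (\<lambda>g. PCmp C r s A B D f g)"
    and comp_map: "f \<in> PHom C A B r \<Longrightarrow> g \<in> PHom C B D s \<Longrightarrow> r \<le> r' \<Longrightarrow> s \<le> s' \<Longrightarrow>
      PCmp C r' s' A B D (PMap C A B r r' f) (PMap C B D s s' g) =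
      PMap C A D (r + s) (r' + s') (PCmp C r s A B D f g)"
    and comp_assoc: "f \<in> PHom C A B r \<Longrightarrow> g \<in> PHom C B D s \<Longrightarrow> h \<in> PHom C D E t \<Longrightarrow>
      PCmp C (r + s) t A D E (PCmp C r s A B D f g) h = PCmp C r (s + t) A B E f (PCmp C s t B D E g h)"
    and id_closed: "PId C A \<in> PHom C A A 0"
    and id_left: "f \<in> PHom C A B r \<Longrightarrow> PCmp C 0 r A A B (PId C A) f = f"
    and id_right: "f \<in> PHom C A B r \<Longrightarrow> PCmp C r 0 A B B f (PId C B) = f"

text \<open>
  The shift functor is a strict monoidal functor from \<open>(\<real>, +)\<close>, with one arrow \<open>r \<rightarrow> s\<close> for each pair,
  to persistence endofunctors; \<open>shift_eta\<close> and \<open>eta_shift\<close> are its compatibility with the monoidal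
  structure. By \<open>eta_trans\<close> and \<open>eta_refl\<close> every \<open>(\<eta>\<^sub>r\<^sub>,\<^sub>s)\<^sub>X\<close> is invertible, with inverse \<open>(\<eta>\<^sub>s\<^sub>,\<^sub>r)\<^sub>X\<close>.
\<close>

locale shift_persistence_category = persistence_category C
  for C :: "('k::field, 'v::ab_group_add, 'o) pers_cat" +
  assumes shift_linear:
      "linear_between (PScale C) (PScale C) (PHom C A B s) (PHom C (Sob C r A) (Sob C r B) s) (Smor C r s A B)"
    and shift_map: "f \<in> PHom C A B s \<Longrightarrow> s \<le> t \<Longrightarrow>
      Smor C r t A B (PMap C A B s t f) = PMap C (Sob C r A) (Sob C r B) s t (Smor C r s A B f)"
    and shift_id: "Smor C r 0 A A (PId C A) = PId C (Sob C r A)"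
    and shift_comp: "f \<in> PHom C A B s \<Longrightarrow> g \<in> PHom C B D t \<Longrightarrow>
      Smor C r (s + t) A D (PCmp C s t A B D f g) =
      PCmp C s t (Sob C r A) (Sob C r B) (Sob C r D) (Smor C r s A B f) (Smor C r t B D g)"
    and shift_zero_ob: "Sob C 0 A = A"
    and shift_zero_mor: "f \<in> PHom C A B s \<Longrightarrow> Smor C 0 s A B f = f"
    and shift_add_ob: "Sob C r (Sob C q A) = Sob C (r + q) A"
    and shift_add_mor: "f \<in> PHom C A B s \<Longrightarrow>
      Smor C r s (Sob C q A) (Sob C q B) (Smor C q s A B f) = Smor C (r + q) s A B f"
    and eta_closed: "Eta C r s X \<in> PHom C (Sob C r X) (Sob C s X) (s - r)"
    and eta_natural: "f \<in> PHom C X Y q \<Longrightarrow>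
      PCmp C q (s - r) (Sob C r X) (Sob C r Y) (Sob C s Y) (Smor C r q X Y f) (Eta C r s Y) =
      PCmp C (s - r) q (Sob C r X) (Sob C s X) (Sob C s Y) (Eta C r s X) (Smor C s q X Y f)"
    and eta_refl: "Eta C r r X = PId C (Sob C r X)"
    and eta_trans: "PCmp C (s - r) (t - s) (Sob C r X) (Sob C s X) (Sob C t X) (Eta C r s X) (Eta C s t X) =
      Eta C r t X"
    and shift_eta: "Smor C q (s - r) (Sob C r X) (Sob C s X) (Eta C r s X) = Eta C (q + r) (q + s) X"
    and eta_shift: "Eta C r s (Sob C q X) = Eta C (r + q) (s + q) X"

definition eta_map :: "('k, 'v, 'o) pers_cat \<Rightarrow> real \<Rightarrow> 'o \<Rightarrow> 'v" where
  "eta_map C r X = PMap C (Sob C r X) X (- r) 0 (Eta C r 0 X)"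

definition acyclic_object :: "('k, 'v::zero, 'o) pers_cat \<Rightarrow> real \<Rightarrow> 'o \<Rightarrow> bool" where
  "acyclic_object C r K \<longleftrightarrow> PMap C K K 0 r (PId C K) = 0"

text \<open>
  \<open>shift_exact\<close> says that \<open>\<Sigma>\<^sup>r\<close> is a triangulated functor: it commutes with \<open>T\<close> up to a natural
  isomorphism \<open>\<theta> : \<Sigma>\<^sup>r T \<rightarrow> T \<Sigma>\<^sup>r\<close> of functors on the degree-zero category and carries exact triangles
  to exact ones. Additivity of \<open>\<Sigma>\<^sup>r\<close> is part of \<open>shift_linear\<close>. Compatibility of \<open>\<eta>\<^sub>r\<^sub>,\<^sub>s\<close> and of the structure maps with direct sums follows from
  \<open>eta_natural\<close>, \<open>comp_map\<close> and bilinearity of composition.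
\<close>

locale triangulated_persistence_category = shift_persistence_category C
  for C :: "('k::field, 'v::ab_group_add, 'o) pers_cat" +
  assumes degree_zero_triangulated: "triangulated_category (degree_zero C)"
    and shift_exact: "\<exists>\<theta>.
      (\<forall>A. iso_in (degree_zero C) (Sob C r (PTob C A)) (PTob C (Sob C r A)) (\<theta> A)) \<and>
      (\<forall>A B. \<forall>f\<in>PHom C A B 0.
        PCmp C 0 0 (Sob C r (PTob C A)) (Sob C r (PTob C B)) (PTob C (Sob C r B))
          (Smor C r 0 (PTob C A) (PTob C B) (PTmor C A B f)) (\<theta> B) =
        PCmp C 0 0 (Sob C r (PTob C A)) (PTob C (Sob C r A)) (PTob C (Sob C r B))
          (\<theta> A) (PTmor C (Sob C r A) (Sob C r B) (Smor C r 0 A B f))) \<and>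
      (\<forall>A B D u v w. (A, B, D, u, v, w) \<in> PExact C \<longrightarrow>
        (Sob C r A, Sob C r B, Sob C r D, Smor C r 0 A B u, Smor C r 0 B D v,
         PCmp C 0 0 (Sob C r D) (Sob C r (PTob C A)) (PTob C (Sob C r A))
           (Smor C r 0 D (PTob C A) w) (\<theta> A)) \<in> PExact C)"
    and eta_cone: "r \<ge> 0 \<Longrightarrow>
      \<exists>K v w. (Sob C r X, X, K, eta_map C r X, v, w) \<in> PExact C \<and> acyclic_object C r K"

definition T_pow :: "('k, 'v, 'o) pers_cat \<Rightarrow> int \<Rightarrow> 'o \<Rightarrow> 'o" where
  "T_pow C i = (if i \<ge> 0 then PTob C ^^ nat i else inv_into UNIV (PTob C) ^^ nat (- i))"

definition tame :: "('k::field, 'v::ab_group_add, 'o) pers_cat \<Rightarrow> bool" where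
  "tame C \<longleftrightarrow> (\<forall>A B s. finite_dimensional (PScale C) (PHom C A B s))"

definition bounded_category :: "('k, 'v::zero, 'o) pers_cat \<Rightarrow> bool" where
  "bounded_category C \<longleftrightarrow>
     (\<forall>X Y. \<exists>l. \<forall>i. \<bar>i\<bar> \<ge> l \<longrightarrow> (\<forall>s. PHom C X (T_pow C i Y) s = {0}))"

text \<open>
  The bars of a lower semicontinuous, lower bounded, pointwise finite-dimensional persistence module
  may accumulate from the left, as in \<open>\<Oplus>\<^sub>n [- 1 / n, 0)\<close>; then \<open>\<Sum>\<^sub>j m\<^sub>j \<lambda>\<^bsub>I\<^sub>j\<^esub>\<close> is not an
  element of the Novikov ring (here \<open>t\<^sup>0\<close> would have coefficient \<open>- \<infinity>\<close>). The following condition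
  says that they do not: for such a module it amounts to only finitely many bars \<open>[a, b)\<close> having
  \<open>a\<close> below any given level.
\<close>

definition no_left_accumulation :: "('k, 'v) pmod \<Rightarrow> bool" where
  "no_left_accumulation M \<longleftrightarrow>
     (\<forall>s. \<exists>\<epsilon>>0. \<forall>t t'. s - \<epsilon> < t \<and> t \<le> t' \<and> t' < s \<longrightarrow>
        bij_betw (pmap M t t') (pspace M t) (pspace M t'))"


section \<open>The Grothendieck group and tensor products\<close>

definition grothendieck_relations :: "('k, 'v, 'o) tri_cat \<Rightarrow> ('o \<Rightarrow>\<^sub>0 int) set" where
  "grothendieck_relations C =
     generate (free_Abelian_group UNIV)
       {frag_of B - frag_of A - frag_of D |A B D. \<exists>u v w. (A, B, D, u, v, w) \<in> Exact C}"

definition grothendieck_group :: "('k, 'v, 'o) tri_cat \<Rightarrow> ('o \<Rightarrow>\<^sub>0 int) set monoid" where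
  "grothendieck_group C = free_Abelian_group UNIV Mod grothendieck_relations C"

text \<open>
  The additive group \<open>G Mod N\<close> with scalar action induced by an action \<open>act\<close> on \<open>G\<close>. The fields \<open>mult\<close>
  and \<open>one\<close> of the record play no role for a module.
\<close>

definition quotient_module ::
    "'g monoid \<Rightarrow> 'g set \<Rightarrow> ('r \<Rightarrow> 'g \<Rightarrow> 'g) \<Rightarrow> ('r, 'g set) module" where
  "quotient_module G N act =
     \<lparr> carrier = carrier (G Mod N), monoid.mult = undefined, monoid.one = undefined,
       ring.zero = monoid.one (G Mod N), ring.add = monoid.mult (G Mod N),
       smult = (\<lambda>p c. \<Union>z\<in>c. N #>\<^bsub>G\<^esub> act p z) \<rparr>"

text \<open>The action \<open>t\<^sup>r \<cdot> A = \<sigma> r A\<close>, extended to finite sums and to the free abelian group on the objects.\<close>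

definition shift_action ::
    "(real \<Rightarrow> 'o \<Rightarrow> 'o) \<Rightarrow> (real \<Rightarrow> int) \<Rightarrow> ('o \<Rightarrow>\<^sub>0 int) \<Rightarrow> ('o \<Rightarrow>\<^sub>0 int)" where
  "shift_action \<sigma> p z =
     (\<Sum>r\<in>{r. p r \<noteq> 0}. frag_cmul (p r) (frag_extend (\<lambda>A. frag_of (\<sigma> r A)) z))"

definition K_relations :: "('k, 'v, 'o) pers_cat \<Rightarrow> ('o \<Rightarrow>\<^sub>0 int) set" where
  "K_relations C = grothendieck_relations (degree_zero C)"

definition K_group :: "('k, 'v, 'o) pers_cat \<Rightarrow> ('o \<Rightarrow>\<^sub>0 int) set monoid" where
  "K_group C = grothendieck_group (degree_zero C)"

definition K_coset :: "('k, 'v, 'o) pers_cat \<Rightarrow> ('o \<Rightarrow>\<^sub>0 int) \<Rightarrow> ('o \<Rightarrow>\<^sub>0 int) set" where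
  "K_coset C z = K_relations C #>\<^bsub>free_Abelian_group UNIV\<^esub> z"

definition K_class :: "('k, 'v, 'o) pers_cat \<Rightarrow> 'o \<Rightarrow> ('o \<Rightarrow>\<^sub>0 int) set" where
  "K_class C A = K_coset C (frag_of A)"

definition K_module :: "('k, 'v, 'o) pers_cat \<Rightarrow> (real \<Rightarrow> int, ('o \<Rightarrow>\<^sub>0 int) set) module" where
  "K_module C = quotient_module (free_Abelian_group UNIV) (K_relations C) (shift_action (Sob C))"

definition K_reversed :: "('k, 'v, 'o) pers_cat \<Rightarrow> (real \<Rightarrow> int, ('o \<Rightarrow>\<^sub>0 int) set) module" where
  "K_reversed C =
     quotient_module (free_Abelian_group UNIV) (K_relations C) (shift_action (\<lambda>r. Sob C (- r)))"

definition tensor_relations ::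
    "('r, 'm) ring_scheme \<Rightarrow> ('r, 'a) module \<Rightarrow> ('r, 'b) module \<Rightarrow> ('a \<times> 'b \<Rightarrow>\<^sub>0 int) set" where
  "tensor_relations R M N =
     generate (free_Abelian_group (carrier M \<times> carrier N))
       ({frag_of (x \<oplus>\<^bsub>M\<^esub> x', y) - frag_of (x, y) - frag_of (x', y) |x x' y.
           x \<in> carrier M \<and> x' \<in> carrier M \<and> y \<in> carrier N} \<union>
        {frag_of (x, y \<oplus>\<^bsub>N\<^esub> y') - frag_of (x, y) - frag_of (x, y') |x y y'.
           x \<in> carrier M \<and> y \<in> carrier N \<and> y' \<in> carrier N} \<union>
        {frag_of (p \<odot>\<^bsub>M\<^esub> x, y) - frag_of (x, p \<odot>\<^bsub>N\<^esub> y) |p x y.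
           p \<in> carrier R \<and> x \<in> carrier M \<and> y \<in> carrier N})"

definition tensor_module ::
    "('r, 'm) ring_scheme \<Rightarrow> ('r, 'a) module \<Rightarrow> ('r, 'b) module \<Rightarrow> ('r, ('a \<times> 'b \<Rightarrow>\<^sub>0 int) set) module" where
  "tensor_module R M N =
     quotient_module (free_Abelian_group (carrier M \<times> carrier N)) (tensor_relations R M N)
       (\<lambda>p. frag_extend (\<lambda>(x, y). frag_of (p \<odot>\<^bsub>M\<^esub> x, y)))"

definition tensor_elem ::
    "('r, 'm) ring_scheme \<Rightarrow> ('r, 'a) module \<Rightarrow> ('r, 'b) module \<Rightarrow> 'a \<Rightarrow> 'b \<Rightarrow> ('a \<times> 'b \<Rightarrow>\<^sub>0 int) set" where
  "tensor_elem R M N x y =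
     tensor_relations R M N #>\<^bsub>free_Abelian_group (carrier M \<times> carrier N)\<^esub> frag_of (x, y)"

definition module_map ::
    "('r, 'm) ring_scheme \<Rightarrow> ('r, 'a) module \<Rightarrow> ('r, 'b) module \<Rightarrow> ('a \<Rightarrow> 'b) \<Rightarrow> bool" where
  "module_map R M N h \<longleftrightarrow>
     Module.module R M \<and> Module.module R N \<and>
     h \<in> carrier M \<rightarrow> carrier N \<and>
     (\<forall>x\<in>carrier M. \<forall>y\<in>carrier M. h (x \<oplus>\<^bsub>M\<^esub> y) = h x \<oplus>\<^bsub>N\<^esub> h y) \<and>
     (\<forall>p\<in>carrier R. \<forall>x\<in>carrier M. h (p \<odot>\<^bsub>M\<^esub> x) = p \<odot>\<^bsub>N\<^esub> h x)"

text \<open>The \<open>\<int>\<close>-linear extension of \<open>N \<mapsto> \<lambda>\<close> of \<open>hom(X, T\<^sup>\<bullet> N)\<close> to the free abelian group on the objects.\<close>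

definition q_tilde ::
    "('k::field, 'v::ab_group_add, 'o) pers_cat \<Rightarrow> 'o \<Rightarrow> ('o \<Rightarrow>\<^sub>0 int) \<Rightarrow> real \<Rightarrow> int" where
  "q_tilde C X z a =
     (\<Sum>N\<in>Poly_Mapping.keys z.
        Poly_Mapping.lookup z N * lambda_graded (\<lambda>i. hom_pmod C X (T_pow C i N)) a)"

end

theory Submission
  imports Defs
begin

text \<open>
  The number \<open>\<lambda>\<^sub>M(x)\<close> counts the bars of \<open>M\<close> that start at \<open>x\<close> minus those that end at \<open>x\<close>. Since \<open>dim M\<^sup>s\<close>
  counts the bars containing \<open>s\<close>, this is the jump \<open>dim M\<^sup>x - dim M\<^sup>t\<close> for all \<open>t < x\<close> close to \<open>x\<close>
  (\<open>lambda_pmod_jump\<close>). So \<open>\<lambda>\<close> depends on dimensions only, and every identity between values of \<open>\<lambda>\<close>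
  reduces to one between dimensions of the spaces \<open>hom\<^sup>s\<close>. The jump formula presupposes that a barcode
  exists, which is the structure theorem \<open>barcode_exists\<close>.

  Structure theorem. Choose, for each bar \<open>[a, b)\<close>, elements of \<open>ker(M\<^sup>a \<rightarrow> M\<^sup>b)\<close> that form a basis of a
  complement of the span of its elements that come from before \<open>a\<close> and of those that die before \<open>b\<close>.
  For every \<open>s\<close>, the images in \<open>M\<^sup>s\<close> of the elements chosen for the bars containing \<open>s\<close> form a basis.
  Independence: in a linear relation, the terms with the latest birth, and among these the latest
  death, lie in that span (\<open>gens_independent\<close>). Generation: induction on the birth, which runs
  through finitely many critical values, and then on the dimension of the kernel
  (\<open>critical_spanned\<close>).

  Additivity. Put \<open>\<chi>\<^sub>s(X, Y) = \<Sum>\<^sub>i (-1)\<^sup>i dim hom\<^sup>s(X, T\<^sup>i Y)\<close>, so that \<open>\<lambda>\<close> of \<open>hom(X, T\<^sup>\<bullet> Y)\<close> at \<open>x\<close> is the jump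
  of \<open>s \<mapsto> \<chi>\<^sub>s(X, Y)\<close> at \<open>x\<close> (\<open>lam_jump\<close>). Composition with the invertible morphisms \<open>\<eta>\<close> identifies
  \<open>hom\<^sup>s(X, Y)\<close> with \<open>hom\<^sup>0(\<Sigma>\<^sup>s X, Y)\<close>, and \<open>\<Sigma>\<^sup>s\<close> preserves exact triangles. In the triangulated category of
  degree-zero morphisms an exact triangle in either variable gives a long exact sequence of
  finite-dimensional spaces with finitely many nonzero terms, hence \<open>\<chi>\<^sub>s\<close> is additive in both variables
  (\<open>chi_add_left\<close>, \<open>chi_add_right\<close>). Therefore the \<open>\<int>\<close>-bilinear extension of \<open>(X, Y) \<mapsto> \<lambda>\<close> vanishes on the
  relations of the Grothendieck group in each variable.

  Scalars. The same identification and \<open>\<Sigma>\<^sup>r T \<cong> T \<Sigma>\<^sup>r\<close> show that \<open>\<chi>\<^sub>s(\<Sigma>\<^bsup>-r\<^esup> X, Y) = \<chi>\<^bsub>s-r\<^esub>(X, Y) = \<chi>\<^sub>s(X, \<Sigma>\<^sup>r Y)\<close>. Both shifts thus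
  multiply \<open>\<lambda>\<close> by \<open>t\<^sup>r\<close> (\<open>lam_shift_left\<close>, \<open>lam_shift_right\<close>): the pairing is balanced when the first factor
  carries the reversed action, and it factors through the tensor product as a \<open>\<Lambda>\<^sub>P\<close>-linear map.
\<close>

section \<open>Dimensions of subspaces\<close>

definition fdim :: "('k::field \<Rightarrow> 'v::ab_group_add \<Rightarrow> 'v) \<Rightarrow> 'v set \<Rightarrow> nat" where
  "fdim s V = vector_space.dim s V"

lemma (in vector_space) span_Int_span_Diff_independent:
  assumes E: "independent E" and AE: "A \<subseteq> E" and y: "y \<in> span A" "y \<in> span (E - A)"
  shows "y = 0"
proof -
  obtain F c where F: "finite F" "F \<subseteq> A" "y = (\<Sum>b\<in>F. scale (c b) b)"
    using y(1) unfolding span_explicit by blast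
  obtain H d where H: "finite H" "H \<subseteq> E - A" "y = (\<Sum>b\<in>H. scale (d b) b)"
    using y(2) unfolding span_explicit by blast
  let ?e = "\<lambda>b. if b \<in> F then - c b else d b"
  have disj: "F \<inter> H = {}" using F H by auto
  have "(\<Sum>b\<in>F \<union> H. scale (?e b) b) = (\<Sum>b\<in>F. scale (?e b) b) + (\<Sum>b\<in>H. scale (?e b) b)"
    using sum.union_disjoint[OF F(1) H(1) disj] .
  also have "(\<Sum>b\<in>F. scale (?e b) b) = - y" unfolding F(3) by (simp add: sum_negf cong: sum.cong)
  also have "(\<Sum>b\<in>H. scale (?e b) b) = y" unfolding H(3) using disj by (intro sum.cong) auto
  finally have "(\<Sum>b\<in>F \<union> H. scale (?e b) b) = 0" by simp
  then have "\<forall>b\<in>F \<union> H. ?e b = 0"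
    using independentD[OF E, where u = ?e and t = "F \<union> H"] F H AE by blast
  then have "\<forall>b\<in>F. c b = 0" by (metis UnI1 neg_equal_0_iff_equal)
  then show ?thesis unfolding F(3) by simp
qed

text \<open>
  Closure of the subspace is proved together with linearity, because the induction step applies
  additivity to the partial sum.
\<close>

lemma linear_between_sum_scale:
  assumes "vector_space s1" "vector_space s2" "Modules.module.subspace s1 V" "linear_between s1 s2 V W f" "finite B" "B \<subseteq> V"
  shows "f (\<Sum>b\<in>B. s1 (c b) b) = (\<Sum>b\<in>B. s2 (c b) (f b)) \<and> (\<Sum>b\<in>B. s1 (c b) b) \<in> V"
  using assms(5,6)
proof (induction rule: finite_induct)
  case empty
  interpret v1: vector_space s1 by fact
  interpret v2: vector_space s2 by fact
  have z: "0 \<in> V" using assms(3) by (rule v1.subspace_0)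
  have "f (0+0) = f 0 + f 0" using assms(4) z unfolding linear_between_def by blast
  then show ?case using z by simp
next
  case (insert x F)
  interpret v1: vector_space s1 by fact
  interpret v2: vector_space s2 by fact
  have "x \<in> V" using insert by auto
  moreover have "s1 (c x) x \<in> V" using assms(3) calculation by (rule v1.subspace_scale)
  moreover have "f (s1 (c x) x) = s2 (c x) (f x)" using assms(4) calculation(1) unfolding linear_between_def by blast
  moreover have "f (s1 (c x) x + (\<Sum>b\<in>F. s1 (c b) b)) = f (s1 (c x) x) + f (\<Sum>b\<in>F. s1 (c b) b)"
    using assms(4) insert calculation(2) unfolding linear_between_def by blast
  ultimately show ?case using insert by (simp add: v1.subspace_add[OF assms(3)])
qed

text \<open>
  The map need only be linear on a subspace and the two ambient spaces may differ. On a basis of the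
  subspace it agrees with a globally linear map, whose restriction to a complement of the kernel is
  injective.
\<close>

lemma rank_nullity:
  fixes s1 :: "'k::field \<Rightarrow> 'v::ab_group_add \<Rightarrow> 'v" and s2 :: "'k \<Rightarrow> 'w::ab_group_add \<Rightarrow> 'w"
  assumes vs: "vector_space s1" "vector_space s2"
    and V: "Modules.module.subspace s1 V" and fd: "finite_dimensional s1 V"
    and f: "linear_between s1 s2 V W f"
  shows "fdim s1 V = fdim s1 {x\<in>V. f x = 0} + fdim s2 (f ` V)"
proof -
  interpret vector_space_pair s1 s2 using vs by (simp add: vector_space_pair_def)
  obtain G where G: "finite G" "vs1.span G = V" using fd unfolding finite_dimensional_def by blast
  obtain B where B: "B \<subseteq> V" "vs1.independent B" "V \<subseteq> vs1.span B"
    by (rule vs1.maximal_independent_subset)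
  \<comment> \<open>the globally linear map that agrees with \<open>f\<close> on \<open>V\<close>\<close>
  let ?g = "construct B f"
  have lg: "Vector_Spaces.linear s1 s2 ?g" using B(2) by (rule linear_construct)
  interpret g: Vector_Spaces.linear s1 s2 ?g by (rule lg)
  have finB: "finite X" if "vs1.independent X" "X \<subseteq> V" for X
    using vs1.independent_span_bound[OF G(1) that(1)] that(2) G(2) by blast
  have gB: "?g b = f b" if "b \<in> B" for b using construct_basis[OF B(2) that] .
  have gf: "?g x = f x" if "x \<in> V" for x
  proof -
    have "x \<in> vs1.span B" using that B by blast
    then obtain c where c: "x = (\<Sum>b\<in>B. s1 (c b) b)"
      using vs1.span_finite[OF finB[OF B(2,1)]] by blast
    have "f x = (\<Sum>b\<in>B. s2 (c b) (f b))"
      using linear_between_sum_scale[OF vs V f finB[OF B(2,1)] B(1)] c by auto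
    moreover have "?g x = (\<Sum>b\<in>B. s2 (c b) (f b))"
      unfolding c g.sum g.scale using gB by simp
    ultimately show ?thesis by simp
  qed
  let ?K = "{x\<in>V. f x = 0}"
  have Keq: "?K = {x\<in>V. ?g x = 0}" using gf by auto
  have K: "vs1.subspace ?K"
    unfolding Keq using V by (auto simp: vs1.subspace_def g.add g.scale)
  obtain A where A: "A \<subseteq> ?K" "vs1.independent A" "?K \<subseteq> vs1.span A"
    by (rule vs1.maximal_independent_subset)
  obtain E where E: "A \<subseteq> E" "E \<subseteq> V" "vs1.independent E" "V \<subseteq> vs1.span E"
    using vs1.maximal_independent_subset_extend[of A V] A by blast
  have finE: "finite E" using finB E by blast
  let ?D = "E - A"
  have iD: "vs1.independent ?D" using E(3) vs1.independent_mono by blast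
  have sV: "vs1.span E = V" using E vs1.span_minimal[OF E(2) V] by blast
  have inj: "inj_on ?g (vs1.span ?D)"
    unfolding g.inj_on_iff_eq_0[OF vs1.subspace_span]
  proof (intro ballI impI)
    fix x assume x: "x \<in> vs1.span ?D" "?g x = 0"
    have "x \<in> V" using x(1) vs1.span_mono[of ?D E] sV by blast
    then have "x \<in> vs1.span A" using x A(3) Keq by blast
    then show "x = 0" using vs1.span_Int_span_Diff_independent[OF E(3,1)] x(1) by blast
  qed
  have im: "vs2.span (f ` V) = vs2.span (?g ` ?D)"
  proof -
    have "f ` V = ?g ` vs1.span E" using gf sV by auto
    also have "\<dots> = vs2.span (?g ` E)" by (simp add: g.span_image)
    also have "\<dots> = vs2.span (?g ` ?D)"
    proof
      show "vs2.span (?g ` E) \<subseteq> vs2.span (?g ` ?D)"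
      proof (rule vs2.span_minimal[OF _ vs2.subspace_span], rule image_subsetI)
        fix x assume "x \<in> E"
        then show "?g x \<in> vs2.span (?g ` ?D)"
        proof (cases "x \<in> A")
          case True
          then have "?g x = 0" using A(1) Keq by blast
          then show ?thesis by (simp add: vs2.span_zero)
        qed (use \<open>x \<in> E\<close> in \<open>auto intro: vs2.span_base\<close>)
      qed
      show "vs2.span (?g ` ?D) \<subseteq> vs2.span (?g ` E)" by (rule vs2.span_mono) auto
    qed
    finally show ?thesis by simp
  qed
  have indim: "vs2.independent (?g ` ?D)"
    by (rule linear_independent_injective_image[OF lg iD inj])
  have "vs2.dim (f ` V) = card (?g ` ?D)"
    using vs2.dim_eq_card[OF _ indim] im by simp
  also have "\<dots> = card ?D"
    using inj_on_subset[OF inj vs1.span_superset] by (rule card_image)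
  finally have 1: "vs2.dim (f ` V) = card ?D" .
  have 2: "vs1.dim ?K = card A" using vs1.basis_card_eq_dim[OF A(1,3,2)] by simp
  have 3: "vs1.dim V = card E" using vs1.basis_card_eq_dim[OF E(2,4,3)] by simp
  have "card E = card A + card ?D" using finE E(1) card_Diff_subset card_mono
    by (metis finite_subset le_add_diff_inverse)
  then show ?thesis unfolding fdim_def using 1 2 3 by simp
qed

lemma fdim_bij:
  assumes vs: "vector_space s1" "vector_space s2"
    and V: "Modules.module.subspace s1 V" and fd: "finite_dimensional s1 V"
    and f: "linear_between s1 s2 V W f" and b: "bij_betw f V W"
  shows "fdim s1 V = fdim s2 W"
proof -
  interpret v1: vector_space s1 by fact
  have "0 \<in> V" using V by (rule v1.subspace_0)
  moreover have "f 0 = 0" using f calculation unfolding linear_between_def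
    by (metis add.left_neutral add_cancel_right_right)
  ultimately have "{x\<in>V. f x = 0} = {0}" using b unfolding bij_betw_def inj_on_def by auto
  moreover have "fdim s1 {0} = 0" unfolding fdim_def
    using v1.dim_eq_card[of "{}" "{0}"] by (simp add: v1.independent_empty)
  ultimately show ?thesis using rank_nullity[OF vs V fd f] b by (simp add: bij_betw_def)
qed

lemma (in vector_space) complement_basis:
  assumes R: "subspace R" and K: "subspace K" and RK: "R \<subseteq> K"
  obtains X where "X \<subseteq> K" "independent X" "span X \<inter> R \<subseteq> {0}" "\<And>z. z \<in> K \<Longrightarrow> \<exists>x\<in>span X. z - x \<in> R"
proof -
  obtain A where A: "A \<subseteq> R" "independent A" "R \<subseteq> span A"
    by (rule maximal_independent_subset)
  obtain E where E: "A \<subseteq> E" "E \<subseteq> K" "independent E" "K \<subseteq> span E"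
    using maximal_independent_subset_extend[of A K] A RK by blast
  have sA: "span A = R" using A R by (simp add: span_subspace)
  show ?thesis
  proof (rule that[of "E - A"])
    show "E - A \<subseteq> K" using E by auto
    show "independent (E - A)" using E(3) independent_mono by blast
    show "span (E - A) \<inter> R \<subseteq> {0}"
      using span_Int_span_Diff_independent[OF E(3,1)] sA by blast
    fix z assume "z \<in> K"
    then have "z \<in> span ((E - A) \<union> A)" using E by (simp add: Un_absorb2 subset_iff)
    then obtain x y where "z = x + y" "x \<in> span (E - A)" "y \<in> span A" unfolding span_Un by blast
    then show "\<exists>x\<in>span (E - A). z - x \<in> R" using sA by (intro bexI[of _ x]) auto
  qed
qed

lemma (in vector_space) dim_strict_mono:
  assumes U: "subspace U" and V: "subspace V" and UV: "U \<subset> V" and VW: "V \<subseteq> W" and fd: "finite_dimensional scale W"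
  shows "dim U < dim V"
proof -
  obtain G where G: "finite G" "span G = W" using fd unfolding finite_dimensional_def by blast
  obtain A where A: "A \<subseteq> U" "independent A" "U \<subseteq> span A"
    by (rule maximal_independent_subset)
  obtain E where E: "A \<subseteq> E" "E \<subseteq> V" "independent E" "V \<subseteq> span E"
    using maximal_independent_subset_extend[of A V] A UV by blast
  have "finite E" using independent_span_bound[OF G(1) E(3)] E(2) G(2) VW by blast
  moreover have "A \<noteq> E"
    using A E UV span_minimal[OF A(1) U] by blast
  ultimately have "card A < card E" using E(1) by (metis psubset_card_mono psubsetI)
  then show ?thesis using basis_card_eq_dim[OF A(1,3,2)] basis_card_eq_dim[OF E(2,4,3)] by simp
qed

section \<open>Critical values of a persistence module\<close>

text \<open>
  Right continuity, left regularity and vanishing for small parameters confine the points where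
  \<open>M\<close> changes to a set that is finite below every level.
\<close>

locale locally_finite_pmod = persistence_module M
  for M :: "('k::field, 'v::ab_group_add) pmod" +
  assumes fin_dim: "finite_dimensional (pscale M) (pspace M s)"
    and no_accum: "no_left_accumulation M"
begin

sublocale vs: vector_space "pscale M" by (rule ambient)

abbreviation "V \<equiv> pspace M"
abbreviation "i \<equiv> pmap M"
abbreviation "isoV s t \<equiv> bij_betw (i s t) (V s) (V t)"

lemma i_closed: "s \<le> t \<Longrightarrow> x \<in> V s \<Longrightarrow> i s t x \<in> V t"
  using linear unfolding linear_between_def by blast

lemma i_add: "s \<le> t \<Longrightarrow> x \<in> V s \<Longrightarrow> y \<in> V s \<Longrightarrow> i s t (x + y) = i s t x + i s t y"
  using linear unfolding linear_between_def by blast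

lemma i_scale: "s \<le> t \<Longrightarrow> x \<in> V s \<Longrightarrow> i s t (pscale M c x) = pscale M c (i s t x)"
  using linear unfolding linear_between_def by blast

lemma V_zero: "0 \<in> V s" using subspaces vs.subspace_0 by blast
lemma V_add: "x \<in> V s \<Longrightarrow> y \<in> V s \<Longrightarrow> x + y \<in> V s" using subspaces vs.subspace_add by blast
lemma V_scale: "x \<in> V s \<Longrightarrow> pscale M c x \<in> V s" using subspaces vs.subspace_scale by blast

lemma i_zero: "s \<le> t \<Longrightarrow> i s t 0 = 0"
  using i_scale[of s t 0 0] V_zero by simp

lemma i_lincomb:
  assumes "s \<le> t" "finite F" "\<And>g. g \<in> F \<Longrightarrow> x g \<in> V s"
  shows "i s t (\<Sum>g\<in>F. pscale M (c g) (x g)) = (\<Sum>g\<in>F. pscale M (c g) (i s t (x g)))"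
    and "(\<Sum>g\<in>F. pscale M (c g) (x g)) \<in> V s"
proof -
  have "i s t (\<Sum>g\<in>F. pscale M (c g) (x g)) = (\<Sum>g\<in>F. pscale M (c g) (i s t (x g))) \<and> (\<Sum>g\<in>F. pscale M (c g) (x g)) \<in> V s"
    using assms(2,3)
    by (induction rule: finite_induct) (auto simp: i_zero V_zero i_add i_scale V_add V_scale assms(1))
  then show "i s t (\<Sum>g\<in>F. pscale M (c g) (x g)) = (\<Sum>g\<in>F. pscale M (c g) (i s t (x g)))"
    and "(\<Sum>g\<in>F. pscale M (c g) (x g)) \<in> V s" by auto
qed

lemma iso_refl: "isoV s s"
proof -
  have "bij_betw id (V s) (V s)" by (rule bij_betw_id)
  also have "bij_betw id (V s) (V s) \<longleftrightarrow> isoV s s"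
    using map_refl by (intro bij_betw_cong) simp
  finally show ?thesis .
qed

lemma i_comp: "s \<le> t \<Longrightarrow> t \<le> r \<Longrightarrow> bij_betw (i t r \<circ> i s t) (V s) (V r) \<longleftrightarrow> isoV s r"
  using map_trans by (intro bij_betw_cong) auto

lemma iso_trans: "s \<le> t \<Longrightarrow> t \<le> r \<Longrightarrow> isoV s t \<Longrightarrow> isoV t r \<Longrightarrow> isoV s r"
  using i_comp bij_betw_trans by blast

lemma iso_cancel_left: "s \<le> t \<Longrightarrow> t \<le> r \<Longrightarrow> isoV s t \<Longrightarrow> isoV s r \<Longrightarrow> isoV t r"
  using i_comp[of s t r] bij_betw_comp_iff[of "i s t" "V s" "V t" "i t r" "V r"] by blast

text \<open>
  The points at which the structure maps arriving from the left fail to be isomorphisms.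
\<close>

definition "critical = {c. \<not> (\<exists>\<epsilon>>0. \<forall>t. c - \<epsilon> < t \<and> t \<le> c \<longrightarrow> isoV t c)}"

text \<open>
  Every point of \<open>[s, t]\<close> has a neighbourhood in that interval such that the structure maps to it and
  from it are isomorphisms: to the right by lower semicontinuity, to the left because no point of \<open>(s, t]\<close>
  is critical. Compactness of \<open>[s, t]\<close> and
  composition of isomorphisms do the rest.
\<close>

lemma iso_if_no_critical:
  assumes "s \<le> t" "{s<..t} \<inter> critical = {}"
  shows "isoV s t"
proof -
  let ?P = "\<lambda>p q. s \<le> p \<longrightarrow> q \<le> t \<longrightarrow> p \<le> q \<longrightarrow> isoV p q"
  have "?P s t"
  proof (rule Bolzano[of s t ?P])
    fix a b c assume "?P a b" "?P b c" "a \<le> b" "b \<le> c"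
    then show "?P a c" using iso_trans[of a b c] by auto
  next
    fix x assume local: "s \<le> x" "x \<le> t"
    obtain e1 where e1: "e1 > 0" "\<And>u. x \<le> u \<Longrightarrow> u < x + e1 \<Longrightarrow> isoV x u"
      using lower_semicontinuous by blast
    have "\<exists>e2>0. \<forall>u. x - e2 < u \<longrightarrow> s \<le> u \<longrightarrow> u \<le> x \<longrightarrow> isoV u x"
    proof (cases "x = s")
      case True
      then have "isoV u x" if "s \<le> u" "u \<le> x" for u
        using iso_refl that by (metis order_antisym)
      then show ?thesis by (intro exI[of _ 1]) auto
    next
      case False
      then have "x \<in> {s<..t}" using local by simp
      then have "x \<notin> critical" using assms(2) by blast
      then show ?thesis unfolding critical_def by blast
    qed
    then obtain e2 where e2: "e2 > 0" "\<And>u. x - e2 < u \<Longrightarrow> s \<le> u \<Longrightarrow> u \<le> x \<Longrightarrow> isoV u x" by blast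
    show "\<exists>d>0. \<forall>a b. a \<le> x \<and> x \<le> b \<and> b - a < d \<longrightarrow> ?P a b"
    proof (intro exI[of _ "min e1 e2"] conjI allI impI)
      fix a b assume "a \<le> x \<and> x \<le> b \<and> b - a < min e1 e2" "s \<le> a" "b \<le> t" "a \<le> b"
      then show "isoV a b" using e1(2)[of b] e2(2)[of a] iso_trans[of a x b] by auto
    qed (use e1 e2 in auto)
  qed (rule assms(1))
  then show ?thesis using assms(1) by auto
qed

text \<open>
  No point is an accumulation point of critical values: on a punctured neighbourhood of it the
  structure maps on either side are isomorphisms. Hence compactness gives finiteness on bounded
  intervals, and below some level all spaces vanish.
\<close>

lemma finite_critical: "finite (critical \<inter> {..S})"
proof -
  obtain s0 where s0: "\<And>s. s \<le> s0 \<Longrightarrow> V s = {0}" using lower_bounded by blast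
  have low: "c \<notin> critical" if "c \<le> s0" for c
  proof -
    have "isoV t c" if "t \<le> c" for t
      using s0[of t] s0[of c] i_zero that \<open>c \<le> s0\<close> by (auto simp: bij_betw_def)
    then show ?thesis unfolding critical_def by (auto intro!: exI[of _ 1])
  qed
  have "finite (critical \<inter> {s0..max s0 S})"
  proof (rule Bolzano[of s0 "max s0 S" "\<lambda>p q. finite (critical \<inter> {p..q})"])
    show "s0 \<le> max s0 S" by simp
    fix a b c assume "finite (critical \<inter> {a..b})" "finite (critical \<inter> {b..c})" "a \<le> b" "b \<le> c"
    moreover have "critical \<inter> {a..c} \<subseteq> critical \<inter> {a..b} \<union> critical \<inter> {b..c}" by auto
    ultimately show "finite (critical \<inter> {a..c})" by (meson finite_UnI finite_subset)
  next
    fix x assume "s0 \<le> x" "x \<le> max s0 S"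
    obtain e1 where e1: "e1 > 0" "\<And>u. x \<le> u \<Longrightarrow> u < x + e1 \<Longrightarrow> isoV x u"
      using lower_semicontinuous by blast
    obtain e2 where e2: "e2 > 0" "\<And>t t'. x - e2 < t \<Longrightarrow> t \<le> t' \<Longrightarrow> t' < x \<Longrightarrow> isoV t t'"
      using no_accum unfolding no_left_accumulation_def by blast
    have r: "c \<notin> critical" if "x < c" "c < x + e1" for c
    proof -
      have "isoV t c" if "c - (c - x) < t \<and> t \<le> c" for t
        using e1(2)[of t] e1(2)[of c] iso_cancel_left[of x t c] that \<open>c < x + e1\<close> by auto
      then show ?thesis unfolding critical_def using that by (auto intro!: exI[of _ "c - x"])
    qed
    have l: "c \<notin> critical" if "x - e2 < c" "c < x" for c
    proof -
      have "isoV t c" if "c - (c - (x - e2)) < t \<and> t \<le> c" for t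
        using e2(2)[of t c] that \<open>c < x\<close> by auto
      then show ?thesis unfolding critical_def using that by (auto intro!: exI[of _ "c - (x - e2)"])
    qed
    show "\<exists>d>0. \<forall>a b. a \<le> x \<and> x \<le> b \<and> b - a < d \<longrightarrow> finite (critical \<inter> {a..b})"
    proof (intro exI[of _ "min e1 e2"] conjI allI impI)
      fix a b assume ab: "a \<le> x \<and> x \<le> b \<and> b - a < min e1 e2"
      have "c = x" if "c \<in> critical \<inter> {a..b}" for c
      proof (rule ccontr)
        assume "c \<noteq> x"
        then consider "c < x" | "x < c" by linarith
        then show False using l[of c] r[of c] that ab by cases auto
      qed
      then have "critical \<inter> {a..b} \<subseteq> {x}" by blast
      then show "finite (critical \<inter> {a..b})" using finite_subset by blast
    qed (use e1 e2 in auto)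
  qed
  moreover have "critical \<inter> {..S} \<subseteq> critical \<inter> {s0..max s0 S}"
  proof
    fix c assume "c \<in> critical \<inter> {..S}"
    moreover have "s0 \<le> c" using low[of c] calculation by force
    ultimately show "c \<in> critical \<inter> {s0..max s0 S}" by simp
  qed
  ultimately show ?thesis using finite_subset by blast
qed

text \<open>
  The space at \<open>a\<close> is the one at the largest critical value below \<open>a\<close>. This turns induction on the
  parameter into induction on the number of critical values.
\<close>

lemma critical_predecessor:
  obtains "V a = {0}" | c where "c \<in> critical" "c \<le> a" "isoV c a"
proof (cases "critical \<inter> {..a} = {}")
  case True
  obtain s0 where s0: "\<And>s. s \<le> s0 \<Longrightarrow> V s = {0}" using lower_bounded by blast
  have "isoV (min s0 a) a" using True by (intro iso_if_no_critical) auto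
  then have "V a = i (min s0 a) a ` {0}" using s0[of "min s0 a"] by (simp add: bij_betw_def)
  then have "V a = {0}" using i_zero by simp
  then show ?thesis using that by blast
next
  case False
  let ?c = "Max (critical \<inter> {..a})"
  have c: "?c \<in> critical \<inter> {..a}" using Max_in[OF finite_critical False] .
  have "{?c<..a} \<inter> critical = {}" using Max_ge[OF finite_critical] by (auto simp: not_le[symmetric])
  then have "isoV ?c a" using c by (intro iso_if_no_critical) auto
  then show ?thesis using that c by blast
qed

end

section \<open>Direct sums of interval modules\<close>

definition alive :: "real \<Rightarrow> bar \<Rightarrow> bool" where
  "alive s I \<longleftrightarrow> fst I \<le> s \<and> ereal s < snd I"

definition bar_sum :: "(bar \<Rightarrow> nat) \<Rightarrow> ('k::field, bar \<times> nat \<Rightarrow>\<^sub>0 'k) pmod" where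
  "bar_sum m = direct_sum_pmod {(I, j). j < m I} (\<lambda>(I, j). interval_module I)"

definition alive_labels :: "(bar \<Rightarrow> nat) \<Rightarrow> real \<Rightarrow> (bar \<times> nat) set" where
  "alive_labels m s = {(I, j). j < m I \<and> alive s I}"

lemma pspace_bar_sum:
  "pspace (bar_sum m :: ('k::field, bar \<times> nat \<Rightarrow>\<^sub>0 'k) pmod) s = {p. Poly_Mapping.keys p \<subseteq> alive_labels m s}"
proof -
  let ?L = "{(I, j). j < m I}"
  have 1: "(\<forall>k\<in>?L. Poly_Mapping.lookup p k \<in> (if alive s (fst k) then UNIV else {0})) \<longleftrightarrow>
    (\<forall>k\<in>?L. k \<in> Poly_Mapping.keys p \<longrightarrow> alive s (fst k))" for p :: "bar \<times> nat \<Rightarrow>\<^sub>0 'k"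
    by (auto simp: in_keys_iff)
  have 2: "pspace (case k of (I, j) \<Rightarrow> (interval_module I :: ('k, 'k) pmod)) s =
    (if alive s (fst k) then UNIV else {0})" for k :: "bar \<times> nat"
    by (cases k) (simp add: interval_module_def alive_def)
  have "pspace (bar_sum m :: ('k, bar \<times> nat \<Rightarrow>\<^sub>0 'k) pmod) s = {p. Poly_Mapping.keys p \<subseteq> ?L \<and>
      (\<forall>k\<in>?L. k \<in> Poly_Mapping.keys p \<longrightarrow> alive s (fst k))}"
    by (simp only: bar_sum_def direct_sum_pmod_def pmod.select_convs 2 1)
  also have "\<dots> = {p. Poly_Mapping.keys p \<subseteq> alive_labels m s}"
    unfolding alive_labels_def by fastforce
  finally show ?thesis .
qed

lemma lookup_pscale_bar_sum:
  "Poly_Mapping.lookup (pscale (bar_sum m) c p) k = c * Poly_Mapping.lookup p k"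
  by (cases k) (simp add: bar_sum_def direct_sum_pmod_def interval_module_def mapp.rep_eq when_def in_keys_iff)

lemma lookup_pmap_bar_sum:
  "Poly_Mapping.lookup (pmap (bar_sum m) s t p) k =
    (if ereal t < snd (fst k) then Poly_Mapping.lookup p k else 0)"
  by (cases k) (simp add: bar_sum_def direct_sum_pmod_def interval_module_def mapp.rep_eq when_def in_keys_iff)

section \<open>Generators of the bars\<close>

context locally_finite_pmod
begin

text \<open>
  The kernel of \<open>M\<^sup>a \<rightarrow> M\<^sup>b\<close>, with all of \<open>M\<^sup>a\<close> for \<open>b = \<infinity>\<close>. It is written with all \<open>t \<ge> b\<close> so that one
  formula covers every extended real \<open>b\<close>.
\<close>

definition "dies_by a b = {x \<in> V a. \<forall>t\<ge>a. b \<le> ereal t \<longrightarrow> i a t x = 0}"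
definition "dies_before a b = (\<Union>b'\<in>{..<b}. dies_by a b')"
definition "born_before a = (\<Union>a'\<in>{..<a}. i a' a ` V a')"
definition "superfluous a b = {y + z |y z. y \<in> dies_by a b \<inter> born_before a \<and> z \<in> dies_before a b}"

lemma dies_by_mono: "b \<le> b' \<Longrightarrow> dies_by a b \<subseteq> dies_by a b'"
  unfolding dies_by_def by (auto intro: order_trans)

lemma subspace_dies_by: "vs.subspace (dies_by a b)"
  unfolding dies_by_def vs.subspace_def
  by (auto simp: V_zero V_add V_scale i_zero i_add i_scale)

lemma dies_before_subset: "dies_before a b \<subseteq> dies_by a b"
  unfolding dies_before_def using dies_by_mono less_imp_le by blast

lemma subspace_dies_before:
  assumes "ereal a < b"
  shows "vs.subspace (dies_before a b)"
  unfolding vs.subspace_def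
proof (intro conjI ballI allI)
  show "0 \<in> dies_before a b" unfolding dies_before_def using assms vs.subspace_0[OF subspace_dies_by] by blast
  fix x y assume "x \<in> dies_before a b" "y \<in> dies_before a b"
  then obtain b1 b2 where b: "b1 < b" "x \<in> dies_by a b1" "b2 < b" "y \<in> dies_by a b2" unfolding dies_before_def by blast
  have "x \<in> dies_by a (max b1 b2)" "y \<in> dies_by a (max b1 b2)" using b dies_by_mono[of b1 "max b1 b2" a] dies_by_mono[of b2 "max b1 b2" a] by auto
  then have "x + y \<in> dies_by a (max b1 b2)" by (rule vs.subspace_add[OF subspace_dies_by])
  then show "x + y \<in> dies_before a b" unfolding dies_before_def using b by auto
next
  fix c x assume "x \<in> dies_before a b"
  then show "pscale M c x \<in> dies_before a b" unfolding dies_before_def using vs.subspace_scale[OF subspace_dies_by] by blast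
qed

lemma born_beforeI: "a' < a \<Longrightarrow> x \<in> V a' \<Longrightarrow> i a' a x \<in> born_before a"
  unfolding born_before_def by blast

lemma subspace_born_before: "vs.subspace (born_before a)"
  unfolding vs.subspace_def
proof (intro conjI ballI allI)
  have "i (a - 1) a 0 \<in> born_before a" using V_zero by (intro born_beforeI) auto
  then show "0 \<in> born_before a" by (simp add: i_zero)
  fix x y assume "x \<in> born_before a" "y \<in> born_before a"
  then obtain a1 a2 x' y' where *: "a1 < a" "x' \<in> V a1" "x = i a1 a x'" "a2 < a" "y' \<in> V a2" "y = i a2 a y'"
    unfolding born_before_def by blast
  let ?m = "max a1 a2"
  have "x = i ?m a (i a1 ?m x')" "y = i ?m a (i a2 ?m y')"
    using * map_trans[of a1 ?m a x'] map_trans[of a2 ?m a y'] by auto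
  moreover have "i a1 ?m x' \<in> V ?m" "i a2 ?m y' \<in> V ?m" using * by (auto intro: i_closed)
  ultimately have "x + y = i ?m a (i a1 ?m x' + i a2 ?m y')" "i a1 ?m x' + i a2 ?m y' \<in> V ?m"
    using i_add[of ?m a "i a1 ?m x'" "i a2 ?m y'"] * V_add by auto
  moreover have "?m < a" using * by simp
  ultimately show "x + y \<in> born_before a" using born_beforeI by metis
next
  fix c x assume "x \<in> born_before a"
  then obtain a1 x' where *: "a1 < a" "x' \<in> V a1" "x = i a1 a x'"
    unfolding born_before_def by blast
  then have "pscale M c x = i a1 a (pscale M c x')" "pscale M c x' \<in> V a1"
    using i_scale[of a1 a x' c] V_scale by auto
  then show "pscale M c x \<in> born_before a" using *(1) born_beforeI by metis
qed

lemma subspace_superfluous: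
  assumes "ereal a < b"
  shows "vs.subspace (superfluous a b)"
  unfolding superfluous_def
  by (intro vs.subspace_sums vs.subspace_inter subspace_dies_by subspace_born_before subspace_dies_before assms)

lemma superfluous_subset: "superfluous a b \<subseteq> dies_by a b"
  unfolding superfluous_def using vs.subspace_add[OF subspace_dies_by] dies_before_subset by blast

text \<open>
  Representatives for the bars \<open>[a, b)\<close>: a basis of a complement of the elements of the kernel that are
  already accounted for by bars with an earlier birth or with the same birth and an earlier death.
\<close>

definition is_gens :: "real \<Rightarrow> ereal \<Rightarrow> 'v set \<Rightarrow> bool" where
  "is_gens a b X \<longleftrightarrow> X \<subseteq> dies_by a b \<and> vs.independent X \<and> vs.span X \<inter> superfluous a b \<subseteq> {0} \<and>
    (\<forall>z\<in>dies_by a b. \<exists>x\<in>vs.span X. z - x \<in> superfluous a b)"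

definition gens :: "bar \<Rightarrow> 'v set" where
  "gens I = (if ereal (fst I) < snd I then (SOME X. is_gens (fst I) (snd I) X) else {})"

lemma is_gens_gens:
  assumes "ereal a < b"
  shows "is_gens a b (gens (a, b))"
proof -
  have "\<exists>X. is_gens a b X"
    unfolding is_gens_def
    by (rule vs.complement_basis[OF subspace_superfluous[OF assms] subspace_dies_by superfluous_subset]) blast
  then show ?thesis unfolding gens_def using assms by (simp add: someI_ex)
qed

lemma gens_bar: "x \<in> gens I \<Longrightarrow> ereal (fst I) < snd I"
  unfolding gens_def by (auto split: if_splits)

lemma gens_dies_by: "x \<in> gens I \<Longrightarrow> x \<in> dies_by (fst I) (snd I)"
  using is_gens_gens[of "fst I" "snd I"] gens_bar[of x I] unfolding is_gens_def by auto

lemma gens_V: "x \<in> gens I \<Longrightarrow> x \<in> V (fst I)"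
  using gens_dies_by unfolding dies_by_def by blast

lemma gens_dead: "x \<in> gens I \<Longrightarrow> fst I \<le> t \<Longrightarrow> snd I \<le> ereal t \<Longrightarrow> i (fst I) t x = 0"
  using gens_dies_by unfolding dies_by_def by blast

lemma finite_gens: "finite (gens I)"
proof (cases "ereal (fst I) < snd I")
  case True
  obtain G where G: "finite G" "vs.span G = V (fst I)"
    using fin_dim unfolding finite_dimensional_def by blast
  have "vs.independent (gens I)" using is_gens_gens[OF True] unfolding is_gens_def by simp
  then show ?thesis using vs.independent_span_bound[OF G(1)] G(2) gens_V by blast
qed (simp add: gens_def)

definition "alive_span s = vs.span {i (fst I) s x |I x. x \<in> gens I \<and> alive s I}"
text \<open>
  Elements all of whose images are combinations of chosen generators. Keeping all later parameters in
  the definition makes it stable under structure maps and trivially true once an element has died.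
\<close>

definition "spanned a = {z \<in> V a. \<forall>s\<ge>a. i a s z \<in> alive_span s}"

lemma subspace_spanned: "vs.subspace (spanned a)"
  unfolding spanned_def vs.subspace_def
  by (auto simp: V_zero V_add V_scale i_zero i_add i_scale alive_span_def vs.span_zero vs.span_add vs.span_scale)

lemma gens_spanned:
  assumes "x \<in> gens (a, b)"
  shows "x \<in> spanned a"
  unfolding spanned_def
proof (intro CollectI conjI allI impI)
  show "x \<in> V a" using gens_V[OF assms] by simp
  fix s assume s: "a \<le> s"
  show "i a s x \<in> alive_span s"
  proof (cases "alive s (a, b)")
    case True
    then show ?thesis unfolding alive_span_def using assms by (intro vs.span_base) force
  next
    case False
    then have "i a s x = 0" using gens_dead[OF assms, of s] s by (simp add: alive_def)
    then show ?thesis by (simp add: alive_span_def vs.span_zero)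
  qed
qed

lemma spanned_push:
  assumes "a \<le> c" "z \<in> spanned a"
  shows "i a c z \<in> spanned c"
  using assms map_trans[of a c _ z] i_closed unfolding spanned_def by auto

text \<open>
  The death of \<open>z\<close> is the first parameter at which its image vanishes, or \<open>\<infinity>\<close>. A first
  parameter exists, because the structure maps immediately to the right of any point are injective.
\<close>

lemma ex_death:
  assumes z: "z \<in> V a" "z \<noteq> 0"
  obtains b where "ereal a < b" "z \<in> dies_by a b" "z \<notin> dies_before a b"
proof -
  let ?D = "{t. a \<le> t \<and> i a t z = 0}"
  have up: "t' \<in> ?D" if "t \<in> ?D" "t \<le> t'" for t t'
    using that map_trans[of a t t' z] z i_zero by auto
  show ?thesis
  proof (cases "?D = {}")
    case True
    have "z \<in> dies_by a \<infinity>" unfolding dies_by_def using z by simp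
    moreover have "z \<notin> dies_before a \<infinity>"
    proof
      assume "z \<in> dies_before a \<infinity>"
      then obtain b' where b': "b' < \<infinity>" "z \<in> dies_by a b'" unfolding dies_before_def by blast
      obtain r where r: "b' \<le> ereal r" using b'(1) by (cases b') auto
      have "b' \<le> ereal (max a r)" using r by (meson ereal_less_eq(3) max.cobounded2 order_trans)
      then have "i a (max a r) z = 0" using b'(2) unfolding dies_by_def by simp
      then show False using True by (metis (mono_tags, lifting) empty_Collect_eq max.cobounded1)
    qed
    ultimately show ?thesis using that[of \<infinity>] by simp
  next
    case False
    define \<beta> where "\<beta> = Inf ?D"
    have bb: "bdd_below ?D" by (auto intro: bdd_belowI[of _ a])
    have ab: "a \<le> \<beta>" unfolding \<beta>_def using False by (intro cInf_greatest) auto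
    obtain e where e: "e > 0" "\<And>t. \<beta> \<le> t \<Longrightarrow> t < \<beta> + e \<Longrightarrow> isoV \<beta> t" using lower_semicontinuous by blast
    obtain t where t: "t \<in> ?D" "t < \<beta> + e" using cInf_lessD[OF False, of "\<beta> + e"] e(1) unfolding \<beta>_def by auto
    have bt: "\<beta> \<le> t" unfolding \<beta>_def using cInf_lower[OF t(1) bb] .
    have "i \<beta> t (i a \<beta> z) = i \<beta> t 0" using map_trans[OF ab bt z(1)] t(1) i_zero[OF bt] by simp
    moreover have "inj_on (i \<beta> t) (V \<beta>)" using e(2)[OF bt t(2)] by (simp add: bij_betw_def)
    ultimately have "i a \<beta> z = 0" using i_closed[OF ab z(1)] V_zero by (auto dest: inj_onD)
    then have bD: "\<beta> \<in> ?D" using ab by simp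
    have "\<beta> \<noteq> a" using \<open>i a \<beta> z = 0\<close> map_refl[OF z(1)] z(2) by auto
    then have "ereal a < ereal \<beta>" using ab by simp
    moreover have "z \<in> dies_by a (ereal \<beta>)" unfolding dies_by_def using z up[OF bD] by simp
    moreover have "z \<notin> dies_before a (ereal \<beta>)"
    proof
      assume "z \<in> dies_before a (ereal \<beta>)"
      then obtain b' where b': "b' < ereal \<beta>" "z \<in> dies_by a b'" unfolding dies_before_def by blast
      obtain u where u: "max b' (ereal a) < ereal u" "ereal u < ereal \<beta>"
        using ereal_dense2[of "max b' (ereal a)" "ereal \<beta>"] b'(1) \<open>ereal a < ereal \<beta>\<close> by auto
      have "i a u z = 0" using b'(2) u unfolding dies_by_def by (simp add: less_imp_le)
      then have "u \<in> ?D" using u by simp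
      then have "\<beta> \<le> u" unfolding \<beta>_def using bb by (rule cInf_lower)
      then show False using u by simp
    qed
    ultimately show ?thesis using that by blast
  qed
qed

text \<open>
  Two nested inductions. Outer: on the number of critical values up to \<open>a\<close>, which settles every element coming
  from an earlier parameter. Inner: on the dimension of the kernel in which \<open>z\<close> dies; modulo generators and
  earlier births, \<open>z\<close> is an element that dies strictly earlier, and the kernel for the earlier death is a
  proper subspace because \<open>z\<close> itself is missing from it.
\<close>

lemma critical_spanned:
  assumes "a \<in> critical"
  shows "V a \<subseteq> spanned a"
  using assms
proof (induction "card (critical \<inter> {..a})" arbitrary: a rule: less_induct)
  case less
  have earlier: "born_before a \<subseteq> spanned a"
  proof
    fix y assume "y \<in> born_before a"
    then obtain a' y' where *: "a' < a" "y' \<in> V a'" "y = i a' a y'" unfolding born_before_def by blast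
    show "y \<in> spanned a"
    proof (rule critical_predecessor[of a'])
      assume "V a' = {0}"
      then show "y \<in> spanned a" using * i_zero[of a' a] vs.subspace_0[OF subspace_spanned] by auto
    next
      fix c assume c: "c \<in> critical" "c \<le> a'" "isoV c a'"
      have "critical \<inter> {..c} \<subset> critical \<inter> {..a}" using c * less.prems by force
      then have "V c \<subseteq> spanned c" using less.hyps[OF psubset_card_mono[OF finite_critical]] c(1) by blast
      moreover obtain y'' where "y'' \<in> V c" "y' = i c a' y''" using c(3) *(2) by (auto simp: bij_betw_def)
      moreover have "y = i c a y''" using calculation * map_trans[of c a' a y''] c(2) by simp
      ultimately show "y \<in> spanned a" using spanned_push[of c a y''] c(2) *(1) by auto
    qed
  qed
  have claim: "z \<in> spanned a" if "ereal a < b" "z \<in> dies_by a b" "z \<notin> dies_before a b" for z b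
    using that
  proof (induction "vs.dim (dies_by a b)" arbitrary: z b rule: less_induct)
    case (less b z)
    have gb: "is_gens a b (gens (a, b))" using is_gens_gens[OF less.prems(1)] .
    then obtain x where x: "x \<in> vs.span (gens (a, b))" "z - x \<in> superfluous a b"
      using less.prems(2) unfolding is_gens_def by blast
    then obtain y w where yw: "z - x = y + w" "y \<in> born_before a" "w \<in> dies_before a b" unfolding superfluous_def by blast
    have "vs.span (gens (a, b)) \<subseteq> spanned a"
      using gens_spanned by (intro vs.span_minimal subspace_spanned) blast
    then have xG: "x \<in> spanned a" using x(1) by blast
    have yG: "y \<in> spanned a" using yw(2) earlier by blast
    have wG: "w \<in> spanned a"
    proof (cases "w = 0")
      case True
      then show ?thesis using vs.subspace_0[OF subspace_spanned] by simp
    next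
      case False
      obtain b' where b': "b' < b" "w \<in> dies_by a b'" using yw(3) unfolding dies_before_def by blast
      then have "w \<in> V a" unfolding dies_by_def by simp
      then obtain d where d: "ereal a < d" "w \<in> dies_by a d" "w \<notin> dies_before a d"
        using ex_death False by blast
      \<comment> \<open>otherwise \<open>w\<close> would already die before its death \<open>d\<close>\<close>
      have "\<not> b' < d" using d(3) b'(2) unfolding dies_before_def by auto
      then have db: "d \<le> b'" by simp
      have "dies_by a d \<subseteq> dies_by a b'" using dies_by_mono[OF db] .
      moreover have "dies_by a b' \<subseteq> dies_by a b" using dies_by_mono b'(1) by simp
      moreover have "z \<notin> dies_by a b'" using less.prems(3) b'(1) unfolding dies_before_def by auto
      ultimately have "dies_by a d \<subset> dies_by a b" using less.prems(2) by blast
      then have "vs.dim (dies_by a d) < vs.dim (dies_by a b)"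
        using vs.dim_strict_mono[OF subspace_dies_by subspace_dies_by _ _ fin_dim[of a]] dies_by_def by auto
      then show ?thesis using less.hyps d by blast
    qed
    have "z = x + (y + w)" using yw(1) by (simp add: algebra_simps)
    then show ?case using vs.subspace_add[OF subspace_spanned] xG yG wG by simp
  qed
  show ?case
  proof
    fix z assume z: "z \<in> V a"
    show "z \<in> spanned a"
    proof (cases "z = 0")
      case True
      then show ?thesis using vs.subspace_0[OF subspace_spanned] by simp
    next
      case False
      then obtain b where "ereal a < b" "z \<in> dies_by a b" "z \<notin> dies_before a b" using ex_death z by blast
      then show ?thesis by (rule claim)
    qed
  qed
qed

lemma gens_span: "V s \<subseteq> alive_span s"
proof -
  have "V s \<subseteq> spanned s"
  proof (rule critical_predecessor[of s])
    assume "V s = {0}"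
    then show ?thesis using vs.subspace_0[OF subspace_spanned] by simp
  next
    fix c assume c: "c \<in> critical" "c \<le> s" "isoV c s"
    show ?thesis
    proof
      fix z assume "z \<in> V s"
      then obtain y where "y \<in> V c" "z = i c s y" using c(3) by (auto simp: bij_betw_def)
      then show "z \<in> spanned s" using spanned_push[OF c(2)] critical_spanned[OF c(1)] by blast
    qed
  qed
  then show ?thesis unfolding spanned_def using map_refl by fastforce
qed

text \<open>
  Among the terms with nonzero coefficient take those with the last birth \<open>a\<close>, and among these the ones
  with the last death \<open>b\<close>. In \<open>M\<^sup>a\<close> the whole sum dies by \<open>s < b\<close>, the terms with the same birth and earlier
  death die before \<open>b\<close>, and the remaining ones come from before \<open>a\<close>. So the selected part lies in the
  subspace to which the generators of \<open>[a, b)\<close> are complementary. The injectivity assumption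
  lets a family of labels stand for a set of pairs of a bar and a generator.
\<close>

lemma gens_independent:
  fixes F :: "'j set"
  assumes F: "finite F" "\<And>k. k \<in> F \<Longrightarrow> x k \<in> gens (B k) \<and> alive s (B k)"
    and inj: "inj_on (\<lambda>k. (B k, x k)) F"
    and zero: "(\<Sum>k\<in>F. pscale M (c k) (i (fst (B k)) s (x k))) = 0"
    and g: "g \<in> F"
  shows "c g = 0"
proof (rule ccontr)
  assume "c g \<noteq> 0"
  define N where "N = {k\<in>F. c k \<noteq> 0}"
  have N: "finite N" "N \<noteq> {}" "N \<subseteq> F" unfolding N_def using F(1) g \<open>c g \<noteq> 0\<close> by auto
  \<comment> \<open>the last birth, and below the last death among the bars with that birth\<close>
  define a where "a = Max ((fst \<circ> B) ` N)"
  define Na where "Na = {k\<in>N. fst (B k) = a}"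
  have "a \<in> (fst \<circ> B) ` N" unfolding a_def using N by (intro Max_in) auto
  then have Na: "finite Na" "Na \<noteq> {}" unfolding Na_def using N by auto
  define b where "b = Max ((snd \<circ> B) ` Na)"
  define P1 where "P1 = {k\<in>N. fst (B k) < a}"
  define P2 where "P2 = {k\<in>N. fst (B k) = a \<and> snd (B k) < b}"
  define P3 where "P3 = {k\<in>N. B k = (a, b)}"
  have "b \<in> (snd \<circ> B) ` Na" unfolding b_def using Na by (intro Max_in) auto
  then have P3: "P3 \<noteq> {}" unfolding P3_def Na_def by force
  have le_a: "fst (B k) \<le> a" if "k \<in> N" for k unfolding a_def using N that by (intro Max_ge) auto
  have le_b: "snd (B k) \<le> b" if "k \<in> Na" for k unfolding b_def using Na that by (intro Max_ge) auto
  have Nsplit: "N = P1 \<union> (P2 \<union> P3)"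
  proof (intro equalityI subsetI)
    fix k assume k: "k \<in> N"
    show "k \<in> P1 \<union> (P2 \<union> P3)"
      using k le_a[OF k] le_b[of k] unfolding P1_def P2_def P3_def Na_def
      by (cases "B k") (auto simp: less_le)
  qed (auto simp: P1_def P2_def P3_def)
  have fin: "finite P1" "finite P2" "finite P3" using N unfolding P1_def P2_def P3_def by auto
  have al: "x k \<in> gens (B k)" "alive s (B k)" if "k \<in> N" for k using F(2) that N(3) by auto
  let ?v = "\<lambda>k. pscale M (c k) (i (fst (B k)) a (x k))"
  have xV: "x k \<in> V (fst (B k))" if "k \<in> N" for k using gens_V al(1)[OF that] .
  have vV: "?v k \<in> V a" if "k \<in> N" for k
    using V_scale i_closed[OF le_a[OF that] xV[OF that]] .
  have as: "a \<le> s" and sb: "ereal s < b"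
    using P3 al(2) unfolding P3_def alive_def by force+
  have ab: "ereal a < b" using as sb by (meson ereal_less_eq(3) le_less_trans)
  have "i a s (\<Sum>k\<in>N. ?v k) = (\<Sum>k\<in>N. pscale M (c k) (i a s (i (fst (B k)) a (x k))))"
    using N(1) as i_closed[OF le_a xV] by (intro i_lincomb(1)) auto
  also have "\<dots> = (\<Sum>k\<in>N. pscale M (c k) (i (fst (B k)) s (x k)))"
    using map_trans[OF le_a as xV] by (intro sum.cong) auto
  also have "\<dots> = (\<Sum>k\<in>F. pscale M (c k) (i (fst (B k)) s (x k)))"
    unfolding N_def using F(1) by (intro sum.mono_neutral_left) auto
  finally have z0: "i a s (\<Sum>k\<in>N. ?v k) = 0" using zero by simp
  have zV: "(\<Sum>k\<in>N. ?v k) \<in> V a" using vV by (intro vs.subspace_sum[OF subspaces]) auto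
  have zK: "(\<Sum>k\<in>N. ?v k) \<in> dies_by a (ereal s)"
    unfolding dies_by_def using zV z0 map_trans[OF as _ zV] i_zero by auto
  then have zK': "(\<Sum>k\<in>N. ?v k) \<in> dies_before a b" unfolding dies_before_def using sb by blast
  have v2: "(\<Sum>k\<in>P2. ?v k) \<in> dies_before a b"
  proof (intro vs.subspace_sum[OF subspace_dies_before[OF ab]])
    fix k assume "k \<in> P2"
    then have k: "k \<in> N" "fst (B k) = a" "snd (B k) < b" unfolding P2_def by auto
    have "x k \<in> dies_by a (snd (B k))" using gens_dies_by[OF al(1)[OF k(1)]] k(2) by simp
    then have "x k \<in> dies_before a b" unfolding dies_before_def using k(3) by blast
    then show "?v k \<in> dies_before a b"
      using vs.subspace_scale[OF subspace_dies_before[OF ab]] map_refl[of "x k" a] xV[OF k(1)] k(2) by simp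
  qed
  have v3eq: "(\<Sum>k\<in>P3. ?v k) = (\<Sum>k\<in>P3. pscale M (c k) (x k))"
    using map_refl xV unfolding P3_def by (intro sum.cong) force+
  have gX: "is_gens a b (gens (a, b))" using is_gens_gens[OF ab] .
  have v3s: "(\<Sum>k\<in>P3. ?v k) \<in> vs.span (gens (a, b))"
    unfolding v3eq using al unfolding P3_def
    by (intro vs.span_sum vs.span_scale vs.span_base) force
  have v3K: "(\<Sum>k\<in>P3. ?v k) \<in> dies_by a b"
    using v3s gX vs.span_minimal[OF _ subspace_dies_by] unfolding is_gens_def by blast
  have v1I: "(\<Sum>k\<in>P1. ?v k) \<in> born_before a"
  proof (intro vs.subspace_sum[OF subspace_born_before])
    fix k assume "k \<in> P1"
    then show "?v k \<in> born_before a" unfolding P1_def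
      by (intro vs.subspace_scale[OF subspace_born_before] born_beforeI xV) auto
  qed
  have split: "(\<Sum>k\<in>N. ?v k) = (\<Sum>k\<in>P1. ?v k) + ((\<Sum>k\<in>P2. ?v k) + (\<Sum>k\<in>P3. ?v k))"
  proof -
    have "fst (B k) \<noteq> a" if "k \<in> P1" for k using that unfolding P1_def by simp
    moreover have "fst (B k) = a" if "k \<in> P2 \<union> P3" for k using that unfolding P2_def P3_def by auto
    moreover have "snd (B k) \<noteq> b" if "k \<in> P2" for k using that unfolding P2_def by auto
    moreover have "snd (B k) = b" if "k \<in> P3" for k using that unfolding P3_def by simp
    ultimately have disj: "P1 \<inter> (P2 \<union> P3) = {}" "P2 \<inter> P3 = {}" by blast+
    have "(\<Sum>k\<in>N. ?v k) = (\<Sum>k\<in>P1. ?v k) + (\<Sum>k\<in>P2 \<union> P3. ?v k)"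
      using sum.union_disjoint[OF fin(1) finite_UnI[OF fin(2,3)] disj(1)] Nsplit by (simp only:)
    also have "(\<Sum>k\<in>P2 \<union> P3. ?v k) = (\<Sum>k\<in>P2. ?v k) + (\<Sum>k\<in>P3. ?v k)"
      by (rule sum.union_disjoint[OF fin(2,3) disj(2)])
    finally show ?thesis .
  qed
  have v1K: "(\<Sum>k\<in>P1. ?v k) \<in> dies_by a b"
  proof -
    have "(\<Sum>k\<in>P1. ?v k) = (\<Sum>k\<in>N. ?v k) - (\<Sum>k\<in>P2. ?v k) - (\<Sum>k\<in>P3. ?v k)"
      using split by simp
    moreover have "(\<Sum>k\<in>N. ?v k) \<in> dies_by a b" "(\<Sum>k\<in>P2. ?v k) \<in> dies_by a b"
      using zK' v2 dies_before_subset by blast+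
    ultimately show ?thesis using v3K by (simp only: vs.subspace_diff[OF subspace_dies_by])
  qed
  have "(\<Sum>k\<in>P3. ?v k) = - (\<Sum>k\<in>P1. ?v k) + ((\<Sum>k\<in>N. ?v k) - (\<Sum>k\<in>P2. ?v k))"
    using split by simp
  moreover have "- (\<Sum>k\<in>P1. ?v k) \<in> dies_by a b \<inter> born_before a"
    using v1K v1I vs.subspace_neg[OF subspace_dies_by] vs.subspace_neg[OF subspace_born_before] by blast
  moreover have "(\<Sum>k\<in>N. ?v k) - (\<Sum>k\<in>P2. ?v k) \<in> dies_before a b"
    using vs.subspace_diff[OF subspace_dies_before[OF ab]] zK' v2 by blast
  ultimately have "(\<Sum>k\<in>P3. ?v k) \<in> superfluous a b" unfolding superfluous_def by blast
  then have "(\<Sum>k\<in>P3. pscale M (c k) (x k)) = 0" using v3s v3eq gX unfolding is_gens_def by auto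
  moreover have injx: "inj_on x P3"
  proof (rule inj_onI)
    fix k l assume "k \<in> P3" "l \<in> P3" "x k = x l"
    then show "k = l" using inj_onD[OF inj, of k l] N(3) unfolding P3_def by auto
  qed
  ultimately have "(\<Sum>y\<in>x ` P3. pscale M (c (inv_into P3 x y)) y) = 0"
    by (simp add: sum.reindex[OF injx] inv_into_f_f[OF injx] cong: sum.cong)
  moreover have "vs.independent (gens (a, b))" using gX unfolding is_gens_def by blast
  moreover have "x ` P3 \<subseteq> gens (a, b)" using al unfolding P3_def by force
  ultimately have "\<forall>y\<in>x ` P3. c (inv_into P3 x y) = 0"
    using vs.independentD[of "gens (a, b)" "x ` P3" "\<lambda>y. c (inv_into P3 x y)"] fin(3) by blast
  then have "\<forall>k\<in>P3. c k = 0" using inv_into_f_f[OF injx] by force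
  moreover have "\<forall>k\<in>P3. c k \<noteq> 0" unfolding P3_def N_def by blast
  ultimately show False using P3 by blast
qed

section \<open>The barcode decomposition\<close>

text \<open>
  The summands of a barcode module are numbered, so the generators of each bar have to be enumerated.
\<close>

definition "labelling I = (SOME h. bij_betw h {0..<card (gens I)} (gens I))"

abbreviation "lgen k \<equiv> labelling (fst k) (snd k)"

definition "labels = {(I, j). j < card (gens I)}"

lemma labelling: "bij_betw (labelling I) {0..<card (gens I)} (gens I)"
  unfolding labelling_def using ex_bij_betw_nat_finite[OF finite_gens] by (rule someI_ex)

lemma lgen: "k \<in> labels \<Longrightarrow> lgen k \<in> gens (fst k)"
  using labelling[of "fst k"] unfolding labels_def bij_betw_def by fastforce

lemma lgen_inj: "inj_on (\<lambda>k. (fst k, lgen k)) labels"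
proof (rule inj_onI)
  fix k l assume kl: "k \<in> labels" "l \<in> labels" "(fst k, lgen k) = (fst l, lgen l)"
  then have "labelling (fst k) (snd k) = labelling (fst k) (snd l)" "snd k < card (gens (fst k))" "snd l < card (gens (fst k))"
    unfolding labels_def by auto
  then have "snd k = snd l"
    using labelling[of "fst k"] unfolding bij_betw_def inj_on_def by auto
  then show "k = l" using kl(3) by (simp add: prod_eq_iff)
qed

abbreviation "gens_sum \<equiv> (bar_sum (\<lambda>I. card (gens I)) :: ('k, bar \<times> nat \<Rightarrow>\<^sub>0 'k) pmod)"

lemma pspace_gens_sum: "pspace gens_sum s = {p. Poly_Mapping.keys p \<subseteq> {k\<in>labels. alive s (fst k)}}"
  unfolding pspace_bar_sum alive_labels_def labels_def by (simp add: case_prod_unfold)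

lemmas lookup_pscale_gens_sum = lookup_pscale_bar_sum[of "\<lambda>I. card (gens I)"]
lemmas lookup_pmap_gens_sum = lookup_pmap_bar_sum[of "\<lambda>I. card (gens I)"]

text \<open>
  The comparison map from the direct sum of interval modules: a coordinate is sent to the multiple of
  the image in \<open>M\<^sup>s\<close> of its generator.
\<close>

definition "realize s p = (\<Sum>k\<in>Poly_Mapping.keys p. pscale M (Poly_Mapping.lookup p k) (i (fst (fst k)) s (lgen k)))"

lemma realize_superset:
  assumes "finite A" "Poly_Mapping.keys p \<subseteq> A"
  shows "realize s p = (\<Sum>k\<in>A. pscale M (Poly_Mapping.lookup p k) (i (fst (fst k)) s (lgen k)))"
  unfolding realize_def using assms by (intro sum.mono_neutral_left) (auto simp: in_keys_iff)

lemma realize_closed: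
  assumes "p \<in> pspace gens_sum s"
  shows "realize s p \<in> V s"
proof -
  have "k \<in> labels \<and> alive s (fst k)" if "k \<in> Poly_Mapping.keys p" for k using assms that unfolding pspace_gens_sum by blast
  then show ?thesis unfolding realize_def alive_def
    by (intro vs.subspace_sum[OF subspaces] V_scale i_closed gens_V lgen) auto
qed

lemma realize_linear: "linear_between (pscale gens_sum) (pscale M) (pspace gens_sum s) (V s) (realize s)"
  unfolding linear_between_def
proof (intro conjI ballI allI funcsetI)
  show "realize s p \<in> V s" if "p \<in> pspace gens_sum s" for p using realize_closed that .
  fix p q :: "bar \<times> nat \<Rightarrow>\<^sub>0 'k"
  let ?A = "Poly_Mapping.keys p \<union> Poly_Mapping.keys q"
  have "Poly_Mapping.keys (p + q) \<subseteq> ?A" by (rule keys_add)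
  then show "realize s (p + q) = realize s p + realize s q"
    using realize_superset[of ?A "p + q" s] realize_superset[of ?A p s] realize_superset[of ?A q s]
    by (simp add: lookup_add vs.scale_left_distrib sum.distrib)
next
  fix c p
  have "Poly_Mapping.keys (pscale gens_sum c p) \<subseteq> Poly_Mapping.keys p" by (auto simp: in_keys_iff lookup_pscale_gens_sum)
  then show "realize s (pscale gens_sum c p) = pscale M c (realize s p)"
    using realize_superset[of "Poly_Mapping.keys p" "pscale gens_sum c p" s] realize_superset[of "Poly_Mapping.keys p" p s]
    by (simp add: lookup_pscale_gens_sum vs.scale_sum_right)
qed

lemma realize_inj: "inj_on (realize s) (pspace gens_sum s)"
proof (rule inj_onI)
  fix p q assume pq: "p \<in> pspace gens_sum s" "q \<in> pspace gens_sum s" "realize s p = realize s q"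
  let ?A = "Poly_Mapping.keys p \<union> Poly_Mapping.keys q"
  have A: "k \<in> labels" "alive s (fst k)" if "k \<in> ?A" for k
    using pq(1,2) that unfolding pspace_gens_sum by auto
  have "(\<Sum>k\<in>?A. pscale M (Poly_Mapping.lookup p k - Poly_Mapping.lookup q k) (i (fst (fst k)) s (lgen k))) = 0"
    using pq(3) realize_superset[of ?A p s] realize_superset[of ?A q s]
    by (simp add: vs.scale_left_diff_distrib sum_subtractf)
  moreover have "inj_on (\<lambda>k. (fst k, lgen k)) ?A" using lgen_inj A(1) inj_on_subset by blast
  ultimately have "Poly_Mapping.lookup p k - Poly_Mapping.lookup q k = 0" if "k \<in> ?A" for k
    using gens_independent[of ?A lgen fst s "\<lambda>k. Poly_Mapping.lookup p k - Poly_Mapping.lookup q k" k] A lgen that by auto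
  then have "Poly_Mapping.lookup p k = Poly_Mapping.lookup q k" for k by (cases "k \<in> ?A") (auto simp: in_keys_iff)
  then show "p = q" by (rule poly_mapping_eqI)
qed

lemma zero_gens_sum: "0 \<in> pspace gens_sum s"
  unfolding pspace_gens_sum by simp

lemma add_gens_sum: "p \<in> pspace gens_sum s \<Longrightarrow> q \<in> pspace gens_sum s \<Longrightarrow> p + q \<in> pspace gens_sum s"
  unfolding pspace_gens_sum using keys_add[of p q] by blast

lemma scale_gens_sum: "p \<in> pspace gens_sum s \<Longrightarrow> pscale gens_sum c p \<in> pspace gens_sum s"
  unfolding pspace_gens_sum by (auto simp: in_keys_iff lookup_pscale_gens_sum)

lemma realize_add:
  "p \<in> pspace gens_sum s \<Longrightarrow> q \<in> pspace gens_sum s \<Longrightarrow> realize s (p + q) = realize s p + realize s q"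
  using realize_linear unfolding linear_between_def by blast

lemma realize_scale: "p \<in> pspace gens_sum s \<Longrightarrow> realize s (pscale gens_sum c p) = pscale M c (realize s p)"
  using realize_linear unfolding linear_between_def by blast

lemma realize_surj: "realize s ` pspace gens_sum s = V s"
proof
  show "realize s ` pspace gens_sum s \<subseteq> V s" using realize_closed by (rule image_subsetI)
  have "vs.subspace (realize s ` pspace gens_sum s)"
    unfolding vs.subspace_def
  proof (intro conjI ballI allI)
    have "0 = realize s 0" unfolding realize_def by simp
    then show "0 \<in> realize s ` pspace gens_sum s" using zero_gens_sum by (rule image_eqI)
    fix x y assume "x \<in> realize s ` pspace gens_sum s" "y \<in> realize s ` pspace gens_sum s"
    then obtain p q where pq: "p \<in> pspace gens_sum s" "x = realize s p" "q \<in> pspace gens_sum s" "y = realize s q" by blast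
    then have "x + y = realize s (p + q)" using realize_add by simp
    then show "x + y \<in> realize s ` pspace gens_sum s" using add_gens_sum[OF pq(1,3)] by (rule image_eqI)
  next
    fix c x assume "x \<in> realize s ` pspace gens_sum s"
    then obtain p where p: "p \<in> pspace gens_sum s" "x = realize s p" by blast
    then have "pscale M c x = realize s (pscale gens_sum c p)" using realize_scale by simp
    then show "pscale M c x \<in> realize s ` pspace gens_sum s" using scale_gens_sum[OF p(1)] by (rule image_eqI)
  qed
  moreover have "{i (fst I) s x |I x. x \<in> gens I \<and> alive s I} \<subseteq> realize s ` pspace gens_sum s"
  proof
    fix y assume "y \<in> {i (fst I) s x |I x. x \<in> gens I \<and> alive s I}"
    then obtain I x where x: "y = i (fst I) s x" "x \<in> gens I" "alive s I" by blast
    obtain j where j: "j < card (gens I)" "x = labelling I j"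
      using labelling[of I] x(2) unfolding bij_betw_def by (metis atLeastLessThan_iff imageE)
    let ?q = "Poly_Mapping.single (I, j) 1"
    have "?q \<in> pspace gens_sum s" unfolding pspace_gens_sum labels_def using j x by simp
    moreover have "y = realize s ?q" unfolding realize_def x(1) j(2) by simp
    ultimately show "y \<in> realize s ` pspace gens_sum s" by (intro image_eqI)
  qed
  ultimately show "V s \<subseteq> realize s ` pspace gens_sum s"
    using gens_span[of s] vs.span_minimal unfolding alive_span_def by blast
qed

lemma realize_natural:
  assumes "s \<le> t" "p \<in> pspace gens_sum s"
  shows "realize t (pmap gens_sum s t p) = i s t (realize s p)" and "pmap gens_sum s t p \<in> pspace gens_sum t"
proof -
  have A: "k \<in> labels" "fst (fst k) \<le> s" "lgen k \<in> gens (fst k)" if "k \<in> Poly_Mapping.keys p" for k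
    using assms(2) that lgen[of k] unfolding pspace_gens_sum alive_def by blast+
  have sub: "Poly_Mapping.keys (pmap gens_sum s t p) \<subseteq> Poly_Mapping.keys p"
    by (auto simp: in_keys_iff lookup_pmap_gens_sum split: if_splits)
  then show "pmap gens_sum s t p \<in> pspace gens_sum t"
    using A assms(1) unfolding pspace_gens_sum alive_def
    by (auto simp: in_keys_iff lookup_pmap_gens_sum subset_iff split: if_splits) (meson order_trans)+
  have "i s t (realize s p) = (\<Sum>k\<in>Poly_Mapping.keys p. pscale M (Poly_Mapping.lookup p k) (i s t (i (fst (fst k)) s (lgen k))))"
    unfolding realize_def
    by (rule i_lincomb(1)[OF assms(1) finite_keys i_closed[OF A(2) gens_V[OF A(3)]]])
  also have "\<dots> = (\<Sum>k\<in>Poly_Mapping.keys p. pscale M (Poly_Mapping.lookup (pmap gens_sum s t p) k) (i (fst (fst k)) t (lgen k)))"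
  proof (rule sum.cong[OF refl])
    fix k assume k: "k \<in> Poly_Mapping.keys p"
    show "pscale M (Poly_Mapping.lookup p k) (i s t (i (fst (fst k)) s (lgen k))) =
      pscale M (Poly_Mapping.lookup (pmap gens_sum s t p) k) (i (fst (fst k)) t (lgen k))"
      using map_trans[OF A(2)[OF k] assms(1) gens_V[OF A(3)[OF k]]] gens_dead[OF A(3)[OF k], of t] A(2)[OF k] assms(1)
      by (auto simp: lookup_pmap_gens_sum not_less)
  qed
  finally show "realize t (pmap gens_sum s t p) = i s t (realize s p)"
    using realize_superset[OF _ sub] by simp
qed

theorem barcode_exists: "is_barcode M (\<lambda>I. card (gens I))"
  unfolding is_barcode_def
proof (intro conjI allI impI)
  show "ereal a < b" if "card (gens (a, b)) \<noteq> 0" for a b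
    using that gens_def[of "(a, b)"] by (auto split: if_splits)
  have bij: "bij_betw (realize s) (pspace gens_sum s) (V s)" for s
    using realize_inj realize_surj by (simp add: bij_betw_def)
  define \<phi> where "\<phi> s = the_inv_into (pspace gens_sum s) (realize s)" for s
  have \<phi>: "bij_betw (\<phi> s) (V s) (pspace gens_sum s)" for s
    unfolding \<phi>_def using bij_betw_the_inv_into[OF bij] .
  have r\<phi>: "realize s (\<phi> s x) = x" "\<phi> s x \<in> pspace gens_sum s" if "x \<in> V s" for s x
    using f_the_inv_into_f_bij_betw[OF bij] bij_betw_apply[OF \<phi> that] that unfolding \<phi>_def by auto
  have \<phi>r: "\<phi> s y = p" if "p \<in> pspace gens_sum s" "realize s p = y" for s p y
    using the_inv_into_f_f[OF realize_inj that(1)] that(2) unfolding \<phi>_def by simp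
  have lin: "linear_between (pscale M) (pscale gens_sum) (V s) (pspace gens_sum s) (\<phi> s)" for s
    unfolding linear_between_def
  proof (intro conjI ballI allI funcsetI)
    show "\<phi> s x \<in> pspace gens_sum s" if "x \<in> V s" for x using r\<phi> that by blast
    fix x y assume xy: "x \<in> V s" "y \<in> V s"
    have "\<phi> s x + \<phi> s y \<in> pspace gens_sum s" using r\<phi>(2) xy by (intro add_gens_sum)
    moreover have "realize s (\<phi> s x + \<phi> s y) = x + y"
      using r\<phi> xy by (simp add: realize_add)
    ultimately show "\<phi> s (x + y) = \<phi> s x + \<phi> s y" by (rule \<phi>r)
  next
    fix c x assume x: "x \<in> V s"
    have "pscale gens_sum c (\<phi> s x) \<in> pspace gens_sum s" using r\<phi>(2)[OF x] by (rule scale_gens_sum)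
    moreover have "realize s (pscale gens_sum c (\<phi> s x)) = pscale M c x"
      using r\<phi> x by (simp add: realize_scale)
    ultimately show "\<phi> s (pscale M c x) = pscale gens_sum c (\<phi> s x)" by (rule \<phi>r)
  qed
  have nat: "\<phi> t (i s t x) = pmap gens_sum s t (\<phi> s x)" if "s \<le> t" "x \<in> V s" for s t x
    using realize_natural[OF that(1) r\<phi>(2)[OF that(2)]] r\<phi>(1)[OF that(2)] by (intro \<phi>r) auto
  have "pmod_isomorphic M gens_sum"
    unfolding pmod_isomorphic_def using lin \<phi> nat by (intro exI[of _ \<phi>]) blast
  then show "pmod_isomorphic M (direct_sum_pmod {(I, j). j < card (gens I)}
      (\<lambda>(I, j). interval_module I :: ('k, 'k) pmod))"
    unfolding bar_sum_def .
qed

end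

section \<open>The jump formula\<close>

lemma finite_dimensional_image:
  assumes vs: "vector_space s1" "vector_space s2"
    and V: "Modules.module.subspace s1 V" and W: "Modules.module.subspace s2 W"
    and fd: "finite_dimensional s1 V"
    and f: "linear_between s1 s2 V W f" and onto: "f ` V = W"
  shows "finite_dimensional s2 W"
proof -
  interpret v1: vector_space s1 by fact
  interpret v2: vector_space s2 by fact
  obtain G where G: "finite G" "v1.span G = V" using fd unfolding finite_dimensional_def by blast
  have GV: "G \<subseteq> V" using G(2) v1.span_superset by blast
  have "W \<subseteq> v2.span (f ` G)"
  proof
    fix y assume "y \<in> W"
    then obtain x where x: "x \<in> v1.span G" "y = f x" using onto G(2) by blast
    then obtain c where "x = (\<Sum>b\<in>G. s1 (c b) b)" using v1.span_finite[OF G(1)] by blast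
    then have "y = (\<Sum>b\<in>G. s2 (c b) (f b))"
      using linear_between_sum_scale[OF vs V f G(1) GV] x(2) by auto
    moreover have "(\<Sum>b\<in>G. s2 (c b) (f b)) \<in> v2.span (f ` G)"
      by (intro v2.span_sum v2.span_scale v2.span_base imageI)
    ultimately show "y \<in> v2.span (f ` G)" by simp
  qed
  moreover have "v2.span (f ` G) \<subseteq> W" using GV onto W by (intro v2.span_minimal) auto
  ultimately show ?thesis unfolding finite_dimensional_def using G(1) by blast
qed

lemma vector_space_bar_sum:
  "vector_space (pscale (bar_sum m :: ('k::field, bar \<times> nat \<Rightarrow>\<^sub>0 'k) pmod))"
  by unfold_locales (auto intro!: poly_mapping_eqI simp: lookup_pscale_bar_sum lookup_add algebra_simps)

lemma subspace_bar_sum: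
  "Modules.module.subspace (pscale (bar_sum m)) (pspace (bar_sum m :: ('k::field, bar \<times> nat \<Rightarrow>\<^sub>0 'k) pmod) s)"
proof -
  interpret v: vector_space "pscale (bar_sum m :: ('k, bar \<times> nat \<Rightarrow>\<^sub>0 'k) pmod)" by (rule vector_space_bar_sum)
  have "Poly_Mapping.keys (x + y) \<subseteq> A" if "Poly_Mapping.keys x \<subseteq> A" "Poly_Mapping.keys y \<subseteq> A"
    for x y :: "bar \<times> nat \<Rightarrow>\<^sub>0 'k" and A
    using that keys_add[of x y] by blast
  moreover have "Poly_Mapping.keys (pscale (bar_sum m) c x) \<subseteq> A" if "Poly_Mapping.keys x \<subseteq> A"
    for c and x :: "bar \<times> nat \<Rightarrow>\<^sub>0 'k" and A
    using that by (auto simp: in_keys_iff lookup_pscale_bar_sum)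
  ultimately show ?thesis unfolding v.subspace_def pspace_bar_sum by auto
qed

text \<open>
  The finitely supported functions equal to one at a single alive label form a basis. An infinite set of labels would
  give an infinite independent set in a finite-dimensional space.
\<close>

lemma fdim_bar_sum:
  assumes fd: "finite_dimensional (pscale (bar_sum m)) (pspace (bar_sum m :: ('k::field, bar \<times> nat \<Rightarrow>\<^sub>0 'k) pmod) s)"
  shows "finite (alive_labels m s)"
    and "fdim (pscale (bar_sum m)) (pspace (bar_sum m :: ('k, bar \<times> nat \<Rightarrow>\<^sub>0 'k) pmod) s) = card (alive_labels m s)"
proof -
  let ?M = "bar_sum m :: ('k, bar \<times> nat \<Rightarrow>\<^sub>0 'k) pmod"
  let ?A = "alive_labels m s"
  let ?e = "\<lambda>k. Poly_Mapping.single k (1::'k)"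
  interpret v: vector_space "pscale ?M" by (rule vector_space_bar_sum)
  have inj: "inj_on ?e X" for X by (rule inj_onI) (metis lookup_single_eq lookup_single_not_eq zero_neq_one)
  have sub: "?e ` ?A \<subseteq> pspace ?M s" unfolding pspace_bar_sum by auto
  have comb: "Poly_Mapping.lookup (\<Sum>k\<in>F. pscale ?M (c k) (?e k)) l = (if l \<in> F then c l else 0)"
    if "finite F" for F c l
  proof -
    have "Poly_Mapping.lookup (\<Sum>k\<in>F. pscale ?M (c k) (?e k)) l = (\<Sum>k\<in>F. if k = l then c k else 0)"
      unfolding lookup_sum by (intro sum.cong) (auto simp: lookup_pscale_bar_sum lookup_single when_def)
    then show ?thesis using that by simp
  qed
  have ind: "v.independent (?e ` ?A)"
  proof (rule ccontr)
    assume "\<not> v.independent (?e ` ?A)"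
    then obtain t u where tu: "finite t" "t \<subseteq> ?e ` ?A" "(\<Sum>v\<in>t. pscale ?M (u v) v) = 0" "\<exists>v\<in>t. u v \<noteq> 0"
      unfolding v.dependent_explicit by blast
    obtain F where F: "F \<subseteq> ?A" "t = ?e ` F" using tu(2) by (meson subset_imageE)
    have "finite F" using tu(1) F(2) finite_imageD inj by blast
    have "(\<Sum>k\<in>F. pscale ?M (u (?e k)) (?e k)) = 0"
      using tu(3) unfolding F(2) by (simp add: sum.reindex[OF inj])
    then have "u (?e l) = 0" if "l \<in> F" for l
      using comb[OF \<open>finite F\<close>, of "\<lambda>k. u (?e k)" l] that by simp
    then show False using tu(4) F(2) by blast
  qed
  obtain G where G: "finite G" "v.span G = pspace ?M s" using fd unfolding finite_dimensional_def by blast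
  then have "finite (?e ` ?A)" using v.independent_span_bound[OF G(1) ind] sub by blast
  then show fin: "finite ?A" using finite_imageD inj by blast
  have "pspace ?M s \<subseteq> v.span (?e ` ?A)"
  proof
    fix p assume "p \<in> pspace ?M s"
    then have "Poly_Mapping.keys p \<subseteq> ?A" unfolding pspace_bar_sum by simp
    then have "p = (\<Sum>k\<in>?A. pscale ?M (Poly_Mapping.lookup p k) (?e k))"
      using comb[OF fin] by (intro poly_mapping_eqI) (auto simp: in_keys_iff)
    also have "\<dots> \<in> v.span (?e ` ?A)" by (intro v.span_sum v.span_scale v.span_base) simp
    finally show "p \<in> v.span (?e ` ?A)" .
  qed
  then have "card (?e ` ?A) = v.dim (pspace ?M s)" using v.basis_card_eq_dim[OF sub _ ind] by simp
  then show "fdim (pscale ?M) (pspace ?M s) = card ?A" unfolding fdim_def using card_image[OF inj] by metis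
qed

lemma lambda_bar_eq_0: "fst I \<noteq> x \<Longrightarrow> snd I \<noteq> ereal x \<Longrightarrow> lambda_bar I x = 0"
  by (auto simp: lambda_bar_def)

context locally_finite_pmod
begin

text \<open>
  The isomorphism to the direct sum commutes with structure maps, so it carries over the intervals on
  which these are bijective.
\<close>

lemma iso_bar_sum:
  assumes m: "is_barcode M m" and st: "s \<le> t" and iso: "isoV s t"
  shows "bij_betw (pmap (bar_sum m) s t) (pspace (bar_sum m :: ('k, bar \<times> nat \<Rightarrow>\<^sub>0 'k) pmod) s)
    (pspace (bar_sum m :: ('k, bar \<times> nat \<Rightarrow>\<^sub>0 'k) pmod) t)"
proof -
  let ?N = "bar_sum m :: ('k, bar \<times> nat \<Rightarrow>\<^sub>0 'k) pmod"
  obtain \<phi> where \<phi>: "\<And>s. bij_betw (\<phi> s) (V s) (pspace ?N s)"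
      "\<And>s t x. s \<le> t \<Longrightarrow> x \<in> V s \<Longrightarrow> \<phi> t (i s t x) = pmap ?N s t (\<phi> s x)"
    using m unfolding is_barcode_def bar_sum_def[symmetric] pmod_isomorphic_def by blast
  have "bij_betw (\<phi> t \<circ> i s t) (V s) (pspace ?N t)" using bij_betw_trans[OF iso \<phi>(1)] .
  then have "bij_betw (pmap ?N s t \<circ> \<phi> s) (V s) (pspace ?N t)"
    using \<phi>(2)[OF st] by (subst (asm) bij_betw_cong[of _ _ "pmap ?N s t \<circ> \<phi> s"]) auto
  then show ?thesis by (rule bij_betw_comp_iff[OF \<phi>(1), THEN iffD2])
qed

lemma dim_bar_sum:
  assumes m: "is_barcode M m"
  shows "finite (alive_labels m s)" and "fdim (pscale M) (V s) = card (alive_labels m s)"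
proof -
  let ?N = "bar_sum m :: ('k, bar \<times> nat \<Rightarrow>\<^sub>0 'k) pmod"
  obtain \<phi> where \<phi>: "bij_betw (\<phi> s) (V s) (pspace ?N s)"
      "linear_between (pscale M) (pscale ?N) (V s) (pspace ?N s) (\<phi> s)"
    using m unfolding is_barcode_def bar_sum_def[symmetric] pmod_isomorphic_def by blast
  have fd: "finite_dimensional (pscale ?N) (pspace ?N s)"
    using finite_dimensional_image[OF ambient vector_space_bar_sum subspaces subspace_bar_sum fin_dim \<phi>(2)] \<phi>(1)
    by (simp add: bij_betw_def)
  show "finite (alive_labels m s)" by (rule fdim_bar_sum(1)[OF fd])
  show "fdim (pscale M) (V s) = card (alive_labels m s)"
    using fdim_bij[OF ambient vector_space_bar_sum subspaces fin_dim \<phi>(2,1)] fdim_bar_sum(2)[OF fd] by simp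
qed

lemma is_barcode_barcode: "is_barcode M (barcode M)"
  unfolding barcode_def by (rule someI[where P = "is_barcode M", OF barcode_exists])

text \<open>
  Isomorphisms on \<open>(x - \<epsilon>, x)\<close> exclude births and deaths in that interval, so the bars alive at \<open>t\<close> are those
  with birth before \<open>x\<close> and death at \<open>x\<close> or later. Compared with the bars alive at \<open>x\<close>, the common ones cancel,
  leaving the bars born at \<open>x\<close> and those dying at \<open>x\<close>. Both sets are finite as subsets of the bars alive at
  \<open>x\<close> or at \<open>t\<close>.
\<close>

lemma lambda_pmod_eq_jump:
  assumes \<epsilon>: "\<epsilon> > 0" "\<And>t t'. x - \<epsilon> < t \<Longrightarrow> t \<le> t' \<Longrightarrow> t' < x \<Longrightarrow> isoV t t'"
    and t: "x - \<epsilon> < t" "t < x"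
  shows "lambda_pmod M x = int (fdim (pscale M) (V x)) - int (fdim (pscale M) (V t))"
proof -
  define m where "m = barcode M"
  have m: "is_barcode M m" unfolding m_def by (rule is_barcode_barcode)
  have bar: "ereal (fst I) < snd I" if "m I \<noteq> 0" for I
    using m that unfolding is_barcode_def by (metis prod.collapse)
  let ?N = "bar_sum m :: ('k, bar \<times> nat \<Rightarrow>\<^sub>0 'k) pmod"
  \<comment> \<open>a nonzero vector in one copy of the interval module of \<open>I\<close>\<close>
  let ?e = "\<lambda>I. Poly_Mapping.single (I, 0::nat) (1::'k)"
  have e: "?e I \<in> pspace ?N s" if "m I \<noteq> 0" "alive s I" for I s
    using that unfolding pspace_bar_sum alive_labels_def by simp
  \<comment> \<open>a bar born in \<open>(t, x)\<close> would not be in the image of the structure map from \<open>t\<close> to its birth\<close>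
  have birth: "fst I \<le> t" if I: "m I \<noteq> 0" "fst I < x" for I
  proof (rule ccontr)
    assume a: "\<not> fst I \<le> t"
    then have b: "bij_betw (pmap ?N t (fst I)) (pspace ?N t) (pspace ?N (fst I))"
      using \<epsilon>(2)[of t "fst I"] t I by (intro iso_bar_sum[OF m]) auto
    have "?e I \<in> pspace ?N (fst I)" using bar I by (intro e) (auto simp: alive_def)
    then obtain p where p: "p \<in> pspace ?N t" "?e I = pmap ?N t (fst I) p"
      using b unfolding bij_betw_def by blast
    have "Poly_Mapping.lookup p (I, 0) = Poly_Mapping.lookup (?e I) (I, 0)"
      unfolding p(2) lookup_pmap_bar_sum using bar I by simp
    then have "(I, 0) \<in> alive_labels m t" using p(1) unfolding pspace_bar_sum by (auto simp: in_keys_iff)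
    then show False using a unfolding alive_labels_def alive_def by simp
  qed
  \<comment> \<open>a bar dying at \<open>b\<close> in \<open>(t, x)\<close> would be in the kernel of the structure map from \<open>t\<close> to \<open>b\<close>\<close>
  have death: "ereal x \<le> snd I" if I: "m I \<noteq> 0" "fst I < x" "ereal t < snd I" for I
  proof (rule ccontr)
    assume "\<not> ereal x \<le> snd I"
    then obtain b where b: "snd I = ereal b" "t < b" "b < x" using I(3) by (cases "snd I") auto
    have inj: "inj_on (pmap ?N t b) (pspace ?N t)"
      using iso_bar_sum[OF m _ \<epsilon>(2)[of t b]] b t by (simp add: bij_betw_def)
    have "pmap ?N t b (?e I) = pmap ?N t b 0"
      using b by (intro poly_mapping_eqI) (auto simp: lookup_pmap_bar_sum lookup_single when_def)
    moreover have "?e I \<in> pspace ?N t" using birth I b by (intro e) (auto simp: alive_def)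
    moreover have "0 \<in> pspace ?N t" unfolding pspace_bar_sum by simp
    ultimately have "?e I = 0" using inj by (auto dest: inj_onD)
    then show False by (metis lookup_single_eq lookup_zero zero_neq_one)
  qed
  define L where "L = {(I, j). j < m I}"
  define C where "C = {k\<in>L. fst (fst k) < x \<and> ereal x < snd (fst k)}"
  define Bk where "Bk = {k\<in>L. fst (fst k) = x}"
  define Ek where "Ek = {k\<in>L. snd (fst k) = ereal x}"
  have Lm: "m (fst k) \<noteq> 0" if "k \<in> L" for k using that unfolding L_def by auto
  have Ax: "alive_labels m x = C \<union> Bk"
  proof (intro equalityI subsetI)
    fix k assume "k \<in> alive_labels m x"
    then show "k \<in> C \<union> Bk" unfolding alive_labels_def C_def Bk_def L_def alive_def by auto
  next
    fix k assume "k \<in> C \<union> Bk"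
    then show "k \<in> alive_labels m x"
      using bar[of "fst k"] unfolding alive_labels_def C_def Bk_def L_def alive_def by auto
  qed
  have At: "alive_labels m t = C \<union> Ek"
  proof (intro equalityI subsetI)
    fix k assume "k \<in> alive_labels m t"
    then have k: "k \<in> L" "fst (fst k) \<le> t" "ereal t < snd (fst k)"
      unfolding alive_labels_def L_def alive_def by auto
    then have "ereal x \<le> snd (fst k)" using death[OF Lm[OF k(1)]] t by auto
    then show "k \<in> C \<union> Ek" using k t unfolding C_def Ek_def by auto
  next
    fix k assume k: "k \<in> C \<union> Ek"
    then have "k \<in> L" "fst (fst k) < x" "ereal x \<le> snd (fst k)"
      using bar[OF Lm, of k] unfolding C_def Ek_def by auto
    moreover have "ereal t < snd (fst k)" using calculation(3) t(2) by (meson ereal_less(2) less_ereal.simps(1) less_le_trans)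
    ultimately show "k \<in> alive_labels m t"
      using birth[OF Lm] unfolding alive_labels_def L_def alive_def by auto
  qed
  have fin: "finite C" "finite Bk" "finite Ek"
    using dim_bar_sum(1)[OF m, of x] dim_bar_sum(1)[OF m, of t] unfolding Ax At by auto
  have CB: "C \<inter> Bk = {}" unfolding C_def Bk_def by blast
  have "snd (fst k) \<noteq> ereal x" if "k \<in> C" for k
    using that unfolding C_def mem_Collect_eq by (elim conjE) (erule less_imp_neq[THEN not_sym])
  then have CE: "C \<inter> Ek = {}" unfolding Ek_def by blast
  have cx: "card (alive_labels m x) = card C + card Bk"
    unfolding Ax using card_Un_disjoint[OF fin(1,2)] CB by simp
  have ct: "card (alive_labels m t) = card C + card Ek"
    unfolding At using card_Un_disjoint[OF fin(1,3)] CE by simp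
  define B where "B = {I. m I \<noteq> 0 \<and> fst I = x}"
  define E where "E = {I. m I \<noteq> 0 \<and> snd I = ereal x}"
  have BB: "Bk = Sigma B (\<lambda>I. {..<m I})" unfolding Bk_def B_def L_def by auto
  have EE: "Ek = Sigma E (\<lambda>I. {..<m I})" unfolding Ek_def E_def L_def by auto
  have "B = fst ` Bk" unfolding BB fst_image_Sigma by (auto simp: B_def)
  then have fB: "finite B" using fin by simp
  have "E = fst ` Ek" unfolding EE fst_image_Sigma by (auto simp: E_def)
  then have fE: "finite E" using fin by simp
  have cB: "card Bk = (\<Sum>I\<in>B. m I)" unfolding BB using fB by simp
  have cE: "card Ek = (\<Sum>I\<in>E. m I)" unfolding EE using fE by simp
  have lB: "lambda_bar I x = 1" if "I \<in> B" for I
    using bar[of I] that by (auto simp: B_def lambda_bar_def)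
  have lE: "lambda_bar I x = - 1" if "I \<in> E" for I
    using bar[of I] that by (auto simp: E_def lambda_bar_def)
  have disj: "B \<inter> E = {}" using lB lE by fastforce
  have sup: "{I. int (m I) * lambda_bar I x \<noteq> 0} \<subseteq> B \<union> E"
  proof (rule subsetI, rule ccontr)
    fix I assume I: "I \<in> {I. int (m I) * lambda_bar I x \<noteq> 0}" "I \<notin> B \<union> E"
    then have "m I \<noteq> 0" by (cases "m I = 0") auto
    then have "fst I \<noteq> x" "snd I \<noteq> ereal x" using I(2) unfolding B_def E_def by blast+
    then have "lambda_bar I x = 0" by (rule lambda_bar_eq_0)
    then show False using I(1) by simp
  qed
  have "lambda_pmod M x = (\<Sum>I\<in>B \<union> E. int (m I) * lambda_bar I x)"
    unfolding lambda_pmod_def m_def[symmetric] by (rule Sum_any.expand_superset[OF finite_UnI[OF fB fE] sup])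
  also have "\<dots> = (\<Sum>I\<in>B. int (m I) * lambda_bar I x) + (\<Sum>I\<in>E. int (m I) * lambda_bar I x)"
    by (rule sum.union_disjoint[OF fB fE disj])
  also have "(\<Sum>I\<in>B. int (m I) * lambda_bar I x) = int (\<Sum>I\<in>B. m I)"
    unfolding of_nat_sum using lB by (intro sum.cong) auto
  also have "(\<Sum>I\<in>E. int (m I) * lambda_bar I x) = - int (\<Sum>I\<in>E. m I)"
    unfolding of_nat_sum sum_negf[symmetric] using lE by (intro sum.cong) auto
  finally show ?thesis
    using dim_bar_sum(2)[OF m] cx ct cB cE by simp
qed

lemma lambda_pmod_jump:
  "\<forall>\<^sub>F t in at_left x. lambda_pmod M x = int (fdim (pscale M) (V x)) - int (fdim (pscale M) (V t))"
proof -
  obtain \<epsilon> where \<epsilon>: "\<epsilon> > 0" "\<And>t t'. x - \<epsilon> < t \<Longrightarrow> t \<le> t' \<Longrightarrow> t' < x \<Longrightarrow> isoV t t'"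
    using no_accum unfolding no_left_accumulation_def by blast
  have "\<forall>\<^sub>F t in at_left x. t \<in> {x - \<epsilon><..<x}" using \<epsilon>(1) by (intro eventually_at_left_real) simp
  then show ?thesis
  proof eventually_elim
    case (elim t)
    then have "x - \<epsilon> < t" "t < x" by simp_all
    with \<epsilon> show ?case by (rule lambda_pmod_eq_jump)
  qed
qed

text \<open>
  The dimension does not jump away from critical values.
\<close>

lemma lambda_pmod_support: "finite {x. x \<le> c \<and> lambda_pmod M x \<noteq> 0}"
proof -
  have "lambda_pmod M x = 0" if "x \<notin> critical" for x
  proof -
    have "\<exists>e>0. \<forall>t. x - e < t \<and> t \<le> x \<longrightarrow> isoV t x"
      using that unfolding critical_def mem_Collect_eq not_not .
    then obtain e where e: "e > 0" "\<forall>t. x - e < t \<and> t \<le> x \<longrightarrow> isoV t x" by (elim exE conjE)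
    have "\<forall>\<^sub>F t in at_left x. t \<in> {x - e<..<x}" using e(1) by (intro eventually_at_left_real) simp
    with lambda_pmod_jump[of x] have "\<forall>\<^sub>F t in at_left x. lambda_pmod M x = 0"
    proof eventually_elim
      case (elim t)
      then have "t \<le> x" "isoV t x" using e(2) by simp_all
      then have "fdim (pscale M) (V t) = fdim (pscale M) (V x)"
        by (intro fdim_bij[OF ambient ambient subspaces fin_dim linear])
      then show ?case using elim by simp
    qed
    then show ?thesis using eventually_const[OF trivial_limit_at_left_real] by blast
  qed
  then have "{x. x \<le> c \<and> lambda_pmod M x \<noteq> 0} \<subseteq> critical \<inter> {..c}"
    by (intro subsetI IntI) (metis (mono_tags, lifting) mem_Collect_eq, simp)
  then show ?thesis using finite_critical finite_subset by blast
qed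

end

section \<open>Long exact sequences in a triangulated category\<close>

locale hom_finite_triangulated = triangulated_category C
  for C :: "('k::field, 'v::ab_group_add, 'o) tri_cat" +
  assumes fin_dim_hom: "finite_dimensional (Scale C) (Hom C A B)"
begin

sublocale vs: vector_space "Scale C" by (rule ambient)

lemma hom_zero: "0 \<in> Hom C A B" using hom_subspace by (rule vs.subspace_0)

lemma hom_neg: "f \<in> Hom C A B \<Longrightarrow> - f \<in> Hom C A B" using hom_subspace by (rule vs.subspace_neg)

lemma comp_closed: "f \<in> Hom C A B \<Longrightarrow> g \<in> Hom C B D \<Longrightarrow> Cmp C A B D f g \<in> Hom C A D"
  using comp_linear_left[of g B D A] unfolding linear_between_def by auto

lemma linear_between_0:
  assumes "linear_between (Scale C) (Scale C) V W \<phi>" "0 \<in> V"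
  shows "\<phi> 0 = 0"
proof -
  have "\<phi> (Scale C 0 0) = Scale C 0 (\<phi> 0)" using assms unfolding linear_between_def by blast
  then show ?thesis by simp
qed

lemma linear_between_neg:
  assumes "linear_between (Scale C) (Scale C) V W \<phi>" "x \<in> V"
  shows "\<phi> (- x) = - \<phi> x"
proof -
  have "\<phi> (Scale C (- 1) x) = Scale C (- 1) (\<phi> x)" using assms unfolding linear_between_def by blast
  then show ?thesis by simp
qed

lemma comp_0_left: "g \<in> Hom C B D \<Longrightarrow> Cmp C A B D 0 g = 0"
  using linear_between_0[OF comp_linear_left hom_zero] .

lemma comp_0_right: "f \<in> Hom C A B \<Longrightarrow> Cmp C A B D f 0 = 0"
  using linear_between_0[OF comp_linear_right hom_zero] .

lemma comp_neg_left: "f \<in> Hom C A B \<Longrightarrow> g \<in> Hom C B D \<Longrightarrow> Cmp C A B D (- f) g = - Cmp C A B D f g"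
  using linear_between_neg[OF comp_linear_left] .

lemma comp_neg_right: "f \<in> Hom C A B \<Longrightarrow> g \<in> Hom C B D \<Longrightarrow> Cmp C A B D f (- g) = - Cmp C A B D f g"
  using linear_between_neg[OF comp_linear_right] .

lemma T_closed: "f \<in> Hom C A B \<Longrightarrow> Tmor C A B f \<in> Hom C (Tob C A) (Tob C B)"
  using T_linear unfolding linear_between_def by blast

lemma T_0: "Tmor C A B 0 = 0"
  using linear_between_0[OF T_linear hom_zero] .

lemma T_inj: "f \<in> Hom C A B \<Longrightarrow> g \<in> Hom C A B \<Longrightarrow> Tmor C A B f = Tmor C A B g \<Longrightarrow> f = g"
  using T_bij_mor[of A B] unfolding bij_betw_def inj_on_def by blast

lemma T_surj:
  assumes "g \<in> Hom C (Tob C A) (Tob C B)"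
  obtains f where "f \<in> Hom C A B" "g = Tmor C A B f"
  using T_bij_mor[of A B] assms unfolding bij_betw_def by blast

lemma rotate: "(A, B, D, u, v, w) \<in> Exact C \<Longrightarrow> (B, D, Tob C A, v, w, - Tmor C A B u) \<in> Exact C"
  using exact_type[of A B D u v w] TR2[of u A B v D w] by blast

lemma exact_comp_zero:
  assumes "(A, B, D, u, v, w) \<in> Exact C"
  shows "Cmp C A B D u v = 0"
proof -
  obtain Z where Z: "zero_object C Z" using has_zero by blast
  have t: "u \<in> Hom C A B" "v \<in> Hom C B D" using exact_type[OF assms] by auto
  obtain h where "h \<in> Hom C Z D" "Cmp C A Z D 0 h = Cmp C A B D u v"
    using TR3[OF TR1_id[OF Z, of A] assms id_closed t(1) refl] by blast
  then show ?thesis using comp_0_left by simp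
qed

text \<open>
  Exactness of \<open>hom(X, -)\<close>: extend \<open>f\<close> and the zero map to a morphism from the rotation of
  \<open>X \<rightarrow> X \<rightarrow> 0\<close> to the rotation of the given triangle; its third component is, up to \<open>T\<close>, the factorization.
\<close>

lemma exact_covariant:
  assumes ex: "(A, B, D, u, v, w) \<in> Exact C" and f: "f \<in> Hom C X B" "Cmp C X B D f v = 0"
  shows "\<exists>h\<in>Hom C X A. Cmp C X A B h u = f"
proof -
  obtain Z where Z: "zero_object C Z" using has_zero by blast
  have t: "u \<in> Hom C A B" "v \<in> Hom C B D" using exact_type[OF ex] by auto
  have "Cmp C X Z D 0 0 = Cmp C X B D f v" using comp_0_left[OF hom_zero] f(2) by simp
  then obtain h' where h': "h' \<in> Hom C (Tob C X) (Tob C A)"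
    "Cmp C (Tob C X) (Tob C X) (Tob C B) (- Tmor C X X (Idn C X)) (Tmor C X B f)
      = Cmp C (Tob C X) (Tob C A) (Tob C B) h' (- Tmor C A B u)"
    using TR3[OF rotate[OF TR1_id[OF Z, of X]] rotate[OF ex] f(1) hom_zero] by blast
  obtain h where h: "h \<in> Hom C X A" "h' = Tmor C X A h" using T_surj[OF h'(1)] .
  have "- Tmor C X B f = - Tmor C X B (Cmp C X A B h u)"
    using h'(2) comp_neg_left[OF T_closed[OF id_closed] T_closed[OF f(1)]]
      comp_neg_right[OF h'(1) T_closed[OF t(1)]] T_comp[OF h(1) t(1)] T_comp[OF id_closed f(1)]
      id_left[OF f(1)] h(2) by simp
  then have "Cmp C X A B h u = f" using T_inj[OF f(1) comp_closed[OF h(1) t(1)]] by simp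
  then show ?thesis using h(1) by blast
qed

text \<open>
  Exactness of \<open>hom(-, N)\<close>, by extending \<open>f\<close> to a morphism into the triangle \<open>0 \<rightarrow> N \<rightarrow> N\<close>. That triangle is the
  backward rotation of \<open>N \<rightarrow> N \<rightarrow> 0\<close>, and its first object must be one whose translate is the given zero object.
\<close>

lemma exact_contravariant:
  assumes ex: "(A, B, D, u, v, w) \<in> Exact C" and f: "f \<in> Hom C B N" "Cmp C A B N u f = 0"
  shows "\<exists>h\<in>Hom C D N. Cmp C B D N v h = f"
proof -
  obtain Z where Z: "zero_object C Z" using has_zero by blast
  obtain Z' where Z': "Z = Tob C Z'" using T_bij_ob by (metis bij_pointE)
  have "(N, N, Tob C Z', Idn C N, 0, - Tmor C Z' N 0) \<in> Exact C"
    using TR1_id[OF Z, of N] Z' T_0 by simp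
  then have t: "(Z', N, N, 0, Idn C N, 0) \<in> Exact C"
    using TR2[OF hom_zero id_closed hom_zero] by blast
  have "Cmp C A B N u f = Cmp C A Z' N 0 0" using f(2) comp_0_left[OF hom_zero] by simp
  then obtain h where "h \<in> Hom C D N" "Cmp C B D N v h = Cmp C B N N f (Idn C N)"
    using TR3[OF ex t hom_zero f(1)] by blast
  then show ?thesis using id_right[OF f(1)] by auto
qed

definition "rank_post X A B u = fdim (Scale C) ((\<lambda>f. Cmp C X A B f u) ` Hom C X A)"
definition "rank_pre A B N u = fdim (Scale C) ((\<lambda>f. Cmp C A B N u f) ` Hom C B N)"
abbreviation "hdim A B \<equiv> fdim (Scale C) (Hom C A B)"

lemma hdim_T: "hdim (Tob C A) (Tob C B) = hdim A B"
  using fdim_bij[OF ambient ambient hom_subspace fin_dim_hom T_linear T_bij_mor] by simp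

lemma hdim_covariant:
  assumes ex: "(A, B, D, u, v, w) \<in> Exact C"
  shows "hdim X B = rank_post X A B u + rank_post X B D v"
proof -
  have t: "u \<in> Hom C A B" "v \<in> Hom C B D" using exact_type[OF ex] by auto
  have "{f \<in> Hom C X B. Cmp C X B D f v = 0} = (\<lambda>f. Cmp C X A B f u) ` Hom C X A" (is "?L = ?R")
  proof
    show "?L \<subseteq> ?R" using exact_covariant[OF ex] by blast
    show "?R \<subseteq> ?L"
    proof
      fix g assume "g \<in> ?R"
      then obtain f where f: "f \<in> Hom C X A" "g = Cmp C X A B f u" by blast
      then have "Cmp C X B D g v = Cmp C X A D f (Cmp C A B D u v)" using comp_assoc t by simp
      then show "g \<in> ?L" using f t comp_closed exact_comp_zero[OF ex] comp_0_right by simp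
    qed
  qed
  then show ?thesis unfolding rank_post_def
    using rank_nullity[OF ambient ambient hom_subspace fin_dim_hom comp_linear_left[OF t(2)]] by simp
qed

lemma hdim_contravariant:
  assumes ex: "(A, B, D, u, v, w) \<in> Exact C"
  shows "hdim B N = rank_pre A B N u + rank_pre B D N v"
proof -
  have t: "u \<in> Hom C A B" "v \<in> Hom C B D" using exact_type[OF ex] by auto
  have "{f \<in> Hom C B N. Cmp C A B N u f = 0} = (\<lambda>f. Cmp C B D N v f) ` Hom C D N" (is "?L = ?R")
  proof
    show "?L \<subseteq> ?R" using exact_contravariant[OF ex] by blast
    show "?R \<subseteq> ?L"
    proof
      fix g assume "g \<in> ?R"
      then obtain f where f: "f \<in> Hom C D N" "g = Cmp C B D N v f" by blast
      then have "Cmp C A B N u g = Cmp C A D N (Cmp C A B D u v) f" using comp_assoc[OF t] by simp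
      then show "g \<in> ?L" using f t comp_closed exact_comp_zero[OF ex] comp_0_left by simp
    qed
  qed
  then show ?thesis unfolding rank_pre_def
    using rank_nullity[OF ambient ambient hom_subspace fin_dim_hom comp_linear_right[OF t(1)]] by simp
qed

lemma fdim_T_image:
  assumes V: "vs.subspace V" "finite_dimensional (Scale C) V" "V \<subseteq> Hom C A B"
  shows "fdim (Scale C) (Tmor C A B ` V) = fdim (Scale C) V"
proof -
  have "linear_between (Scale C) (Scale C) V (Tmor C A B ` V) (Tmor C A B)"
    using T_linear[of A B] V(3) unfolding linear_between_def by blast
  moreover have "bij_betw (Tmor C A B) V (Tmor C A B ` V)"
    using T_bij_mor[of A B] V(3) by (meson bij_betw_imp_inj_on inj_on_imp_bij_betw inj_on_subset)
  ultimately show ?thesis using fdim_bij[OF ambient ambient V(1,2)] by simp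
qed

lemma image_subspace:
  assumes "linear_between (Scale C) (Scale C) (Hom C A B) W \<phi>"
  shows "vs.subspace (\<phi> ` Hom C A B)" "finite_dimensional (Scale C) (\<phi> ` Hom C A B)"
proof -
  show sub: "vs.subspace (\<phi> ` Hom C A B)"
    unfolding vs.subspace_def
  proof (intro conjI ballI allI)
    show "0 \<in> \<phi> ` Hom C A B" using linear_between_0[OF assms hom_zero] hom_zero by (metis imageI)
    fix x y assume "x \<in> \<phi> ` Hom C A B" "y \<in> \<phi> ` Hom C A B"
    then obtain x' y' where *: "x' \<in> Hom C A B" "y' \<in> Hom C A B" "x = \<phi> x'" "y = \<phi> y'" by blast
    then have "x + y = \<phi> (x' + y')" using assms unfolding linear_between_def by simp
    then show "x + y \<in> \<phi> ` Hom C A B" using vs.subspace_add[OF hom_subspace *(1,2)] by blast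
  next
    fix c x assume "x \<in> \<phi> ` Hom C A B"
    then obtain x' where *: "x' \<in> Hom C A B" "x = \<phi> x'" by blast
    then have "Scale C c x = \<phi> (Scale C c x')" using assms unfolding linear_between_def by simp
    then show "Scale C c x \<in> \<phi> ` Hom C A B" using vs.subspace_scale[OF hom_subspace *(1)] by blast
  qed
  have "linear_between (Scale C) (Scale C) (Hom C A B) (\<phi> ` Hom C A B) \<phi>"
    using assms unfolding linear_between_def by blast
  then show "finite_dimensional (Scale C) (\<phi> ` Hom C A B)"
    using finite_dimensional_image[OF ambient ambient hom_subspace sub fin_dim_hom] by blast
qed

lemma T_image_hom: "Tmor C A B ` Hom C A B = Hom C (Tob C A) (Tob C B)"
  using T_bij_mor by (rule bij_betw_imp_surj_on)

lemma neg_image_hom: "uminus ` Hom C A B = Hom C A B"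
proof
  show "uminus ` Hom C A B \<subseteq> Hom C A B" using hom_neg by blast
  show "Hom C A B \<subseteq> uminus ` Hom C A B"
  proof
    fix x assume "x \<in> Hom C A B"
    then have "- x \<in> Hom C A B" "x = - (- x)" using hom_neg by auto
    then show "x \<in> uminus ` Hom C A B" by (metis imageI)
  qed
qed

text \<open>
  The sign introduced by rotating a triangle does not change the image, since precomposed morphisms
  range over a subspace.
\<close>

lemma rank_post_T:
  assumes u: "u \<in> Hom C A B"
  shows "rank_post (Tob C X) (Tob C A) (Tob C B) (- Tmor C A B u) = rank_post X A B u"
proof -
  let ?X = "Tob C X" and ?A = "Tob C A" and ?B = "Tob C B"
  have "(\<lambda>f. Cmp C ?X ?A ?B f (- Tmor C A B u)) ` Hom C ?X ?A
      = (\<lambda>f. Cmp C ?X ?A ?B (- f) (Tmor C A B u)) ` Hom C ?X ?A"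
    using comp_neg_left comp_neg_right T_closed[OF u] by (intro image_cong) auto
  also have "\<dots> = (\<lambda>f. Cmp C ?X ?A ?B f (Tmor C A B u)) ` uminus ` Hom C ?X ?A"
    by (simp add: image_image)
  also have "\<dots> = (\<lambda>f. Cmp C ?X ?A ?B f (Tmor C A B u)) ` Tmor C X A ` Hom C X A"
    by (simp only: neg_image_hom T_image_hom)
  also have "\<dots> = Tmor C X B ` (\<lambda>f. Cmp C X A B f u) ` Hom C X A"
    unfolding image_image using T_comp[OF _ u] by (intro image_cong) auto
  finally show ?thesis
    unfolding rank_post_def
    using fdim_T_image[OF image_subspace[OF comp_linear_left[OF u]], of X X B] comp_closed[OF _ u] by auto
qed

lemma rank_pre_T:
  assumes u: "u \<in> Hom C A B"
  shows "rank_pre (Tob C A) (Tob C B) (Tob C N) (- Tmor C A B u) = rank_pre A B N u"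
proof -
  let ?N = "Tob C N" and ?A = "Tob C A" and ?B = "Tob C B"
  have "(\<lambda>f. Cmp C ?A ?B ?N (- Tmor C A B u) f) ` Hom C ?B ?N
      = (\<lambda>f. Cmp C ?A ?B ?N (Tmor C A B u) (- f)) ` Hom C ?B ?N"
    using comp_neg_left comp_neg_right T_closed[OF u] by (intro image_cong) auto
  also have "\<dots> = (\<lambda>f. Cmp C ?A ?B ?N (Tmor C A B u) f) ` uminus ` Hom C ?B ?N"
    by (simp add: image_image)
  also have "\<dots> = (\<lambda>f. Cmp C ?A ?B ?N (Tmor C A B u) f) ` Tmor C B N ` Hom C B N"
    by (simp only: neg_image_hom T_image_hom)
  also have "\<dots> = Tmor C A N ` (\<lambda>f. Cmp C A B N u f) ` Hom C B N"
    unfolding image_image using T_comp[OF u] by (intro image_cong) auto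
  finally show ?thesis
    unfolding rank_pre_def
    using fdim_T_image[OF image_subspace[OF comp_linear_right[OF u]], of N A N] comp_closed[OF u] by auto
qed

text \<open>
  The long exact sequence in terms of ranks. The triangle stays fixed and the first
  argument is translated instead, so the three ranks at \<open>X\<close> and the one at \<open>T X\<close> come from the same three morphisms.
\<close>

lemma exact_hdim_covariant:
  assumes ex: "(A, B, D, u, v, w) \<in> Exact C"
  shows "hdim X A = rank_post (Tob C X) D (Tob C A) w + rank_post X A B u"
    and "hdim X B = rank_post X A B u + rank_post X B D v"
    and "hdim X D = rank_post X B D v + rank_post X D (Tob C A) w"
  using hdim_covariant[OF ex] hdim_covariant[OF rotate[OF ex]]
    hdim_covariant[OF rotate[OF rotate[OF ex]], of "Tob C X"] rank_post_T[of u A B X] exact_type[OF ex] hdim_T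
  by simp_all

text \<open>
  The dual of the preceding statement: the triangle is fixed and the target is translated.
\<close>

lemma exact_hdim_contravariant:
  assumes ex: "(A, B, D, u, v, w) \<in> Exact C"
  shows "hdim A N = rank_pre D (Tob C A) (Tob C N) w + rank_pre A B N u"
    and "hdim B N = rank_pre A B N u + rank_pre B D N v"
    and "hdim D N = rank_pre B D N v + rank_pre D (Tob C A) N w"
  using hdim_contravariant[OF ex] hdim_contravariant[OF rotate[OF ex]]
    hdim_contravariant[OF rotate[OF rotate[OF ex]], of "Tob C N"] rank_pre_T[of u A B N] exact_type[OF ex] hdim_T
  by simp_all

end

definition sign :: "int \<Rightarrow> int" where "sign i = (if even i then 1 else - 1)"

text \<open>
  In the alternating sum the ranks of the connecting maps occur as \<open>t i\<close> and \<open>t (i + 1)\<close> and telescope.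
\<close>

lemma euler_additive:
  fixes a b d r s t :: "int \<Rightarrow> nat"
  assumes eq: "\<And>i. a i = t (i + 1) + r i" "\<And>i. b i = r i + s i" "\<And>i. d i = s i + t i"
    and fin: "finite {i. a i \<noteq> 0}" "finite {i. b i \<noteq> 0}" "finite {i. d i \<noteq> 0}"
  shows "Sum_any (\<lambda>i. sign i * int (b i)) = Sum_any (\<lambda>i. sign i * int (a i)) + Sum_any (\<lambda>i. sign i * int (d i))"
proof -
  define F where "F = {i. a i \<noteq> 0} \<union> {i. b i \<noteq> 0} \<union> {i. d i \<noteq> 0}"
  \<comment> \<open>enlarged so that every \<open>i\<close> with \<open>t i \<noteq> 0\<close> or \<open>t (i + 1) \<noteq> 0\<close> is contained\<close>
  define G where "G = F \<union> (\<lambda>i. i + 1) ` F"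
  have fG: "finite G" unfolding G_def F_def using fin by simp
  have out: "a i = 0 \<and> b i = 0 \<and> d i = 0" if "i \<notin> G" for i using that unfolding G_def F_def by auto
  have S: "Sum_any (\<lambda>i. sign i * int (f i)) = (\<Sum>i\<in>G. sign i * int (f i))"
    if "\<And>i. i \<notin> G \<Longrightarrow> f i = 0" for f :: "int \<Rightarrow> nat"
  proof (rule Sum_any.expand_superset[OF fG], rule subsetI, rule ccontr)
    fix i assume "i \<in> {i. sign i * int (f i) \<noteq> 0}" "i \<notin> G"
    then show False using that[of i] by simp
  qed
  have "(\<Sum>i\<in>G. sign i * int (t (i + 1))) = (\<Sum>i\<in>F. sign i * int (t (i + 1)))"
    using fG eq(1) unfolding G_def F_def by (intro sum.mono_neutral_right) auto
  also have "\<dots> = (\<Sum>i\<in>(\<lambda>i. i + 1) ` F. - sign i * int (t i))"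
    by (subst sum.reindex) (auto simp: sign_def intro: inj_onI intro!: sum.cong)
  also have "\<dots> = (\<Sum>i\<in>G. - sign i * int (t i))"
  proof (rule sum.mono_neutral_left[OF fG])
    show "(\<lambda>i. i + 1) ` F \<subseteq> G" unfolding G_def by simp
    show "\<forall>i\<in>G - (\<lambda>i. i + 1) ` F. - sign i * int (t i) = 0"
    proof
      fix i assume "i \<in> G - (\<lambda>i. i + 1) ` F"
      then have "i - 1 \<notin> F" by force
      then show "- sign i * int (t i) = 0" using eq(1)[of "i - 1"] unfolding F_def by simp
    qed
  qed
  finally have t: "(\<Sum>i\<in>G. sign i * int (t (i + 1))) + (\<Sum>i\<in>G. sign i * int (t i)) = 0"
    by (simp add: sum_negf)
  have "(\<Sum>i\<in>G. sign i * int (a i)) + (\<Sum>i\<in>G. sign i * int (d i))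
    = ((\<Sum>i\<in>G. sign i * int (t (i + 1))) + (\<Sum>i\<in>G. sign i * int (t i))) + (\<Sum>i\<in>G. sign i * int (b i))"
    unfolding eq sum.distrib[symmetric] by (intro sum.cong) (auto simp: algebra_simps)
  then show ?thesis using t S[of a] S[of b] S[of d] out by simp
qed

section \<open>Euler characteristics in a persistence category\<close>

locale tame_bounded_tpc = triangulated_persistence_category C
  for C :: "('k::field, 'v::ab_group_add, 'o) pers_cat" +
  assumes is_tame: "tame C" and is_bounded: "bounded_category C"
    and hom_no_accum: "no_left_accumulation (hom_pmod C A B)"
begin

abbreviation "C0 \<equiv> degree_zero C"

lemma degree_zero_simps [simp]:
  "Scale C0 = PScale C" "Hom C0 A B = PHom C A B 0" "Cmp C0 = PCmp C 0 0" "Idn C0 = PId C"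
  "Tob C0 = PTob C" "Tmor C0 = PTmor C" "Exact C0 = PExact C"
  by (simp_all add: degree_zero_def)

lemma hom_pmod_simps [simp]:
  "pscale (hom_pmod C A B) = PScale C" "pspace (hom_pmod C A B) = PHom C A B" "pmap (hom_pmod C A B) = PMap C A B"
  by (simp_all add: hom_pmod_def)

lemma locally_finite_hom: "locally_finite_pmod (hom_pmod C A B)"
  using hom_persistence hom_no_accum is_tame
  unfolding locally_finite_pmod_def locally_finite_pmod_axioms_def tame_def by simp

sublocale tri: hom_finite_triangulated C0
  using degree_zero_triangulated is_tame
  unfolding hom_finite_triangulated_def hom_finite_triangulated_axioms_def tame_def by simp

definition "hom_dim s A B = fdim (PScale C) (PHom C A B s)"

lemma vs: "vector_space (PScale C)" using tri.ambient by simp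

lemma PHom_subspace: "Modules.module.subspace (PScale C) (PHom C A B s)"
  using persistence_module.subspaces[OF hom_persistence, of A B s] by simp

lemma fin_dim: "finite_dimensional (PScale C) (PHom C A B s)"
  using is_tame unfolding tame_def by blast

lemma hom_dim_bij:
  assumes "linear_between (PScale C) (PScale C) (PHom C A B s) (PHom C A' B' s') f"
    and "bij_betw f (PHom C A B s) (PHom C A' B' s')"
  shows "hom_dim s A B = hom_dim s' A' B'"
  unfolding hom_dim_def using fdim_bij[OF vs vs PHom_subspace fin_dim assms] .

lemma PCmp_closed: "f \<in> PHom C A B r \<Longrightarrow> g \<in> PHom C B D s \<Longrightarrow> PCmp C r s A B D f g \<in> PHom C A D (r + s)"
  using comp_linear_left[of g B D s A r] unfolding linear_between_def by blast

text \<open>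
  Precomposition with an invertible morphism of degree \<open>r\<close> shifts the degree by \<open>r\<close>. For \<open>r = 0\<close> this is
  invariance under isomorphism; for \<open>\<eta>\<close> it expresses that \<open>\<Sigma>\<^sup>q X\<close> is \<open>X\<close> with a shifted filtration.
\<close>

lemma hom_dim_precomp:
  assumes e: "e \<in> PHom C A B r" "e' \<in> PHom C B A (- r)"
    and inv: "PCmp C r (- r) A B A e e' = PId C A" "PCmp C (- r) r B A B e' e = PId C B"
  shows "hom_dim s B Y = hom_dim (r + s) A Y"
proof (rule hom_dim_bij[OF comp_linear_right[OF e(1)]])
  show "bij_betw (\<lambda>g. PCmp C r s A B Y e g) (PHom C B Y s) (PHom C A Y (r + s))"
  proof (rule bij_betwI[where g = "\<lambda>g. PCmp C (- r) (r + s) B A Y e' g"])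
    show "(\<lambda>g. PCmp C r s A B Y e g) \<in> PHom C B Y s \<rightarrow> PHom C A Y (r + s)"
      using PCmp_closed[OF e(1)] by blast
    show "(\<lambda>g. PCmp C (- r) (r + s) B A Y e' g) \<in> PHom C A Y (r + s) \<rightarrow> PHom C B Y s"
    proof
      fix g assume "g \<in> PHom C A Y (r + s)"
      then show "PCmp C (- r) (r + s) B A Y e' g \<in> PHom C B Y s"
        using PCmp_closed[OF e(2), of g Y "r + s"] by simp
    qed
    fix g assume g: "g \<in> PHom C B Y s"
    show "PCmp C (- r) (r + s) B A Y e' (PCmp C r s A B Y e g) = g"
      using comp_assoc[OF e(2,1) g] inv(2) id_left[OF g] by simp
  next
    fix g assume g: "g \<in> PHom C A Y (r + s)"
    show "PCmp C r s A B Y e (PCmp C (- r) (r + s) B A Y e' g) = g"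
      using comp_assoc[OF e g] inv(1) id_left[OF g] by simp
  qed
qed

lemma hom_dim_postcomp:
  assumes e: "e \<in> PHom C A B r" "e' \<in> PHom C B A (- r)"
    and inv: "PCmp C r (- r) A B A e e' = PId C A" "PCmp C (- r) r B A B e' e = PId C B"
  shows "hom_dim s Y A = hom_dim (s + r) Y B"
proof (rule hom_dim_bij[OF comp_linear_left[OF e(1)]])
  show "bij_betw (\<lambda>g. PCmp C s r Y A B g e) (PHom C Y A s) (PHom C Y B (s + r))"
  proof (rule bij_betwI[where g = "\<lambda>g. PCmp C (s + r) (- r) Y B A g e'"])
    show "(\<lambda>g. PCmp C s r Y A B g e) \<in> PHom C Y A s \<rightarrow> PHom C Y B (s + r)"
      using PCmp_closed[OF _ e(1)] by blast
    show "(\<lambda>g. PCmp C (s + r) (- r) Y B A g e') \<in> PHom C Y B (s + r) \<rightarrow> PHom C Y A s"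
    proof
      fix g assume "g \<in> PHom C Y B (s + r)"
      then show "PCmp C (s + r) (- r) Y B A g e' \<in> PHom C Y A s"
        using PCmp_closed[OF _ e(2), of g Y "s + r"] by simp
    qed
    fix g assume g: "g \<in> PHom C Y A s"
    show "PCmp C (s + r) (- r) Y B A (PCmp C s r Y A B g e) e' = g"
      using comp_assoc[OF g e] inv(1) id_right[OF g] by simp
  next
    fix g assume g: "g \<in> PHom C Y B (s + r)"
    show "PCmp C s r Y A B (PCmp C (s + r) (- r) Y B A g e') e = g"
      using comp_assoc[OF g e(2,1)] inv(2) id_right[OF g] by simp
  qed
qed

lemma eta_invertible:
  "Eta C 0 q X \<in> PHom C X (Sob C q X) q" "Eta C q 0 X \<in> PHom C (Sob C q X) X (- q)"
  "PCmp C q (- q) X (Sob C q X) X (Eta C 0 q X) (Eta C q 0 X) = PId C X"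
  "PCmp C (- q) q (Sob C q X) X (Sob C q X) (Eta C q 0 X) (Eta C 0 q X) = PId C (Sob C q X)"
  using eta_closed[of 0 q X] eta_closed[of q 0 X] eta_trans[of q 0 0 X] eta_trans[of 0 q q X] eta_refl[of 0 X] eta_refl[of q X]
  by (simp_all add: shift_zero_ob)

lemma hom_dim_shift_left: "hom_dim s (Sob C q X) Y = hom_dim (q + s) X Y"
  using hom_dim_precomp[OF eta_invertible] .

lemma hom_dim_shift_right: "hom_dim s X (Sob C q Y) = hom_dim (s - q) X Y"
  using hom_dim_postcomp[of "Eta C q 0 Y" "Sob C q Y" Y "- q" "Eta C 0 q Y" s X] eta_invertible[of q Y] by simp

definition "iso_ob A B \<longleftrightarrow> (\<exists>f. iso_in C0 A B f)"

lemma iso_obI: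
  "f \<in> PHom C A B 0 \<Longrightarrow> g \<in> PHom C B A 0 \<Longrightarrow> PCmp C 0 0 A B A f g = PId C A \<Longrightarrow>
   PCmp C 0 0 B A B g f = PId C B \<Longrightarrow> iso_ob A B"
  unfolding iso_ob_def iso_in_def by auto

lemma iso_obE:
  assumes "iso_ob A B"
  obtains f g where "f \<in> PHom C A B 0" "g \<in> PHom C B A 0" "PCmp C 0 0 A B A f g = PId C A"
    "PCmp C 0 0 B A B g f = PId C B"
  using assms unfolding iso_ob_def iso_in_def by auto

lemma hom_dim_iso_ob: "iso_ob A B \<Longrightarrow> hom_dim s X A = hom_dim s X B"
  using hom_dim_postcomp[of _ A B 0 _ s X] by (elim iso_obE) simp

lemma iso_ob_refl: "iso_ob A A"
  using iso_obI[OF id_closed id_closed] id_left[OF id_closed] by simp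

lemma iso_ob_sym: "iso_ob A B \<Longrightarrow> iso_ob B A"
  by (elim iso_obE) (rule iso_obI)

lemma iso_ob_trans:
  assumes "iso_ob A B" "iso_ob B D"
  shows "iso_ob A D"
proof -
  obtain f g where f: "f \<in> PHom C A B 0" "g \<in> PHom C B A 0" "PCmp C 0 0 A B A f g = PId C A"
    "PCmp C 0 0 B A B g f = PId C B" using assms(1) by (rule iso_obE)
  obtain f' g' where f': "f' \<in> PHom C B D 0" "g' \<in> PHom C D B 0" "PCmp C 0 0 B D B f' g' = PId C B"
    "PCmp C 0 0 D B D g' f' = PId C D" using assms(2) by (rule iso_obE)
  let ?F = "PCmp C 0 0 A B D f f'" and ?G = "PCmp C 0 0 D B A g' g"
  have F: "?F \<in> PHom C A D 0" "?G \<in> PHom C D A 0"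
    using PCmp_closed[OF f(1) f'(1)] PCmp_closed[OF f'(2) f(2)] by simp_all
  have "PCmp C 0 0 A D A ?F ?G = PCmp C 0 0 A B A f (PCmp C 0 0 B D A f' ?G)"
    using comp_assoc[OF f(1) f'(1), of ?G A 0] F(2) by simp
  also have "PCmp C 0 0 B D A f' ?G = g"
    using comp_assoc[OF f'(1,2) f(2)] f'(3) id_left[OF f(2)] by simp
  finally have 1: "PCmp C 0 0 A D A ?F ?G = PId C A" using f(3) by simp
  have "PCmp C 0 0 D A D ?G ?F = PCmp C 0 0 D B D g' (PCmp C 0 0 B A D g ?F)"
    using comp_assoc[OF f'(2) f(2), of ?F D 0] F(1) by simp
  also have "PCmp C 0 0 B A D g ?F = f'"
    using comp_assoc[OF f(2,1) f'(1)] f(4) id_left[OF f'(1)] by simp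
  finally have 2: "PCmp C 0 0 D A D ?G ?F = PId C D" using f'(4) by simp
  show ?thesis using iso_obI[OF F 1 2] .
qed

text \<open>
  The translation functor is fully faithful, so it also reflects isomorphisms. This direction is what allows
  the descent to negative powers of \<open>T\<close>.
\<close>

lemma iso_ob_T: "iso_ob A B \<longleftrightarrow> iso_ob (PTob C A) (PTob C B)"
proof
  assume "iso_ob A B"
  then obtain f g where f: "f \<in> PHom C A B 0" "g \<in> PHom C B A 0" "PCmp C 0 0 A B A f g = PId C A"
    "PCmp C 0 0 B A B g f = PId C B" by (rule iso_obE)
  show "iso_ob (PTob C A) (PTob C B)"
    using tri.T_closed[of f A B] tri.T_closed[of g B A] tri.T_comp[of f A B g A] tri.T_comp[of g B A f B]
      tri.T_id f by (intro iso_obI[of "PTmor C A B f" _ _ "PTmor C B A g"]) simp_all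
next
  assume "iso_ob (PTob C A) (PTob C B)"
  then obtain f' g' where f': "f' \<in> PHom C (PTob C A) (PTob C B) 0" "g' \<in> PHom C (PTob C B) (PTob C A) 0"
    "PCmp C 0 0 (PTob C A) (PTob C B) (PTob C A) f' g' = PId C (PTob C A)"
    "PCmp C 0 0 (PTob C B) (PTob C A) (PTob C B) g' f' = PId C (PTob C B)" by (rule iso_obE)
  obtain f where f: "f \<in> PHom C A B 0" "f' = PTmor C A B f" using tri.T_surj[of f' A B] f'(1) by auto
  obtain g where g: "g \<in> PHom C B A 0" "g' = PTmor C B A g" using tri.T_surj[of g' B A] f'(2) by auto
  have "PTmor C A A (PCmp C 0 0 A B A f g) = PTmor C A A (PId C A)"
    "PTmor C B B (PCmp C 0 0 B A B g f) = PTmor C B B (PId C B)"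
    using tri.T_comp[of f A B g A] tri.T_comp[of g B A f B] f g f' tri.T_id by simp_all
  then show "iso_ob A B"
    using tri.T_inj[of _ A A] tri.T_inj[of _ B B] tri.comp_closed[of f A B g A] tri.comp_closed[of g B A f B] f g id_closed
    by (intro iso_obI[OF f(1) g(1)]) simp_all
qed

abbreviation "Tp \<equiv> T_pow C"

lemma bij_T: "bij (PTob C)" using tri.T_bij_ob by simp

lemma T_pow_0: "Tp 0 Y = Y" by (simp add: T_pow_def)

lemma T_pow_Suc: "Tp (i + 1) Y = PTob C (Tp i Y)"
proof (cases "i \<ge> 0")
  case True
  then show ?thesis by (simp add: T_pow_def nat_add_distrib)
next
  case False
  define n where "n = nat (- i - 1)"
  have n: "nat (- i) = Suc n" "nat (- (i + 1)) = n" using False unfolding n_def by auto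
  have s: "PTob C (inv_into UNIV (PTob C) z) = z" for z using bij_T by (simp add: bij_is_surj surj_f_inv_f)
  show ?thesis
  proof (cases "i = - 1")
    case True
    then show ?thesis using s by (simp add: T_pow_def)
  next
    case False
    then show ?thesis using \<open>\<not> i \<ge> 0\<close> s n by (simp add: T_pow_def)
  qed
qed

lemma T_pow_pred: "PTob C (Tp (i - 1) Y) = Tp i Y"
  using T_pow_Suc[of "i - 1" Y] by simp

lemma inj_T: "PTob C A = PTob C B \<Longrightarrow> A = B" using bij_T by (simp add: bij_is_inj inj_eq)

lemma T_pow_add: "Tp i (Tp j Y) = Tp (i + j) Y"
proof (induction i rule: int_induct[where k = 0])
  case base
  then show ?case by (simp add: T_pow_0)
next
  case (step1 i)
  have "Tp (i + 1) (Tp j Y) = Tp (i + j + 1) Y" using step1 by (simp only: T_pow_Suc)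
  then show ?case by (simp only: ac_simps)
next
  case (step2 i)
  have "PTob C (Tp (i - 1) (Tp j Y)) = PTob C (Tp (i - 1 + j) Y)"
    using step2 T_pow_pred[of "i + j" Y] by (simp add: T_pow_pred algebra_simps)
  then show ?case by (rule inj_T)
qed

lemma hom_dim_T: "hom_dim 0 (PTob C A) (PTob C B) = hom_dim 0 A B"
  using tri.hdim_T[of A B] by (simp add: hom_dim_def)

lemma hom_dim_T_pow: "hom_dim 0 (Tp i A) (Tp i B) = hom_dim 0 A B"
proof (induction i rule: int_induct[where k = 0])
  case base
  then show ?case by (simp add: T_pow_0)
next
  case (step1 i)
  then show ?case by (simp add: T_pow_Suc hom_dim_T)
next
  case (step2 i)
  then show ?case using hom_dim_T[of "Tp (i - 1) A" "Tp (i - 1) B"] by (simp add: T_pow_pred)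
qed

lemma hom_dim_T_pow_swap: "hom_dim 0 A (Tp i B) = hom_dim 0 (Tp (- i) A) B"
  using hom_dim_T_pow[of "- i" A "Tp i B"] by (simp add: T_pow_add T_pow_0)

lemma shift_T_iso: "iso_ob (Sob C r (PTob C A)) (PTob C (Sob C r A))"
  using shift_exact[of r] unfolding iso_ob_def by blast

text \<open>
  Only the commutation of \<open>\<Sigma>\<^sup>r\<close> with \<open>T\<close> itself is given. Negative powers follow by applying \<open>T\<close> and cancelling it.
\<close>

lemma shift_T_pow_iso: "iso_ob (Sob C r (Tp i Y)) (Tp i (Sob C r Y))"
proof (induction i rule: int_induct[where k = 0])
  case base
  then show ?case by (simp add: T_pow_0 iso_ob_refl)
next
  case (step1 i)
  then show ?case using shift_T_iso[of r "Tp i Y"] iso_ob_T iso_ob_trans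
    by (simp add: T_pow_Suc)
next
  case (step2 i)
  have "iso_ob (PTob C (Sob C r (Tp (i - 1) Y))) (PTob C (Tp (i - 1) (Sob C r Y)))"
    using iso_ob_trans[OF iso_ob_sym[OF shift_T_iso[of r "Tp (i - 1) Y"]]] step2 by (simp add: T_pow_pred)
  then show ?case using iso_ob_T by blast
qed

definition "chi s X Y = Sum_any (\<lambda>i. sign i * int (hom_dim s X (Tp i Y)))"

lemma fdim_zero: "fdim (PScale C) {0} = 0"
proof -
  interpret vector_space "PScale C" by (rule vs)
  show ?thesis unfolding fdim_def using dim_eq_card[of "{}" "{0}"] by (simp add: independent_empty)
qed

lemma bounded_hom:
  obtains F :: "int set" where "finite F" "\<And>i s. i \<notin> F \<Longrightarrow> hom_dim s X (Tp i Y) = 0"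
proof -
  obtain l where l: "\<And>i s. \<bar>i\<bar> \<ge> l \<Longrightarrow> PHom C X (Tp i Y) s = {0}"
    using is_bounded unfolding bounded_category_def by blast
  show ?thesis
  proof (rule that[of "{- l..l}"])
    fix i s assume "i \<notin> {- l..l}"
    then have "\<bar>i\<bar> \<ge> l" by auto
    then show "hom_dim s X (Tp i Y) = 0" unfolding hom_dim_def using l fdim_zero by simp
  qed simp
qed

lemma finite_hom_dim: "finite {i. hom_dim s X (Tp i Y) \<noteq> 0}"
proof -
  obtain F where F: "finite F" "\<And>i s. i \<notin> F \<Longrightarrow> hom_dim s X (Tp i Y) = 0" using bounded_hom by blast
  have "{i. hom_dim s X (Tp i Y) \<noteq> 0} \<subseteq> F"
  proof (rule subsetI, rule ccontr)
    fix i assume "i \<in> {i. hom_dim s X (Tp i Y) \<noteq> 0}" "i \<notin> F"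
    then show False using F(2)[of i s] by simp
  qed
  then show ?thesis using F(1) finite_subset by blast
qed

lemma sign_minus: "sign (- i) = sign i" by (simp add: sign_def)

text \<open>
  Translating the first argument instead of the second reverses the sign of the index, which leaves the
  parity unchanged. In this form an exact triangle in the second argument stays fixed.
\<close>

lemma chi_swap: "chi s X Y = Sum_any (\<lambda>i. sign i * int (hom_dim 0 (Tp i (Sob C s X)) Y))"
proof -
  have "hom_dim s X (Tp i Y) = hom_dim 0 (Tp (- i) (Sob C s X)) Y" for i
    using hom_dim_shift_left[of 0 s X "Tp i Y"] hom_dim_T_pow_swap[of "Sob C s X" i Y] by simp
  then show ?thesis unfolding chi_def
    by (intro Sum_any.reindex_cong[of uminus, symmetric])
      (auto simp: sign_minus fun_eq_iff intro!: o_bij[of uminus])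
qed

lemma chi_add_right:
  assumes ex: "(A, B, D, u, v, w) \<in> PExact C"
  shows "chi s X B = chi s X A + chi s X D"
proof -
  let ?X = "\<lambda>i. Tp i (Sob C s X)"
  have ex': "(A, B, D, u, v, w) \<in> Exact C0" using ex by simp
  have fin: "finite {i. hom_dim 0 (?X i) Z \<noteq> 0}" for Z
  proof -
    have "hom_dim 0 (?X i) Z = hom_dim s X (Tp (- i) Z)" for i
      using hom_dim_shift_left[of 0 s X "Tp (- i) Z"] hom_dim_T_pow_swap[of "Sob C s X" "- i" Z] by simp
    then have "{i. hom_dim 0 (?X i) Z \<noteq> 0} = uminus ` {i. hom_dim s X (Tp i Z) \<noteq> 0}"
      by (auto simp: image_iff) (metis minus_minus)
    then show ?thesis using finite_hom_dim by simp
  qed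
  show ?thesis unfolding chi_swap
  proof (rule euler_additive[OF _ _ _ fin fin fin])
    fix i
    show "hom_dim 0 (?X i) A = tri.rank_post (?X (i + 1)) D (PTob C A) w + tri.rank_post (?X i) A B u"
      using tri.exact_hdim_covariant(1)[OF ex', of "?X i"] by (simp add: hom_dim_def T_pow_Suc)
    show "hom_dim 0 (?X i) B = tri.rank_post (?X i) A B u + tri.rank_post (?X i) B D v"
      using tri.exact_hdim_covariant(2)[OF ex', of "?X i"] by (simp add: hom_dim_def)
    show "hom_dim 0 (?X i) D = tri.rank_post (?X i) B D v + tri.rank_post (?X i) D (PTob C A) w"
      using tri.exact_hdim_covariant(3)[OF ex', of "?X i"] by (simp add: hom_dim_def)
  qed
qed

lemma shift_triangle:
  assumes "(A, B, D, u, v, w) \<in> PExact C"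
  shows "\<exists>u v w. (Sob C r A, Sob C r B, Sob C r D, u, v, w) \<in> PExact C"
  using shift_exact[of r] assms by blast

lemma chi_add_left:
  assumes ex: "(A, B, D, u, v, w) \<in> PExact C"
  shows "chi s B Y = chi s A Y + chi s D Y"
proof -
  let ?Y = "\<lambda>i. Tp i Y"
  obtain u' v' w' where ex': "(Sob C s A, Sob C s B, Sob C s D, u', v', w') \<in> Exact C0"
    using shift_triangle[OF ex, of s] by auto
  have e: "hom_dim s Z W = hom_dim 0 (Sob C s Z) W" for Z W using hom_dim_shift_left[of 0 s Z W] by simp
  show ?thesis unfolding chi_def
  proof (rule euler_additive[OF _ _ _ finite_hom_dim finite_hom_dim finite_hom_dim])
    fix i
    show "hom_dim s A (?Y i) = tri.rank_pre (Sob C s D) (PTob C (Sob C s A)) (?Y (i + 1)) w' + tri.rank_pre (Sob C s A) (Sob C s B) (?Y i) u'"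
      using tri.exact_hdim_contravariant(1)[OF ex', of "?Y i"] e[of A] by (simp add: hom_dim_def T_pow_Suc)
    show "hom_dim s B (?Y i) = tri.rank_pre (Sob C s A) (Sob C s B) (?Y i) u' + tri.rank_pre (Sob C s B) (Sob C s D) (?Y i) v'"
      using tri.exact_hdim_contravariant(2)[OF ex', of "?Y i"] e[of B] by (simp add: hom_dim_def)
    show "hom_dim s D (?Y i) = tri.rank_pre (Sob C s B) (Sob C s D) (?Y i) v' + tri.rank_pre (Sob C s D) (PTob C (Sob C s A)) (?Y i) w'"
      using tri.exact_hdim_contravariant(3)[OF ex', of "?Y i"] e[of D] by (simp add: hom_dim_def)
  qed
qed

lemma chi_shift_left: "chi s (Sob C q X) Y = chi (q + s) X Y"
  unfolding chi_def by (simp add: hom_dim_shift_left)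

lemma chi_shift_right: "chi s X (Sob C q Y) = chi (s - q) X Y"
proof -
  have "hom_dim s X (Tp i (Sob C q Y)) = hom_dim (s - q) X (Tp i Y)" for i
    using hom_dim_iso_ob[OF shift_T_pow_iso[of q i Y], of s X] hom_dim_shift_right[of s X q "Tp i Y"] by simp
  then show ?thesis unfolding chi_def by simp
qed

text \<open>
  The value \<open>\<kappa>(X, Y) = \<lambda>\<close> of \<open>hom(X, T\<^sup>\<bullet> Y)\<close> on a pair of objects.
\<close>

definition "lam X Y = lambda_graded (\<lambda>i. hom_pmod C X (Tp i Y))"

lemma hom_jump:
  "\<forall>\<^sub>F t in at_left x. lambda_pmod (hom_pmod C X Y) x = int (hom_dim x X Y) - int (hom_dim t X Y)"
  using locally_finite_pmod.lambda_pmod_jump[OF locally_finite_hom, of X Y x] by (simp add: hom_dim_def)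

text \<open>
  An equality that holds for all \<open>t < x\<close> near \<open>x\<close> and does not involve \<open>t\<close> holds outright. This is how identities
  between Euler characteristics become identities between values of \<open>\<lambda>\<close>.
\<close>

lemma at_left_const:
  fixes a b :: int and x :: real
  assumes "\<forall>\<^sub>F t in at_left x. a = f t" "\<forall>\<^sub>F t in at_left x. b = f t"
  shows "a = b"
proof -
  have "\<forall>\<^sub>F t in at_left x. a = b" using assms by eventually_elim simp
  then show ?thesis by simp
qed

text \<open>
  One finite set of degrees serves all parameters, since boundedness is uniform in \<open>s\<close>. Thus the jump
  formula can be summed over the degrees.
\<close>

lemma lam_sum:
  "\<exists>F. finite F \<and> (\<forall>x. lam X Y x = (\<Sum>i\<in>F. sign i * lambda_pmod (hom_pmod C X (Tp i Y)) x)) \<and>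
    (\<forall>s. chi s X Y = (\<Sum>i\<in>F. sign i * int (hom_dim s X (Tp i Y))))"
proof -
  obtain F where F: "finite F" "\<And>i s. i \<notin> F \<Longrightarrow> hom_dim s X (Tp i Y) = 0" using bounded_hom by blast
  have z: "lambda_pmod (hom_pmod C X (Tp i Y)) x = 0" if "i \<notin> F" for i x
    using hom_jump[of X "Tp i Y" x] F(2)[OF that] by simp
  have "lam X Y x = (\<Sum>i\<in>F. sign i * lambda_pmod (hom_pmod C X (Tp i Y)) x)" for x
    unfolding lam_def lambda_graded_def sign_def[symmetric]
  proof (rule Sum_any.expand_superset[OF F(1)], rule subsetI, rule ccontr)
    fix i assume "i \<in> {i. sign i * lambda_pmod (hom_pmod C X (Tp i Y)) x \<noteq> 0}" "i \<notin> F"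
    then show False using z[of i x] by simp
  qed
  moreover have "chi s X Y = (\<Sum>i\<in>F. sign i * int (hom_dim s X (Tp i Y)))" for s
    unfolding chi_def
  proof (rule Sum_any.expand_superset[OF F(1)], rule subsetI, rule ccontr)
    fix i assume "i \<in> {i. sign i * int (hom_dim s X (Tp i Y)) \<noteq> 0}" "i \<notin> F"
    then show False using F(2)[of i s] by simp
  qed
  ultimately show ?thesis using F(1) by (intro exI[of _ F]) simp
qed

lemma lam_jump: "\<forall>\<^sub>F t in at_left x. lam X Y x = chi x X Y - chi t X Y"
proof -
  obtain F where F: "finite F" "\<And>x. lam X Y x = (\<Sum>i\<in>F. sign i * lambda_pmod (hom_pmod C X (Tp i Y)) x)"
    "\<And>s. chi s X Y = (\<Sum>i\<in>F. sign i * int (hom_dim s X (Tp i Y)))"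
    using lam_sum[of X Y] by (elim exE conjE) simp
  have "\<forall>\<^sub>F t in at_left x. \<forall>i\<in>F. lambda_pmod (hom_pmod C X (Tp i Y)) x = int (hom_dim x X (Tp i Y)) - int (hom_dim t X (Tp i Y))"
    using F(1) hom_jump by (simp add: eventually_ball_finite_distrib)
  then show ?thesis
  proof eventually_elim
    case (elim t)
    then show ?case unfolding F(2,3) sum_subtractf[symmetric] right_diff_distrib[symmetric]
      by (intro sum.cong) simp_all
  qed
qed

lemma lam_novikov: "lam X Y \<in> carrier novikov"
proof -
  obtain F where F: "finite F" "\<And>x. lam X Y x = (\<Sum>i\<in>F. sign i * lambda_pmod (hom_pmod C X (Tp i Y)) x)"
    using lam_sum[of X Y] by (elim exE conjE) simp
  have "finite {x. x \<le> c \<and> lam X Y x \<noteq> 0}" for c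
  proof (rule finite_subset)
    show "{x. x \<le> c \<and> lam X Y x \<noteq> 0} \<subseteq> (\<Union>i\<in>F. {x. x \<le> c \<and> lambda_pmod (hom_pmod C X (Tp i Y)) x \<noteq> 0})"
    proof
      fix x assume "x \<in> {x. x \<le> c \<and> lam X Y x \<noteq> 0}"
      then have x: "x \<le> c" "(\<Sum>i\<in>F. sign i * lambda_pmod (hom_pmod C X (Tp i Y)) x) \<noteq> 0"
        unfolding F(2) by simp_all
      from x(2) obtain i where i: "i \<in> F" "sign i * lambda_pmod (hom_pmod C X (Tp i Y)) x \<noteq> 0"
        by (rule sum.not_neutral_contains_not_neutral)
      then have "x \<in> {x. x \<le> c \<and> lambda_pmod (hom_pmod C X (Tp i Y)) x \<noteq> 0}" using x(1) by simp
      then show "x \<in> (\<Union>i\<in>F. {x. x \<le> c \<and> lambda_pmod (hom_pmod C X (Tp i Y)) x \<noteq> 0})"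
        using i(1) by (rule UN_I[rotated])
    qed
    show "finite (\<Union>i\<in>F. {x. x \<le> c \<and> lambda_pmod (hom_pmod C X (Tp i Y)) x \<noteq> 0})"
      using F(1) locally_finite_pmod.lambda_pmod_support[OF locally_finite_hom] by (rule finite_UN_I)
  qed
  then show ?thesis unfolding novikov_def by simp
qed

lemma lam_add_right:
  assumes ex: "(A, B, D, u, v, w) \<in> PExact C"
  shows "lam X B x = lam X A x + lam X D x"
proof (rule at_left_const[OF lam_jump])
  show "\<forall>\<^sub>F t in at_left x. lam X A x + lam X D x = chi x X B - chi t X B"
    using lam_jump[of X A x] lam_jump[of X D x] unfolding chi_add_right[OF ex] by eventually_elim simp
qed

lemma lam_add_left:
  assumes ex: "(A, B, D, u, v, w) \<in> PExact C"
  shows "lam B Y x = lam A Y x + lam D Y x"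
proof (rule at_left_const[OF lam_jump])
  show "\<forall>\<^sub>F t in at_left x. lam A Y x + lam D Y x = chi x B Y - chi t B Y"
    using lam_jump[of A Y x] lam_jump[of D Y x] unfolding chi_add_left[OF ex] by eventually_elim simp
qed

lemma eventually_at_left_translate:
  fixes x r :: real
  assumes "eventually P (at_left (x - r))"
  shows "\<forall>\<^sub>F t in at_left x. P (t - r)"
proof -
  obtain b where b: "b < x - r" "\<And>y. b < y \<Longrightarrow> y < x - r \<Longrightarrow> P y"
    using assms unfolding eventually_at_left_field by blast
  have "b + r < x" "\<And>t. b + r < t \<Longrightarrow> t < x \<Longrightarrow> P (t - r)" using b by auto
  then show ?thesis unfolding eventually_at_left_field by blast
qed

lemma lam_shift_left: "lam (Sob C (- r) X) Y x = lam X Y (x - r)"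
proof (rule at_left_const[OF lam_jump])
  show "\<forall>\<^sub>F t in at_left x. lam X Y (x - r) = chi x (Sob C (- r) X) Y - chi t (Sob C (- r) X) Y"
    using eventually_at_left_translate[OF lam_jump[of X Y "x - r"]] unfolding chi_shift_left by (simp add: algebra_simps)
qed

lemma lam_shift_right: "lam X (Sob C r Y) x = lam X Y (x - r)"
proof (rule at_left_const[OF lam_jump])
  show "\<forall>\<^sub>F t in at_left x. lam X Y (x - r) = chi x X (Sob C r Y) - chi t X (Sob C r Y)"
    using eventually_at_left_translate[OF lam_jump[of X Y "x - r"]] unfolding chi_shift_right .
qed

end

section \<open>Quotients of free abelian groups\<close>

lemma subgroup_generate_frag:
  assumes "H \<subseteq> carrier (free_Abelian_group S)"
  shows "subgroup (generate (free_Abelian_group S) H) (free_Abelian_group S)"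
  using group.generate_is_subgroup[OF group_free_Abelian_group assms] .

text \<open>
  Additive maps are controlled on a generated subgroup by its generators. The target is any subset closed under
  differences, so that both inclusions of subgroups and vanishing (target \<open>{0}\<close>) are instances.
\<close>

lemma generate_frag_mapsto:
  fixes h :: "('a \<Rightarrow>\<^sub>0 int) \<Rightarrow> 'b::ab_group_add"
  assumes H: "H \<subseteq> carrier (free_Abelian_group S)"
    and h: "\<And>x y. h (x - y) = h x - h y"
    and N0: "0 \<in> N" and N: "\<And>x y. x \<in> N \<Longrightarrow> y \<in> N \<Longrightarrow> x - y \<in> N"
    and gen: "\<And>x. x \<in> H \<Longrightarrow> h x \<in> N"
    and z: "z \<in> generate (free_Abelian_group S) H"
  shows "h z \<in> N"
proof -
  have h0: "h 0 = 0" using h[of 0 0] by simp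
  have hadd: "h (x + y) = h x - (0 - h y)" for x y using h[of x "- y"] h[of 0 y] h0 by simp
  show ?thesis using z
  proof (induction rule: generate.induct)
    case one
    then show ?case using h0 N0 by simp
  next
    case (incl x)
    then show ?case by (rule gen)
  next
    case (inv x)
    then have "h (- x) = 0 - h x" using h[of 0 x] h0 by simp
    moreover have "x \<in> carrier (free_Abelian_group S)" using H inv by blast
    ultimately show ?case using N[OF N0 gen[OF inv]] by simp
  next
    case (eng x y)
    then show ?case using N[OF eng.IH(1) N[OF N0 eng.IH(2)]] hadd by simp
  qed
qed

locale frag_subgroup =
  fixes S :: "'a set" and N :: "('a \<Rightarrow>\<^sub>0 int) set"
  assumes sub: "subgroup N (free_Abelian_group S)"
begin

abbreviation "G \<equiv> free_Abelian_group S"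
abbreviation "coset z \<equiv> N #>\<^bsub>G\<^esub> z"

lemma N_zero: "0 \<in> N" using subgroup.one_closed[OF sub] by simp
lemma N_add: "x \<in> N \<Longrightarrow> y \<in> N \<Longrightarrow> x + y \<in> N" using subgroup.m_closed[OF sub] by simp
lemma N_neg: "x \<in> N \<Longrightarrow> - x \<in> N"
  using subgroup.m_inv_closed[OF sub, of x] subgroup.mem_carrier[OF sub, of x] by simp
lemma N_diff: "x \<in> N \<Longrightarrow> y \<in> N \<Longrightarrow> x - y \<in> N"
  using N_add[of x "- y"] N_neg by simp

lemma coset_iff: "z' \<in> coset z \<longleftrightarrow> z' - z \<in> N"
proof
  assume "z' \<in> coset z"
  then obtain h where "h \<in> N" "z' = h + z" unfolding r_coset_def by auto
  then show "z' - z \<in> N" by simp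
next
  assume "z' - z \<in> N"
  moreover have "z' = (z' - z) + z" by simp
  ultimately show "z' \<in> coset z" unfolding r_coset_def mult_free_Abelian_group by blast
qed

lemma coset_self: "z \<in> coset z" by (simp add: coset_iff N_zero)

lemma coset_eqI:
  assumes "x - y \<in> N"
  shows "coset x = coset y"
proof (rule Set.set_eqI)
  fix z
  have "z - x = (z - y) - (x - y)" "z - y = (z - x) + (x - y)" by simp_all
  then show "z \<in> coset x \<longleftrightarrow> z \<in> coset y"
    unfolding coset_iff using N_add[OF _ assms] N_diff[OF _ assms] by metis
qed

lemma coset_eq_iff: "coset x = coset y \<longleftrightarrow> x - y \<in> N"
proof
  assume "coset x = coset y"
  then have "x \<in> coset y" using coset_self[of x] by simp
  then show "x - y \<in> N" by (simp only: coset_iff)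
qed (rule coset_eqI)

lemma coset_someI: "(SOME z'. z' \<in> coset z) - z \<in> N"
  using someI[of "\<lambda>z'. z' \<in> coset z", OF coset_self] by (simp only: coset_iff)

lemma normal: "N \<lhd> G"
  using comm_group.normal_iff_subgroup[OF abelian_free_Abelian_group] sub by blast

lemma carrier_quotient: "carrier (G Mod N) = {coset z |z. Poly_Mapping.keys z \<subseteq> S}"
  unfolding FactGroup_def RCOSETS_def by force

lemma coset_in_carrier: "Poly_Mapping.keys z \<subseteq> S \<Longrightarrow> coset z \<in> carrier (G Mod N)"
  unfolding carrier_quotient by blast

lemma carrier_quotientE:
  assumes "c \<in> carrier (G Mod N)"
  obtains z where "Poly_Mapping.keys z \<subseteq> S" "c = coset z"
  using assms unfolding carrier_quotient by blast

lemma coset_mult: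
  assumes "Poly_Mapping.keys x \<subseteq> S" "Poly_Mapping.keys y \<subseteq> S"
  shows "coset x \<otimes>\<^bsub>G Mod N\<^esub> coset y = coset (x + y)"
  using normal.rcos_sum[OF normal, of x y] assms by (simp add: FactGroup_def)

end

text \<open>
  A ring acting on a free abelian group by additive maps, where the module laws hold only modulo a
  subgroup. For tensor products, for instance, additivity in the scalar holds only up to the relations.
\<close>

locale frag_quotient_action = frag_subgroup S N
  for S :: "'a set" and N :: "('a \<Rightarrow>\<^sub>0 int) set" +
  fixes R :: "('r, 'm) ring_scheme" and act :: "'r \<Rightarrow> ('a \<Rightarrow>\<^sub>0 int) \<Rightarrow> ('a \<Rightarrow>\<^sub>0 int)"
  assumes R: "cring R"
    and act_closed: "p \<in> carrier R \<Longrightarrow> Poly_Mapping.keys z \<subseteq> S \<Longrightarrow> Poly_Mapping.keys (act p z) \<subseteq> S"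
    and act_diff: "act p (x - y) = act p x - act p y"
    and act_N: "p \<in> carrier R \<Longrightarrow> z \<in> N \<Longrightarrow> act p z \<in> N"
    and act_add_ring: "p \<in> carrier R \<Longrightarrow> q \<in> carrier R \<Longrightarrow> Poly_Mapping.keys z \<subseteq> S \<Longrightarrow>
      act (p \<oplus>\<^bsub>R\<^esub> q) z - (act p z + act q z) \<in> N"
    and act_mult_ring: "p \<in> carrier R \<Longrightarrow> q \<in> carrier R \<Longrightarrow> Poly_Mapping.keys z \<subseteq> S \<Longrightarrow>
      act (p \<otimes>\<^bsub>R\<^esub> q) z - act p (act q z) \<in> N"
    and act_one: "Poly_Mapping.keys z \<subseteq> S \<Longrightarrow> act \<one>\<^bsub>R\<^esub> z - z \<in> N"
begin

abbreviation "Q \<equiv> quotient_module G N act"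

lemma act_add: "act p (x + y) = act p x + act p y"
  using act_diff[of p x "- y"] act_diff[of p 0 y] act_diff[of p 0 0] by simp

lemma smult_coset:
  assumes "p \<in> carrier R"
  shows "p \<odot>\<^bsub>Q\<^esub> coset z = coset (act p z)"
proof -
  have "coset (act p z') = coset (act p z)" if "z' \<in> coset z" for z'
    using that act_N[OF assms, of "z' - z"] by (intro coset_eqI) (simp add: coset_iff act_diff)
  then have "(\<Union>z'\<in>coset z. coset (act p z')) = (\<Union>z'\<in>coset z. coset (act p z))"
    by (rule SUP_cong[OF refl])
  also have "\<dots> = coset (act p z)" using coset_self[of z] by (metis UN_constant empty_iff)
  finally show ?thesis by (simp add: quotient_module_def)
qed

lemma Q_carrier: "carrier Q = carrier (G Mod N)" by (simp add: quotient_module_def)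

lemma add_coset:
  "Poly_Mapping.keys x \<subseteq> S \<Longrightarrow> Poly_Mapping.keys y \<subseteq> S \<Longrightarrow> coset x \<oplus>\<^bsub>Q\<^esub> coset y = coset (x + y)"
  using coset_mult by (simp add: quotient_module_def)

lemma abelian_Q: "abelian_group Q"
proof -
  interpret cg: comm_group "G Mod N"
    using comm_group.abelian_FactGroup[OF abelian_free_Abelian_group sub] .
  have add: "x \<oplus>\<^bsub>Q\<^esub> y = x \<otimes>\<^bsub>G Mod N\<^esub> y" for x y by (simp add: quotient_module_def)
  have zero: "\<zero>\<^bsub>Q\<^esub> = \<one>\<^bsub>G Mod N\<^esub>" by (simp add: quotient_module_def)
  show ?thesis
  proof (rule abelian_groupI, unfold Q_carrier add zero)
    fix x y z assume xyz: "x \<in> carrier (G Mod N)" "y \<in> carrier (G Mod N)" "z \<in> carrier (G Mod N)"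
    show "(x \<otimes>\<^bsub>G Mod N\<^esub> y) \<otimes>\<^bsub>G Mod N\<^esub> z = x \<otimes>\<^bsub>G Mod N\<^esub> (y \<otimes>\<^bsub>G Mod N\<^esub> z)"
      using xyz by (rule cg.m_assoc)
  next
    fix x y assume xy: "x \<in> carrier (G Mod N)" "y \<in> carrier (G Mod N)"
    show "x \<otimes>\<^bsub>G Mod N\<^esub> y \<in> carrier (G Mod N)" using xy by (rule cg.m_closed)
    show "x \<otimes>\<^bsub>G Mod N\<^esub> y = y \<otimes>\<^bsub>G Mod N\<^esub> x" using xy by (rule cg.m_comm)
  next
    fix x assume x: "x \<in> carrier (G Mod N)"
    show "\<one>\<^bsub>G Mod N\<^esub> \<otimes>\<^bsub>G Mod N\<^esub> x = x" using x by (rule cg.l_one)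
    show "\<exists>y\<in>carrier (G Mod N). y \<otimes>\<^bsub>G Mod N\<^esub> x = \<one>\<^bsub>G Mod N\<^esub>"
      using cg.l_inv[OF x] cg.inv_closed[OF x] by (rule bexI)
  qed (rule cg.one_closed)
qed

lemma module_Q: "Module.module R Q"
proof (rule moduleI[OF R abelian_Q])
  fix p x assume px: "p \<in> carrier R" "x \<in> carrier Q"
  then obtain z where z: "Poly_Mapping.keys z \<subseteq> S" "x = coset z" unfolding Q_carrier by (auto elim: carrier_quotientE)
  show "p \<odot>\<^bsub>Q\<^esub> x \<in> carrier Q"
    unfolding z(2) smult_coset[OF px(1)] Q_carrier using coset_in_carrier act_closed px(1) z(1) by blast
next
  fix p q x assume pq: "p \<in> carrier R" "q \<in> carrier R" and x: "x \<in> carrier Q"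
  obtain z where z: "Poly_Mapping.keys z \<subseteq> S" "x = coset z" using x unfolding Q_carrier by (auto elim: carrier_quotientE)
  show "(p \<oplus>\<^bsub>R\<^esub> q) \<odot>\<^bsub>Q\<^esub> x = p \<odot>\<^bsub>Q\<^esub> x \<oplus>\<^bsub>Q\<^esub> q \<odot>\<^bsub>Q\<^esub> x"
    unfolding z(2) using pq z(1) cring.cring_simprules(1)[OF R pq]
    by (simp add: smult_coset add_coset act_closed coset_eq_iff act_add_ring)
  show "(p \<otimes>\<^bsub>R\<^esub> q) \<odot>\<^bsub>Q\<^esub> x = p \<odot>\<^bsub>Q\<^esub> (q \<odot>\<^bsub>Q\<^esub> x)"
    unfolding z(2) using pq z(1) cring.cring_simprules(5)[OF R pq]
    by (simp add: smult_coset coset_eq_iff act_mult_ring)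
next
  fix p x y assume p: "p \<in> carrier R" and x: "x \<in> carrier Q" and y: "y \<in> carrier Q"
  obtain z where z: "Poly_Mapping.keys z \<subseteq> S" "x = coset z" using x unfolding Q_carrier by (auto elim: carrier_quotientE)
  obtain w where w: "Poly_Mapping.keys w \<subseteq> S" "y = coset w" using y unfolding Q_carrier by (auto elim: carrier_quotientE)
  show "p \<odot>\<^bsub>Q\<^esub> (x \<oplus>\<^bsub>Q\<^esub> y) = p \<odot>\<^bsub>Q\<^esub> x \<oplus>\<^bsub>Q\<^esub> p \<odot>\<^bsub>Q\<^esub> y"
    unfolding z(2) w(2) using z(1) w(1) p by (simp add: smult_coset add_coset act_closed act_add)
next
  fix x assume x: "x \<in> carrier Q"
  obtain z where z: "Poly_Mapping.keys z \<subseteq> S" "x = coset z" using x unfolding Q_carrier by (auto elim: carrier_quotientE)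
  show "\<one>\<^bsub>R\<^esub> \<odot>\<^bsub>Q\<^esub> x = x"
    unfolding z(2) using z(1) cring.cring_simprules(6)[OF R] by (simp add: smult_coset coset_eq_iff act_one)
qed

end

text \<open>
  The \<open>\<int>\<close>-linear extension of an integer-valued function on a basis. Maps into the Novikov ring are handled
  one coefficient at a time in this way.
\<close>

section \<open>Novikov rings\<close>

definition zsum :: "('a \<Rightarrow> int) \<Rightarrow> ('a \<Rightarrow>\<^sub>0 int) \<Rightarrow> int" where
  "zsum g z = (\<Sum>k\<in>Poly_Mapping.keys z. Poly_Mapping.lookup z k * g k)"

lemma zsum_superset:
  assumes "finite A" "Poly_Mapping.keys z \<subseteq> A"
  shows "zsum g z = (\<Sum>k\<in>A. Poly_Mapping.lookup z k * g k)"
  unfolding zsum_def using assms by (intro sum.mono_neutral_left) (auto simp: in_keys_iff)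

lemma zsum_add: "zsum g (x + y) = zsum g x + zsum g y"
proof -
  let ?A = "Poly_Mapping.keys x \<union> Poly_Mapping.keys y"
  have "Poly_Mapping.keys (x + y) \<subseteq> ?A" by (rule keys_add)
  then show ?thesis
    using zsum_superset[of ?A "x + y" g] zsum_superset[of ?A x g] zsum_superset[of ?A y g]
    by (simp add: lookup_add distrib_right sum.distrib)
qed

lemma zsum_minus: "zsum g (- x) = - zsum g x"
  by (simp add: zsum_def sum_negf)

lemma zsum_0 [simp]: "zsum g 0 = 0" by (simp add: zsum_def)

lemma zsum_diff: "zsum g (x - y) = zsum g x - zsum g y"
  using zsum_add[of g x "- y"] by (simp add: zsum_minus)

lemma zsum_of [simp]: "zsum g (frag_of a) = g a" by (simp add: zsum_def)

lemma zsum_one [simp]: "zsum g 1 = g (0::real)"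
  using zsum_of[of g 0] by (simp add: single_one)

lemma zsum_cong: "(\<And>k. k \<in> Poly_Mapping.keys z \<Longrightarrow> g k = h k) \<Longrightarrow> zsum g z = zsum h z"
  by (simp add: zsum_def)

lemma zsum_fun_add: "zsum (\<lambda>k. g k + h k) z = zsum g z + zsum h z"
  by (simp add: zsum_def distrib_left sum.distrib)

lemma zsum_fun_diff: "zsum (\<lambda>k. g k - h k) z = zsum g z - zsum h z"
  by (simp add: zsum_def right_diff_distrib sum_subtractf)

lemma zsum_swap: "zsum (\<lambda>x. zsum (g x) w) z = zsum (\<lambda>y. zsum (\<lambda>x. g x y) z) w"
  unfolding zsum_def sum_distrib_left by (subst sum.swap) (simp add: mult.left_commute)

lemma zsum_frag_extend: "zsum g (frag_extend b z) = zsum (\<lambda>k. zsum g (b k)) z"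
proof -
  have "Poly_Mapping.keys z \<subseteq> UNIV" by simp
  then show ?thesis
    by (induction z rule: frag_induction) (simp_all add: frag_extend_diff zsum_diff)
qed

text \<open>
  With finite sums of powers of \<open>t\<close> viewed as the group ring of \<open>\<real>\<close>, linear extension turns multiplication into addition of
  exponents. This is the associativity law of all the actions below.
\<close>

lemma zsum_times: "zsum g (p * q) = zsum (\<lambda>a. zsum (\<lambda>b. g (a + b)) q) p"
  for p q :: "real \<Rightarrow>\<^sub>0 int"
proof -
  have "Poly_Mapping.keys p \<subseteq> UNIV" by simp
  then show ?thesis
  proof (induction p rule: frag_induction)
    case (one r)
    have "Poly_Mapping.keys q \<subseteq> UNIV" by simp
    then show ?case
    proof (induction q rule: frag_induction)
      case (one s)
      have "frag_of r * frag_of s = frag_of (r + s)" by (simp add: mult_single)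
      then show ?case by simp
    qed (simp_all add: right_diff_distrib zsum_diff)
  qed (simp_all add: left_diff_distrib zsum_diff)
qed

text \<open>
  The ring \<open>\<Lambda>\<^sub>P\<close> is the group ring of the reals, that is, the finitely supported functions with convolution
  product. Its laws are transported from there.
\<close>

lemma novikov_P_carrier: "f \<in> carrier novikov_P \<longleftrightarrow> (\<exists>p. f = Poly_Mapping.lookup p)"
proof
  assume "f \<in> carrier novikov_P"
  then have "finite {a. f a \<noteq> 0}" by (simp add: novikov_P_def)
  then show "\<exists>p. f = Poly_Mapping.lookup p" by (metis Abs_poly_mapping_inverse mem_Collect_eq)
qed (auto simp: novikov_P_def)

lemma novikov_P_carrierE:
  assumes "f \<in> carrier novikov_P"
  obtains p where "f = Poly_Mapping.lookup p"
  using assms novikov_P_carrier by blast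

lemma lookup_in_novikov_P: "Poly_Mapping.lookup p \<in> carrier novikov_P"
  using novikov_P_carrier by blast

text \<open>
  A finite sum of powers of \<open>t\<close> acts on a Novikov series by translating it.
\<close>

lemma novikov_mult_lookup:
  "Poly_Mapping.lookup p \<otimes>\<^bsub>novikov\<^esub> f = (\<lambda>c. zsum (\<lambda>r. f (c - r)) p)"
proof
  fix c
  have "(Poly_Mapping.lookup p \<otimes>\<^bsub>novikov\<^esub> f) c = Sum_any (\<lambda>r. Poly_Mapping.lookup p r * f (c - r))"
    by (simp add: novikov_def)
  also have "\<dots> = zsum (\<lambda>r. f (c - r)) p"
    unfolding zsum_def by (rule Sum_any.expand_superset) (auto simp: in_keys_iff)
  finally show "(Poly_Mapping.lookup p \<otimes>\<^bsub>novikov\<^esub> f) c = zsum (\<lambda>r. f (c - r)) p" .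
qed

lemma novikov_P_mult: "Poly_Mapping.lookup p \<otimes>\<^bsub>novikov_P\<^esub> Poly_Mapping.lookup q = Poly_Mapping.lookup (p * q)"
proof
  fix c
  have l: "Poly_Mapping.lookup z c = zsum (\<lambda>x. if x = c then 1 else 0) z" for z :: "real \<Rightarrow>\<^sub>0 int"
    unfolding zsum_def by (simp add: in_keys_iff if_distrib cong: if_cong)
  have l': "Poly_Mapping.lookup q (c - a) = zsum (\<lambda>b. if a + b = c then 1 else 0) q" for a
  proof -
    have "a + b = c \<longleftrightarrow> b = c - a" for b by auto
    then show ?thesis unfolding zsum_def by (simp add: in_keys_iff if_distrib cong: if_cong)
  qed
  have "Poly_Mapping.lookup p \<otimes>\<^bsub>novikov_P\<^esub> Poly_Mapping.lookup q = Poly_Mapping.lookup p \<otimes>\<^bsub>novikov\<^esub> Poly_Mapping.lookup q"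
    by (simp add: novikov_P_def)
  then show "(Poly_Mapping.lookup p \<otimes>\<^bsub>novikov_P\<^esub> Poly_Mapping.lookup q) c = Poly_Mapping.lookup (p * q) c"
    unfolding l[of "p * q"] zsum_times by (simp add: novikov_mult_lookup l')
qed

lemma novikov_P_add: "Poly_Mapping.lookup p \<oplus>\<^bsub>novikov_P\<^esub> Poly_Mapping.lookup q = Poly_Mapping.lookup (p + q)"
  by (simp add: novikov_P_def novikov_def lookup_add fun_eq_iff)

lemma novikov_P_zero: "\<zero>\<^bsub>novikov_P\<^esub> = Poly_Mapping.lookup 0"
  by (simp add: novikov_P_def novikov_def fun_eq_iff)

lemma novikov_P_one: "\<one>\<^bsub>novikov_P\<^esub> = Poly_Mapping.lookup (frag_of 0)"
  by (simp add: novikov_P_def novikov_def fun_eq_iff lookup_one when_def)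

lemma frag_of_0_times: "frag_of (0::real) * p = p"
  by (simp add: single_one)

lemma cring_novikov_P: "cring novikov_P"
proof (rule cringI)
  show "abelian_group novikov_P"
  proof (rule abelian_groupI)
    fix x assume "x \<in> carrier novikov_P"
    then obtain p where p: "x = Poly_Mapping.lookup p" by (rule novikov_P_carrierE)
    have "Poly_Mapping.lookup (- p) \<oplus>\<^bsub>novikov_P\<^esub> x = \<zero>\<^bsub>novikov_P\<^esub>"
      unfolding p novikov_P_add novikov_P_zero by simp
    then show "\<exists>y\<in>carrier novikov_P. y \<oplus>\<^bsub>novikov_P\<^esub> x = \<zero>\<^bsub>novikov_P\<^esub>"
      using lookup_in_novikov_P by blast
  qed (auto elim!: novikov_P_carrierE simp: novikov_P_add novikov_P_zero lookup_in_novikov_P ac_simps)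
  show "comm_monoid novikov_P"
    by (rule comm_monoidI)
      (auto elim!: novikov_P_carrierE simp: novikov_P_mult novikov_P_one lookup_in_novikov_P frag_of_0_times ac_simps)
qed (auto elim!: novikov_P_carrierE simp: novikov_P_mult novikov_P_add algebra_simps)

lemma novikov_zsum:
  assumes "\<And>k. k \<in> Poly_Mapping.keys z \<Longrightarrow> f k \<in> carrier novikov"
  shows "(\<lambda>x. zsum (\<lambda>k. f k x) z) \<in> carrier novikov"
proof -
  have "finite {x. x \<le> c \<and> zsum (\<lambda>k. f k x) z \<noteq> 0}" for c
  proof (rule finite_subset)
    show "{x. x \<le> c \<and> zsum (\<lambda>k. f k x) z \<noteq> 0} \<subseteq> (\<Union>k\<in>Poly_Mapping.keys z. {x. x \<le> c \<and> f k x \<noteq> 0})"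
    proof
      fix x assume "x \<in> {x. x \<le> c \<and> zsum (\<lambda>k. f k x) z \<noteq> 0}"
      then have x: "x \<le> c" "(\<Sum>k\<in>Poly_Mapping.keys z. Poly_Mapping.lookup z k * f k x) \<noteq> 0"
        by (simp_all add: zsum_def)
      from x(2) obtain k where "k \<in> Poly_Mapping.keys z" "Poly_Mapping.lookup z k * f k x \<noteq> 0"
        by (rule sum.not_neutral_contains_not_neutral)
      then show "x \<in> (\<Union>k\<in>Poly_Mapping.keys z. {x. x \<le> c \<and> f k x \<noteq> 0})" using x(1) by auto
    qed
    have "finite {x. x \<le> c \<and> f k x \<noteq> 0}" if "k \<in> Poly_Mapping.keys z" for k
      using assms[OF that] by (simp add: novikov_def)
    then show "finite (\<Union>k\<in>Poly_Mapping.keys z. {x. x \<le> c \<and> f k x \<noteq> 0})" by simp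
  qed
  then show ?thesis by (simp add: novikov_def)
qed

lemma novikov_translate:
  assumes "f \<in> carrier novikov"
  shows "(\<lambda>x. f (x - r)) \<in> carrier novikov"
proof -
  have "finite {x. x \<le> c \<and> f (x - r) \<noteq> 0}" for c
  proof (rule finite_subset)
    show "{x. x \<le> c \<and> f (x - r) \<noteq> 0} \<subseteq> (\<lambda>y. y + r) ` {y. y \<le> c - r \<and> f y \<noteq> 0}"
    proof
      fix x assume "x \<in> {x. x \<le> c \<and> f (x - r) \<noteq> 0}"
      then show "x \<in> (\<lambda>y. y + r) ` {y. y \<le> c - r \<and> f y \<noteq> 0}"
        by (intro image_eqI[of _ _ "x - r"]) auto
    qed
    show "finite ((\<lambda>y. y + r) ` {y. y \<le> c - r \<and> f y \<noteq> 0})" using assms by (simp add: novikov_def)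
  qed
  then show ?thesis by (simp add: novikov_def)
qed

lemma novikov_module_smult:
  "Poly_Mapping.lookup p \<odot>\<^bsub>novikov_module\<^esub> f = (\<lambda>c. zsum (\<lambda>r. f (c - r)) p)"
  using novikov_mult_lookup by (simp add: novikov_module_def)

lemma novikov_module_add: "f \<oplus>\<^bsub>novikov_module\<^esub> g = (\<lambda>c. f c + g c)"
  by (simp add: novikov_module_def novikov_def)

lemma novikov_module_carrier: "carrier novikov_module = carrier novikov"
  by (simp add: novikov_module_def)

lemma novikov_add_closed:
  assumes "f \<in> carrier novikov" "g \<in> carrier novikov"
  shows "(\<lambda>c. f c + g c) \<in> carrier novikov"
proof -
  have "finite {x. x \<le> c \<and> f x + g x \<noteq> 0}" for c
  proof (rule finite_subset)
    show "{x. x \<le> c \<and> f x + g x \<noteq> 0} \<subseteq> {x. x \<le> c \<and> f x \<noteq> 0} \<union> {x. x \<le> c \<and> g x \<noteq> 0}" by auto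
    show "finite ({x. x \<le> c \<and> f x \<noteq> 0} \<union> {x. x \<le> c \<and> g x \<noteq> 0})" using assms by (simp add: novikov_def)
  qed
  then show ?thesis by (simp add: novikov_def)
qed

lemma novikov_neg_closed: "f \<in> carrier novikov \<Longrightarrow> (\<lambda>c. - f c) \<in> carrier novikov"
  by (simp add: novikov_def)

lemma module_novikov: "Module.module novikov_P novikov_module"
proof (rule moduleI[OF cring_novikov_P])
  show "abelian_group novikov_module"
  proof (rule abelian_groupI)
    fix x assume "x \<in> carrier novikov_module"
    then show "\<exists>y\<in>carrier novikov_module. y \<oplus>\<^bsub>novikov_module\<^esub> x = \<zero>\<^bsub>novikov_module\<^esub>"
      using novikov_neg_closed[of x]
      by (intro bexI[of _ "\<lambda>c. - x c"]) (simp_all add: novikov_module_def novikov_def fun_eq_iff)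
  next
    fix x y assume "x \<in> carrier novikov_module" "y \<in> carrier novikov_module"
    then show "x \<oplus>\<^bsub>novikov_module\<^esub> y \<in> carrier novikov_module"
      unfolding novikov_module_add novikov_module_carrier by (rule novikov_add_closed)
  qed (simp_all add: novikov_module_def novikov_def fun_eq_iff)
next
  fix p x assume "p \<in> carrier novikov_P" "x \<in> carrier novikov_module"
  then show "p \<odot>\<^bsub>novikov_module\<^esub> x \<in> carrier novikov_module"
    by (elim novikov_P_carrierE)
      (simp add: novikov_module_smult novikov_module_carrier novikov_zsum novikov_translate)
next
  fix p q x assume "p \<in> carrier novikov_P" "q \<in> carrier novikov_P" "x \<in> carrier novikov_module"
  then obtain P Q where pq: "p = Poly_Mapping.lookup P" "q = Poly_Mapping.lookup Q" by (meson novikov_P_carrierE)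
  show "(p \<oplus>\<^bsub>novikov_P\<^esub> q) \<odot>\<^bsub>novikov_module\<^esub> x
    = p \<odot>\<^bsub>novikov_module\<^esub> x \<oplus>\<^bsub>novikov_module\<^esub> q \<odot>\<^bsub>novikov_module\<^esub> x"
    unfolding pq novikov_P_add novikov_module_smult novikov_module_add zsum_add ..
  show "(p \<otimes>\<^bsub>novikov_P\<^esub> q) \<odot>\<^bsub>novikov_module\<^esub> x = p \<odot>\<^bsub>novikov_module\<^esub> (q \<odot>\<^bsub>novikov_module\<^esub> x)"
    unfolding pq novikov_P_mult novikov_module_smult zsum_times by (simp add: algebra_simps)
next
  fix p x y assume "p \<in> carrier novikov_P" "x \<in> carrier novikov_module" "y \<in> carrier novikov_module"
  then obtain P where p: "p = Poly_Mapping.lookup P" by (meson novikov_P_carrierE)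
  show "p \<odot>\<^bsub>novikov_module\<^esub> (x \<oplus>\<^bsub>novikov_module\<^esub> y)
    = p \<odot>\<^bsub>novikov_module\<^esub> x \<oplus>\<^bsub>novikov_module\<^esub> p \<odot>\<^bsub>novikov_module\<^esub> y"
    unfolding p novikov_module_smult novikov_module_add zsum_fun_add ..
next
  fix x assume "x \<in> carrier novikov_module"
  show "\<one>\<^bsub>novikov_P\<^esub> \<odot>\<^bsub>novikov_module\<^esub> x = x"
    unfolding novikov_P_one novikov_module_smult by simp
qed

section \<open>Shift actions\<close>

lemma shift_action_lookup:
  "shift_action \<sigma> (Poly_Mapping.lookup p) z = frag_extend (\<lambda>r. frag_extend (\<lambda>A. frag_of (\<sigma> r A)) z) p"
proof -
  have "{r. Poly_Mapping.lookup p r \<noteq> 0} = Poly_Mapping.keys p" by (auto simp: in_keys_iff)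
  then show ?thesis by (simp add: shift_action_def frag_extend_def)
qed

lemma frag_cmul_diff_right: "frag_cmul c (x - y) = frag_cmul c x - frag_cmul c y"
  by (rule poly_mapping_eqI) (simp add: lookup_minus right_diff_distrib)

lemma shift_action_diff: "shift_action \<sigma> p (x - y) = shift_action \<sigma> p x - shift_action \<sigma> p y"
  by (simp add: shift_action_def frag_extend_diff frag_cmul_diff_right sum_subtractf)

text \<open>
  An action of the additive group of reals on the objects extends to an action of its group ring. Both sides of each
  law are additive in the scalars, so that it suffices to compare powers of \<open>t\<close>.
\<close>

lemma frag_quotient_action_shift:
  fixes \<sigma> :: "real \<Rightarrow> 'o \<Rightarrow> 'o"
  assumes N: "subgroup N (free_Abelian_group UNIV)"
    and \<sigma>0: "\<And>A. \<sigma> 0 A = A" and \<sigma>add: "\<And>r s A. \<sigma> r (\<sigma> s A) = \<sigma> (r + s) A"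
    and pres: "\<And>r z. z \<in> N \<Longrightarrow> frag_extend (\<lambda>A. frag_of (\<sigma> r A)) z \<in> N"
  shows "frag_quotient_action UNIV N novikov_P (shift_action \<sigma>)"
proof -
  interpret frag_subgroup UNIV N by (rule frag_subgroup.intro[OF N])
  let ?E = "\<lambda>r. frag_extend (\<lambda>A. frag_of (\<sigma> r A))"
  let ?act = "\<lambda>p z. frag_extend (\<lambda>r. ?E r z) p"
  have E_add: "?E r (?E s z) = ?E (r + s) z" for r s z
    using frag_extend_compose[of "\<lambda>A. frag_of (\<sigma> r A)" "\<sigma> s" z] by (simp add: o_def \<sigma>add)
  have act_diff: "?act p (x - y) = ?act p x - ?act p y" for p x y
    using shift_action_diff[of \<sigma> "Poly_Mapping.lookup p" x y] by (simp only: shift_action_lookup)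
  have act_times: "?act (p * q) z = ?act p (?act q z)" for p q z
  proof -
    have "Poly_Mapping.keys p \<subseteq> UNIV" by simp
    then show ?thesis
    proof (induction p rule: frag_induction)
      case (one r)
      have "Poly_Mapping.keys q \<subseteq> UNIV" by simp
      then show ?case
      proof (induction q rule: frag_induction)
        case (one s)
        have "frag_of r * frag_of s = frag_of (r + s)" by (simp add: mult_single)
        then show ?case by (simp add: E_add)
      qed (simp_all add: right_diff_distrib frag_extend_diff)
    qed (simp_all add: left_diff_distrib frag_extend_diff)
  qed
  have act_N: "?act p z \<in> N" if "z \<in> N" for p z
  proof -
    have "Poly_Mapping.keys p \<subseteq> UNIV" by simp
    then show ?thesis
      by (induction p rule: frag_induction) (simp_all add: N_zero pres[OF that] frag_extend_diff N_diff)
  qed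
  show ?thesis
  proof (rule frag_quotient_action.intro[OF frag_subgroup_axioms], rule frag_quotient_action_axioms.intro)
    show "cring novikov_P" by (rule cring_novikov_P)
    show "shift_action \<sigma> p (x - y) = shift_action \<sigma> p x - shift_action \<sigma> p y" for p x y
      by (rule shift_action_diff)
    show "Poly_Mapping.keys (shift_action \<sigma> p z) \<subseteq> UNIV" for p z by simp
    show "shift_action \<sigma> p z \<in> N" if "p \<in> carrier novikov_P" "z \<in> N" for p z
      using that act_N by (elim novikov_P_carrierE) (simp only: shift_action_lookup)
    show "shift_action \<sigma> (p \<oplus>\<^bsub>novikov_P\<^esub> q) z - (shift_action \<sigma> p z + shift_action \<sigma> q z) \<in> N"
      if pq: "p \<in> carrier novikov_P" "q \<in> carrier novikov_P" for p q z
    proof -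
      obtain P Q where "p = Poly_Mapping.lookup P" "q = Poly_Mapping.lookup Q" using pq by (meson novikov_P_carrierE)
      then show ?thesis by (simp add: novikov_P_add shift_action_lookup frag_extend_add N_zero)
    qed
    show "shift_action \<sigma> (p \<otimes>\<^bsub>novikov_P\<^esub> q) z - shift_action \<sigma> p (shift_action \<sigma> q z) \<in> N"
      if pq: "p \<in> carrier novikov_P" "q \<in> carrier novikov_P" for p q z
    proof -
      obtain P Q where "p = Poly_Mapping.lookup P" "q = Poly_Mapping.lookup Q" using pq by (meson novikov_P_carrierE)
      then show ?thesis by (simp add: novikov_P_mult shift_action_lookup act_times N_zero)
    qed
    show "shift_action \<sigma> \<one>\<^bsub>novikov_P\<^esub> z - z \<in> N" for z
    proof -
      have "shift_action \<sigma> \<one>\<^bsub>novikov_P\<^esub> z = frag_extend frag_of z"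
        unfolding novikov_P_one shift_action_lookup frag_extend_of \<sigma>0 ..
      also have "\<dots> = z" by (rule frag_expansion[symmetric])
      finally show ?thesis by (simp add: N_zero)
    qed
  qed
qed

section \<open>Tensor products\<close>

definition tensor_generators ::
    "('r, 'm) ring_scheme \<Rightarrow> ('r, 'a) module \<Rightarrow> ('r, 'b) module \<Rightarrow> ('a \<times> 'b \<Rightarrow>\<^sub>0 int) set" where
  "tensor_generators R M N =
       ({frag_of (x \<oplus>\<^bsub>M\<^esub> x', y) - frag_of (x, y) - frag_of (x', y) |x x' y.
           x \<in> carrier M \<and> x' \<in> carrier M \<and> y \<in> carrier N} \<union>
        {frag_of (x, y \<oplus>\<^bsub>N\<^esub> y') - frag_of (x, y) - frag_of (x, y') |x y y'.
           x \<in> carrier M \<and> y \<in> carrier N \<and> y' \<in> carrier N} \<union>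
        {frag_of (p \<odot>\<^bsub>M\<^esub> x, y) - frag_of (x, p \<odot>\<^bsub>N\<^esub> y) |p x y.
           p \<in> carrier R \<and> x \<in> carrier M \<and> y \<in> carrier N})"

lemma tensor_relations_generators:
  "tensor_relations R M N = generate (free_Abelian_group (carrier M \<times> carrier N)) (tensor_generators R M N)"
  by (simp add: tensor_relations_def tensor_generators_def)

locale tensor_product = M: Module.module R M + N: Module.module R N
  for R :: "('r, 'm) ring_scheme" (structure) and M :: "('r, 'a) module" and N :: "('r, 'b) module"
begin

abbreviation "F \<equiv> free_Abelian_group (carrier M \<times> carrier N)"
abbreviation "tensor_act \<equiv> \<lambda>p. frag_extend (\<lambda>(x, y). frag_of (p \<odot>\<^bsub>M\<^esub> x, y))"

lemma generator_cases [consumes 1, case_names left right scalar]: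
  assumes "g \<in> tensor_generators R M N"
  obtains x x' y where "x \<in> carrier M" "x' \<in> carrier M" "y \<in> carrier N"
      "g = frag_of (x \<oplus>\<^bsub>M\<^esub> x', y) - frag_of (x, y) - frag_of (x', y)"
    | x y y' where "x \<in> carrier M" "y \<in> carrier N" "y' \<in> carrier N"
      "g = frag_of (x, y \<oplus>\<^bsub>N\<^esub> y') - frag_of (x, y) - frag_of (x, y')"
    | p x y where "p \<in> carrier R" "x \<in> carrier M" "y \<in> carrier N"
      "g = frag_of (p \<odot>\<^bsub>M\<^esub> x, y) - frag_of (x, p \<odot>\<^bsub>N\<^esub> y)"
proof -
  from assms consider
      (1) "\<exists>x x' y. g = frag_of (x \<oplus>\<^bsub>M\<^esub> x', y) - frag_of (x, y) - frag_of (x', y) \<and>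
        x \<in> carrier M \<and> x' \<in> carrier M \<and> y \<in> carrier N"
    | (2) "\<exists>x y y'. g = frag_of (x, y \<oplus>\<^bsub>N\<^esub> y') - frag_of (x, y) - frag_of (x, y') \<and>
        x \<in> carrier M \<and> y \<in> carrier N \<and> y' \<in> carrier N"
    | (3) "\<exists>p x y. g = frag_of (p \<odot>\<^bsub>M\<^esub> x, y) - frag_of (x, p \<odot>\<^bsub>N\<^esub> y) \<and>
        p \<in> carrier R \<and> x \<in> carrier M \<and> y \<in> carrier N"
    unfolding tensor_generators_def Un_iff mem_Collect_eq by (elim disjE)
  then show thesis
  proof cases
    case 1
    then show thesis by (elim exE conjE) (rule that(1))
  next
    case 2
    then show thesis by (elim exE conjE) (rule that(2))
  next
    case 3
    then show thesis by (elim exE conjE) (rule that(3))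
  qed
qed

lemma keys_diff_subset:
  "Poly_Mapping.keys x \<subseteq> A \<Longrightarrow> Poly_Mapping.keys y \<subseteq> A \<Longrightarrow> Poly_Mapping.keys (x - y) \<subseteq> A"
  for x y :: "'c \<Rightarrow>\<^sub>0 int"
  using keys_diff[of x y] by blast

lemma generators_closed: "tensor_generators R M N \<subseteq> carrier F"
proof
  fix g assume "g \<in> tensor_generators R M N"
  then show "g \<in> carrier F"
    by (cases rule: generator_cases)
      (simp_all add: keys_diff_subset keys_frag_of M.smult_closed N.smult_closed)
qed

lemma generator_in: "g \<in> tensor_generators R M N \<Longrightarrow> g \<in> tensor_relations R M N"
  unfolding tensor_relations_generators by (rule generate.incl)

lemma rel_left:
  "x \<in> carrier M \<Longrightarrow> x' \<in> carrier M \<Longrightarrow> y \<in> carrier N \<Longrightarrow>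
   frag_of (x \<oplus>\<^bsub>M\<^esub> x', y) - frag_of (x, y) - frag_of (x', y) \<in> tensor_relations R M N"
  by (rule generator_in, unfold tensor_generators_def, rule UnI1, rule UnI1, rule CollectI,
      rule exI[of _ x], rule exI[of _ x'], rule exI[of _ y], simp)

lemma rel_right:
  "x \<in> carrier M \<Longrightarrow> y \<in> carrier N \<Longrightarrow> y' \<in> carrier N \<Longrightarrow>
   frag_of (x, y \<oplus>\<^bsub>N\<^esub> y') - frag_of (x, y) - frag_of (x, y') \<in> tensor_relations R M N"
  by (rule generator_in, unfold tensor_generators_def, rule UnI1, rule UnI2, rule CollectI,
      rule exI[of _ x], rule exI[of _ y], rule exI[of _ y'], simp)

lemma rel_scalar:
  "p \<in> carrier R \<Longrightarrow> x \<in> carrier M \<Longrightarrow> y \<in> carrier N \<Longrightarrow>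
   frag_of (p \<odot>\<^bsub>M\<^esub> x, y) - frag_of (x, p \<odot>\<^bsub>N\<^esub> y) \<in> tensor_relations R M N"
  by (rule generator_in, unfold tensor_generators_def, rule UnI2, rule CollectI,
      rule exI[of _ p], rule exI[of _ x], rule exI[of _ y], simp)

sublocale frag_subgroup "carrier M \<times> carrier N" "tensor_relations R M N"
  by (rule frag_subgroup.intro) (unfold tensor_relations_generators, rule subgroup_generate_frag[OF generators_closed])

text \<open>
  Commutativity of the ring enters for the balancing relations: the acting scalar must be moved past the one in the
  relation.
\<close>

lemma tensor_act_generator:
  assumes p: "p \<in> carrier R" and g: "g \<in> tensor_generators R M N"
  shows "tensor_act p g \<in> tensor_relations R M N"
  using g
proof (cases rule: generator_cases)
  case (left x x' y)
  then show ?thesis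
    using rel_left[of "p \<odot>\<^bsub>M\<^esub> x" "p \<odot>\<^bsub>M\<^esub> x'" y] p
    by (simp add: frag_extend_diff M.smult_r_distr)
next
  case (right x y y')
  then show ?thesis
    using rel_right[of "p \<odot>\<^bsub>M\<^esub> x" y y'] p by (simp add: frag_extend_diff)
next
  case (scalar q x y)
  have "p \<odot>\<^bsub>M\<^esub> (q \<odot>\<^bsub>M\<^esub> x) = q \<odot>\<^bsub>M\<^esub> (p \<odot>\<^bsub>M\<^esub> x)"
    using scalar(1,2) p by (metis M.smult_assoc1 M.R.m_comm)
  then show ?thesis
    using rel_scalar[of q "p \<odot>\<^bsub>M\<^esub> x" y] p scalar by (simp add: frag_extend_diff)
qed

lemma tensor_act_closed:
  assumes "p \<in> carrier R" "Poly_Mapping.keys z \<subseteq> carrier M \<times> carrier N"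
  shows "Poly_Mapping.keys (tensor_act p z) \<subseteq> carrier M \<times> carrier N"
proof -
  have "Poly_Mapping.keys (case k of (x, y) \<Rightarrow> frag_of (p \<odot>\<^bsub>M\<^esub> x, y)) \<subseteq> carrier M \<times> carrier N"
    if "k \<in> Poly_Mapping.keys z" for k
    using that assms by (cases k) (auto simp: keys_frag_of)
  then show ?thesis using keys_frag_extend[of "\<lambda>(x, y). frag_of (p \<odot>\<^bsub>M\<^esub> x, y)" z] by blast
qed

sublocale frag_quotient_action "carrier M \<times> carrier N" "tensor_relations R M N" R tensor_act
proof (rule frag_quotient_action.intro[OF frag_subgroup_axioms], rule frag_quotient_action_axioms.intro, goal_cases)
  case 1
  show ?case by (rule M.R.is_cring)
next
  case (2 p z)
  then show ?case by (rule tensor_act_closed)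
next
  case (3 p x y)
  show ?case by (rule frag_extend_diff)
next
  case (4 p z)
  have z: "z \<in> generate F (tensor_generators R M N)" using 4(2) by (simp only: tensor_relations_generators)
  show ?case
  proof (rule generate_frag_mapsto[where h = "tensor_act p", OF generators_closed _ _ _ _ z])
    show "tensor_act p (x - y) = tensor_act p x - tensor_act p y" for x y by (rule frag_extend_diff)
    show "tensor_act p g \<in> tensor_relations R M N" if "g \<in> tensor_generators R M N" for g
      using tensor_act_generator[OF 4(1) that] .
  qed (rule N_zero, rule N_diff)
next
  case (5 p q z)
  from 5(3) show ?case
  proof (induction z rule: frag_induction)
    case zero
    then show ?case by (simp add: N_zero)
  next
    case (one k)
    obtain x y where k: "k = (x, y)" "x \<in> carrier M" "y \<in> carrier N" using one by auto
    then show ?case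
      using rel_left[of "p \<odot>\<^bsub>M\<^esub> x" "q \<odot>\<^bsub>M\<^esub> x" y] 5(1,2) by (simp add: M.smult_l_distr algebra_simps)
  next
    case (diff a b)
    then show ?case using N_diff[OF diff] by (simp add: frag_extend_diff algebra_simps)
  qed
next
  case (6 p q z)
  from 6(3) show ?case
  proof (induction z rule: frag_induction)
    case zero
    then show ?case by (simp add: N_zero)
  next
    case (one k)
    obtain x y where k: "k = (x, y)" "x \<in> carrier M" "y \<in> carrier N" using one by auto
    then show ?case using 6(1,2) by (simp add: M.smult_assoc1 N_zero)
  next
    case (diff a b)
    then show ?case using N_diff[OF diff] by (simp add: frag_extend_diff algebra_simps)
  qed
next
  case (7 z)
  then show ?case
  proof (induction z rule: frag_induction)
    case zero
    then show ?case by (simp add: N_zero)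
  next
    case (one k)
    obtain x y where k: "k = (x, y)" "x \<in> carrier M" "y \<in> carrier N" using one by auto
    then show ?case by (simp add: N_zero)
  next
    case (diff a b)
    then show ?case using N_diff[OF diff] by (simp add: frag_extend_diff algebra_simps)
  qed
qed

lemma tensor_module_eq: "tensor_module R M N = Q"
  by (simp add: tensor_module_def)

lemma tensor_elem_eq: "tensor_elem R M N x y = coset (frag_of (x, y))"
  by (simp add: tensor_elem_def)

end

section \<open>The pairing on the Grothendieck group\<close>

context tame_bounded_tpc
begin

lemma q_tilde_zsum: "q_tilde C X z a = zsum (\<lambda>Y. lam X Y a) z"
  by (simp add: q_tilde_def zsum_def lam_def)

definition "triangle_relations =
  {frag_of B - frag_of A - frag_of D |A B D. \<exists>u v w. (A, B, D, u, v, w) \<in> PExact C}"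

lemma K_relations_eq: "K_relations C = generate (free_Abelian_group UNIV) triangle_relations"
  by (simp add: K_relations_def grothendieck_relations_def triangle_relations_def)

lemma triangle_relationsE:
  assumes "g \<in> triangle_relations"
  obtains A B D u v w where "(A, B, D, u, v, w) \<in> PExact C" "g = frag_of B - frag_of A - frag_of D"
  using assms unfolding triangle_relations_def mem_Collect_eq by (elim exE conjE) (rule that)

lemma triangle_relations_closed: "triangle_relations \<subseteq> carrier (free_Abelian_group UNIV)"
  by (rule subsetI) simp

lemma subgroup_K: "subgroup (K_relations C) (free_Abelian_group UNIV)"
  unfolding K_relations_eq by (rule subgroup_generate_frag[OF triangle_relations_closed])

sublocale K: frag_subgroup UNIV "K_relations C"
  by (rule frag_subgroup.intro[OF subgroup_K])

text \<open>
  Shifts send exact triangles to exact triangles, hence relations to relations.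
\<close>

lemma shift_K_relations:
  assumes z: "z \<in> K_relations C"
  shows "frag_extend (\<lambda>A. frag_of (Sob C r A)) z \<in> K_relations C"
proof (rule generate_frag_mapsto[where h = "frag_extend (\<lambda>A. frag_of (Sob C r A))", OF triangle_relations_closed])
  show "z \<in> generate (free_Abelian_group UNIV) triangle_relations" using z by (simp only: K_relations_eq)
  show "frag_extend (\<lambda>A. frag_of (Sob C r A)) (x - y)
    = frag_extend (\<lambda>A. frag_of (Sob C r A)) x - frag_extend (\<lambda>A. frag_of (Sob C r A)) y" for x y
    by (rule frag_extend_diff)
  show "frag_extend (\<lambda>A. frag_of (Sob C r A)) g \<in> K_relations C" if g: "g \<in> triangle_relations" for g
  proof -
    obtain A B D u v w where t: "(A, B, D, u, v, w) \<in> PExact C" "g = frag_of B - frag_of A - frag_of D"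
      using g by (rule triangle_relationsE)
    have "frag_of (Sob C r B) - frag_of (Sob C r A) - frag_of (Sob C r D) \<in> triangle_relations"
      using shift_triangle[OF t(1), of r] unfolding triangle_relations_def by blast
    then have "frag_of (Sob C r B) - frag_of (Sob C r A) - frag_of (Sob C r D) \<in> K_relations C"
      unfolding K_relations_eq by (rule generate.incl)
    then show ?thesis unfolding t(2) by (simp add: frag_extend_diff)
  qed
qed (rule K.N_zero, rule K.N_diff)

sublocale KM: frag_quotient_action UNIV "K_relations C" novikov_P "shift_action (Sob C)"
  by (rule frag_quotient_action_shift[where \<sigma> = "Sob C", OF subgroup_K shift_zero_ob shift_add_ob shift_K_relations])

lemma neg_shift_add: "Sob C (- r) (Sob C (- s) A) = Sob C (- (r + s)) A"
  using shift_add_ob[of "- r" "- s" A] by simp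

lemma neg_shift_zero: "Sob C (- 0) A = A"
  using shift_zero_ob[of A] by simp

sublocale KR: frag_quotient_action UNIV "K_relations C" novikov_P "shift_action (\<lambda>r. Sob C (- r))"
  by (rule frag_quotient_action_shift[where \<sigma> = "\<lambda>r. Sob C (- r)", OF subgroup_K neg_shift_zero neg_shift_add shift_K_relations])

lemma K_coset_eq: "K_coset C z = K.coset z" by (simp add: K_coset_def)

lemma K_module_eq: "K_module C = KM.Q" by (simp add: K_module_def)

lemma K_reversed_eq: "K_reversed C = KR.Q" by (simp add: K_reversed_def)

lemma q_tilde_relations:
  assumes "z \<in> K_relations C"
  shows "q_tilde C X z a = 0"
proof -
  have "zsum (\<lambda>Y. lam X Y a) z \<in> {0}"
  proof (rule generate_frag_mapsto[OF triangle_relations_closed zsum_diff])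
    show "z \<in> generate (free_Abelian_group UNIV) triangle_relations" using assms by (simp only: K_relations_eq)
    fix g assume "g \<in> triangle_relations"
    then obtain A B D u v w where t: "(A, B, D, u, v, w) \<in> PExact C" "g = frag_of B - frag_of A - frag_of D"
      by (rule triangle_relationsE)
    show "zsum (\<lambda>Y. lam X Y a) g \<in> {0}"
      unfolding t(2) using lam_add_right[OF t(1), of X a] by (simp add: zsum_diff)
  qed simp_all
  then show ?thesis by (simp add: q_tilde_zsum)
qed

text \<open>
  The bilinear extension of \<open>\<kappa>\<close> to the free abelian group on the objects, coefficient by coefficient.
\<close>

definition "pairing z w a = zsum (\<lambda>X. q_tilde C X w a) z"

lemma pairing_diff_left: "pairing (x - y) w a = pairing x w a - pairing y w a"
  by (simp add: pairing_def zsum_diff)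

lemma pairing_add_left: "pairing (x + y) w a = pairing x w a + pairing y w a"
  by (simp add: pairing_def zsum_add)

lemma pairing_diff_right: "pairing z (x - y) a = pairing z x a - pairing z y a"
  by (simp add: pairing_def q_tilde_zsum zsum_diff zsum_fun_diff)

lemma pairing_add_right: "pairing z (x + y) a = pairing z x a + pairing z y a"
  by (simp add: pairing_def q_tilde_zsum zsum_add zsum_fun_add)

lemma pairing_relations_right: "w \<in> K_relations C \<Longrightarrow> pairing z w a = 0"
  by (simp add: pairing_def q_tilde_relations zsum_def)

lemma pairing_relations_left:
  assumes "z \<in> K_relations C"
  shows "pairing z w a = 0"
proof -
  have "pairing z w a \<in> {0}"
  proof (rule generate_frag_mapsto[where h = "\<lambda>z. pairing z w a", OF triangle_relations_closed pairing_diff_left])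
    show "z \<in> generate (free_Abelian_group UNIV) triangle_relations" using assms by (simp only: K_relations_eq)
    fix g assume "g \<in> triangle_relations"
    then obtain A B D u v w' where t: "(A, B, D, u, v, w') \<in> PExact C" "g = frag_of B - frag_of A - frag_of D"
      by (rule triangle_relationsE)
    have "q_tilde C B w a = q_tilde C A w a + q_tilde C D w a"
      unfolding q_tilde_zsum lam_add_left[OF t(1)] zsum_fun_add ..
    then show "pairing g w a \<in> {0}"
      unfolding t(2) by (simp add: pairing_diff_left) (simp add: pairing_def)
  qed simp_all
  then show ?thesis by simp
qed

lemma pairing_shift_right:
  "pairing z (shift_action (Sob C) (Poly_Mapping.lookup p) w) a = zsum (\<lambda>r. pairing z w (a - r)) p"
proof -
  have "q_tilde C X (shift_action (Sob C) (Poly_Mapping.lookup p) w) a = zsum (\<lambda>r. q_tilde C X w (a - r)) p" for X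
    unfolding q_tilde_zsum shift_action_lookup zsum_frag_extend zsum_of lam_shift_right ..
  then have "pairing z (shift_action (Sob C) (Poly_Mapping.lookup p) w) a
    = zsum (\<lambda>X. zsum (\<lambda>r. q_tilde C X w (a - r)) p) z"
    by (simp only: pairing_def)
  also have "\<dots> = zsum (\<lambda>r. pairing z w (a - r)) p"
    unfolding pairing_def by (rule zsum_swap)
  finally show ?thesis .
qed

text \<open>
  A negative shift in the first argument and a positive one in the second both translate \<open>\<lambda>\<close> by the same
  amount; this is why the first factor carries the reversed structure.
\<close>

lemma pairing_shift_left:
  "pairing (shift_action (\<lambda>r. Sob C (- r)) (Poly_Mapping.lookup p) z) w a = zsum (\<lambda>r. pairing z w (a - r)) p"
  unfolding pairing_def q_tilde_zsum shift_action_lookup zsum_frag_extend zsum_of lam_shift_left ..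

lemma q_tilde_novikov: "q_tilde C X z \<in> carrier novikov"
proof -
  have "q_tilde C X z = (\<lambda>a. zsum (\<lambda>Y. lam X Y a) z)" by (rule ext) (rule q_tilde_zsum)
  also have "\<dots> \<in> carrier novikov" by (rule novikov_zsum) (rule lam_novikov)
  finally show ?thesis .
qed

lemma pairing_novikov: "pairing z w \<in> carrier novikov"
proof -
  have "pairing z w = (\<lambda>a. zsum (\<lambda>X. q_tilde C X w a) z)" by (rule ext) (rule pairing_def)
  also have "\<dots> \<in> carrier novikov" by (rule novikov_zsum) (rule q_tilde_novikov)
  finally show ?thesis .
qed

definition "repr c = (SOME z. z \<in> c)"

lemma repr_coset: "repr (K.coset z) - z \<in> K_relations C"
  unfolding repr_def by (rule K.coset_someI)

lemma q_tilde_repr: "q_tilde C X (repr (K.coset z)) = q_tilde C X z"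
proof
  fix a
  show "q_tilde C X (repr (K.coset z)) a = q_tilde C X z a"
    using q_tilde_relations[OF repr_coset[of z], of X a] by (simp add: q_tilde_zsum zsum_diff)
qed

text \<open>
  The pairing of two classes, computed on chosen representatives.
\<close>

definition "class_pairing x y = pairing (repr x) (repr y)"

lemma class_pairing_coset: "class_pairing (K.coset z) (K.coset w) a = pairing z w a"
proof -
  have "pairing (repr (K.coset z)) (repr (K.coset w)) a = pairing z (repr (K.coset w)) a"
    using pairing_relations_left[OF repr_coset[of z], of "repr (K.coset w)" a] by (simp add: pairing_diff_left)
  also have "\<dots> = pairing z w a"
    using pairing_relations_right[OF repr_coset[of w], of z a] by (simp add: pairing_diff_right)
  finally show ?thesis by (simp add: class_pairing_def)
qed

lemma KM_coset: "c \<in> carrier KM.Q \<Longrightarrow> \<exists>z. c = K.coset z"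
  unfolding KM.Q_carrier by (erule K.carrier_quotientE) (rule exI)

lemma KR_coset: "c \<in> carrier KR.Q \<Longrightarrow> \<exists>z. c = K.coset z"
  unfolding KR.Q_carrier by (erule K.carrier_quotientE) (rule exI)

sublocale T: tensor_product novikov_P KR.Q KM.Q
  by (intro tensor_product.intro KR.module_Q KM.module_Q)

lemma class_pairing_add_left:
  assumes "x \<in> carrier KR.Q" "x' \<in> carrier KR.Q" "y \<in> carrier KM.Q"
  shows "class_pairing (x \<oplus>\<^bsub>KR.Q\<^esub> x') y a = class_pairing x y a + class_pairing x' y a"
proof -
  obtain z z' w where "x = K.coset z" "x' = K.coset z'" "y = K.coset w"
    using KR_coset[OF assms(1)] KR_coset[OF assms(2)] KM_coset[OF assms(3)] by (elim exE)
  then show ?thesis by (simp add: KR.add_coset class_pairing_coset pairing_add_left)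
qed

lemma class_pairing_add_right:
  assumes "x \<in> carrier KR.Q" "y \<in> carrier KM.Q" "y' \<in> carrier KM.Q"
  shows "class_pairing x (y \<oplus>\<^bsub>KM.Q\<^esub> y') a = class_pairing x y a + class_pairing x y' a"
proof -
  obtain z w w' where "x = K.coset z" "y = K.coset w" "y' = K.coset w'"
    using KR_coset[OF assms(1)] KM_coset[OF assms(2)] KM_coset[OF assms(3)] by (elim exE)
  then show ?thesis by (simp add: KM.add_coset class_pairing_coset pairing_add_right)
qed

lemma class_pairing_scalar_left:
  assumes "x \<in> carrier KR.Q" "y \<in> carrier KM.Q"
  shows "class_pairing (Poly_Mapping.lookup p \<odot>\<^bsub>KR.Q\<^esub> x) y a = zsum (\<lambda>r. class_pairing x y (a - r)) p"
proof -
  obtain z w where "x = K.coset z" "y = K.coset w"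
    using KR_coset[OF assms(1)] KM_coset[OF assms(2)] by (elim exE)
  then show ?thesis by (simp only: KR.smult_coset[OF lookup_in_novikov_P] class_pairing_coset pairing_shift_left)
qed

lemma class_pairing_scalar_right:
  assumes "x \<in> carrier KR.Q" "y \<in> carrier KM.Q"
  shows "class_pairing x (Poly_Mapping.lookup p \<odot>\<^bsub>KM.Q\<^esub> y) a = zsum (\<lambda>r. class_pairing x y (a - r)) p"
proof -
  obtain z w where "x = K.coset z" "y = K.coset w"
    using KR_coset[OF assms(1)] KM_coset[OF assms(2)] by (elim exE)
  then show ?thesis by (simp only: KM.smult_coset[OF lookup_in_novikov_P] class_pairing_coset pairing_shift_right)
qed

definition "pairing_ext \<zeta> a = zsum (\<lambda>(x, y). class_pairing x y a) \<zeta>"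

lemma pairing_ext_diff: "pairing_ext (x - y) a = pairing_ext x a - pairing_ext y a" by (simp add: pairing_ext_def zsum_diff)
lemma pairing_ext_add: "pairing_ext (x + y) a = pairing_ext x a + pairing_ext y a" by (simp add: pairing_ext_def zsum_add)
lemma pairing_ext_of: "pairing_ext (frag_of (x, y)) a = class_pairing x y a" by (simp add: pairing_ext_def)

text \<open>
  The three kinds of generators of the tensor relations correspond to additivity in the first
  argument, additivity in the second, and compatibility with scalars.
\<close>

lemma pairing_ext_relations:
  assumes "\<zeta> \<in> tensor_relations novikov_P KR.Q KM.Q"
  shows "pairing_ext \<zeta> a = 0"
proof -
  have "pairing_ext \<zeta> a \<in> {0}"
  proof (rule generate_frag_mapsto[where h = "\<lambda>\<zeta>. pairing_ext \<zeta> a", OF T.generators_closed pairing_ext_diff])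
    show "\<zeta> \<in> generate T.F (tensor_generators novikov_P KR.Q KM.Q)"
      using assms by (simp only: tensor_relations_generators)
    fix g assume "g \<in> tensor_generators novikov_P KR.Q KM.Q"
    then have "pairing_ext g a = 0"
    proof (rule T.generator_cases)
      fix x x' y assume *: "x \<in> carrier KR.Q" "x' \<in> carrier KR.Q" "y \<in> carrier KM.Q"
        and g: "g = frag_of (x \<oplus>\<^bsub>KR.Q\<^esub> x', y) - frag_of (x, y) - frag_of (x', y)"
      show ?thesis unfolding g pairing_ext_diff pairing_ext_of class_pairing_add_left[OF *] by simp
    next
      fix x y y' assume *: "x \<in> carrier KR.Q" "y \<in> carrier KM.Q" "y' \<in> carrier KM.Q"
        and g: "g = frag_of (x, y \<oplus>\<^bsub>KM.Q\<^esub> y') - frag_of (x, y) - frag_of (x, y')"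
      show ?thesis unfolding g pairing_ext_diff pairing_ext_of class_pairing_add_right[OF *] by simp
    next
      fix p x y assume p: "p \<in> carrier novikov_P" and *: "x \<in> carrier KR.Q" "y \<in> carrier KM.Q"
        and g: "g = frag_of (p \<odot>\<^bsub>KR.Q\<^esub> x, y) - frag_of (x, p \<odot>\<^bsub>KM.Q\<^esub> y)"
      obtain P where P: "p = Poly_Mapping.lookup P" using p by (rule novikov_P_carrierE)
      show ?thesis unfolding g P pairing_ext_diff pairing_ext_of class_pairing_scalar_left[OF *] class_pairing_scalar_right[OF *] by simp
    qed
    then show "pairing_ext g a \<in> {0}" by simp
  qed simp_all
  then show ?thesis by simp
qed

definition "kappa c = pairing_ext (SOME \<zeta>. \<zeta> \<in> c)"

lemma kappa_coset: "kappa (T.coset \<zeta>) a = pairing_ext \<zeta> a"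
  using pairing_ext_relations[OF T.coset_someI[of \<zeta>], of a] by (simp add: kappa_def pairing_ext_diff)

lemma pairing_ext_novikov: "pairing_ext \<zeta> \<in> carrier novikov"
proof -
  have "pairing_ext \<zeta> = (\<lambda>a. zsum (\<lambda>k. class_pairing (fst k) (snd k) a) \<zeta>)"
    by (rule ext) (simp add: pairing_ext_def case_prod_unfold)
  also have "\<dots> \<in> carrier novikov"
    unfolding class_pairing_def by (rule novikov_zsum) (rule pairing_novikov)
  finally show ?thesis .
qed

lemma pairing_ext_scalar:
  assumes "Poly_Mapping.keys \<zeta> \<subseteq> carrier KR.Q \<times> carrier KM.Q"
  shows "pairing_ext (T.tensor_act (Poly_Mapping.lookup p) \<zeta>) a = zsum (\<lambda>r. pairing_ext \<zeta> (a - r)) p"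
proof -
  have "pairing_ext (T.tensor_act (Poly_Mapping.lookup p) \<zeta>) a
    = zsum (\<lambda>k. zsum (\<lambda>(x, y). class_pairing x y a) (case k of (x, y) \<Rightarrow> frag_of (Poly_Mapping.lookup p \<odot>\<^bsub>KR.Q\<^esub> x, y))) \<zeta>"
    unfolding pairing_ext_def zsum_frag_extend ..
  also have "\<dots> = zsum (\<lambda>k. zsum (\<lambda>r. (case k of (x, y) \<Rightarrow> class_pairing x y (a - r))) p) \<zeta>"
  proof (rule zsum_cong)
    fix k assume "k \<in> Poly_Mapping.keys \<zeta>"
    then obtain x y where k: "k = (x, y)" "x \<in> carrier KR.Q" "y \<in> carrier KM.Q" using assms by blast
    show "zsum (\<lambda>(x, y). class_pairing x y a) (case k of (x, y) \<Rightarrow> frag_of (Poly_Mapping.lookup p \<odot>\<^bsub>KR.Q\<^esub> x, y))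
      = zsum (\<lambda>r. (case k of (x, y) \<Rightarrow> class_pairing x y (a - r))) p"
      unfolding k(1) prod.case zsum_of by (rule class_pairing_scalar_left[OF k(2,3)])
  qed
  also have "\<dots> = zsum (\<lambda>r. pairing_ext \<zeta> (a - r)) p"
    unfolding pairing_ext_def by (rule zsum_swap)
  finally show ?thesis .
qed

lemma module_map_kappa:
  "module_map novikov_P (tensor_module novikov_P (K_reversed C) (K_module C)) novikov_module kappa"
  unfolding K_reversed_eq K_module_eq T.tensor_module_eq module_map_def
proof (intro conjI ballI)
  show "Module.module novikov_P T.Q" by (rule T.module_Q)
  show "Module.module novikov_P novikov_module" by (rule module_novikov)
  show "kappa \<in> carrier T.Q \<rightarrow> carrier novikov_module"
    unfolding novikov_module_carrier kappa_def using pairing_ext_novikov by blast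
next
  fix c c' assume c: "c \<in> carrier T.Q" "c' \<in> carrier T.Q"
  obtain \<zeta> where \<zeta>: "Poly_Mapping.keys \<zeta> \<subseteq> carrier KR.Q \<times> carrier KM.Q" "c = T.coset \<zeta>"
    using c(1) unfolding T.Q_carrier by (rule T.carrier_quotientE)
  obtain \<xi> where \<xi>: "Poly_Mapping.keys \<xi> \<subseteq> carrier KR.Q \<times> carrier KM.Q" "c' = T.coset \<xi>"
    using c(2) unfolding T.Q_carrier by (rule T.carrier_quotientE)
  show "kappa (c \<oplus>\<^bsub>T.Q\<^esub> c') = kappa c \<oplus>\<^bsub>novikov_module\<^esub> kappa c'"
    unfolding \<zeta>(2) \<xi>(2) T.add_coset[OF \<zeta>(1) \<xi>(1)] novikov_module_add
    by (rule ext) (simp only: kappa_coset pairing_ext_add)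
next
  fix p c assume p: "p \<in> carrier novikov_P" and c: "c \<in> carrier T.Q"
  obtain P where P: "p = Poly_Mapping.lookup P" using p by (rule novikov_P_carrierE)
  obtain \<zeta> where \<zeta>: "Poly_Mapping.keys \<zeta> \<subseteq> carrier KR.Q \<times> carrier KM.Q" "c = T.coset \<zeta>"
    using c unfolding T.Q_carrier by (rule T.carrier_quotientE)
  show "kappa (p \<odot>\<^bsub>T.Q\<^esub> c) = p \<odot>\<^bsub>novikov_module\<^esub> kappa c"
    unfolding \<zeta>(2) T.smult_coset[OF p] unfolding P novikov_module_smult
    by (rule ext) (simp only: kappa_coset pairing_ext_scalar[OF \<zeta>(1)])
qed

definition "q_map X c = q_tilde C X (repr c)"

lemma q_map_coset: "q_map X (K_coset C z) = q_tilde C X z"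
  unfolding q_map_def K_coset_eq by (rule q_tilde_repr)

lemma q_map_hom: "q_map X \<in> hom (K_group C) (add_monoid novikov)"
proof (rule homI)
  show "q_map X c \<in> carrier (add_monoid novikov)" for c
    using q_tilde_novikov by (simp add: q_map_def)
  fix c c' assume "c \<in> carrier (K_group C)" "c' \<in> carrier (K_group C)"
  then have "c \<in> carrier (K.G Mod K_relations C)" "c' \<in> carrier (K.G Mod K_relations C)"
    by (simp_all add: K_group_def grothendieck_group_def K_relations_def)
  then obtain z z' where z: "c = K.coset z" "c' = K.coset z'" by (meson K.carrier_quotientE)
  have "c \<otimes>\<^bsub>K_group C\<^esub> c' = K.coset z \<otimes>\<^bsub>K.G Mod K_relations C\<^esub> K.coset z'"
    by (simp add: z K_group_def grothendieck_group_def K_relations_def)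
  also have "\<dots> = K.coset (z + z')" by (rule K.coset_mult) simp_all
  finally have "q_map X (c \<otimes>\<^bsub>K_group C\<^esub> c') = q_tilde C X (z + z')" by (simp only: q_map_def q_tilde_repr)
  also have "\<dots> = q_tilde C X z \<oplus>\<^bsub>novikov\<^esub> q_tilde C X z'"
    by (simp add: novikov_def fun_eq_iff q_tilde_zsum zsum_add)
  finally show "q_map X (c \<otimes>\<^bsub>K_group C\<^esub> c') = q_map X c \<otimes>\<^bsub>add_monoid novikov\<^esub> q_map X c'"
    by (simp add: z q_map_def q_tilde_repr)
qed

lemma kappa_class:
  "kappa (tensor_elem novikov_P (K_reversed C) (K_module C) (K_class C X) (K_class C Y)) = q_map X (K_class C Y)"
proof
  fix a
  have "kappa (T.coset (frag_of (K.coset (frag_of X), K.coset (frag_of Y)))) a = pairing (frag_of X) (frag_of Y) a"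
    by (simp only: kappa_coset pairing_ext_of class_pairing_coset)
  then show "kappa (tensor_elem novikov_P (K_reversed C) (K_module C) (K_class C X) (K_class C Y)) a = q_map X (K_class C Y) a"
    unfolding K_class_def q_map_coset unfolding K_coset_eq K_reversed_eq K_module_eq T.tensor_elem_eq
    by (simp add: pairing_def)
qed

end

theorem theorem6p1p1:
  fixes C :: "('k::field, 'v::ab_group_add, 'o) pers_cat"
  assumes "triangulated_persistence_category C"
    and "tame C"
    and "bounded_category C"
    and "\<And>A B. no_left_accumulation (hom_pmod C A B)"
  shows "\<exists>q.
    (\<forall>X. q X \<in> hom (K_group C) (add_monoid novikov) \<and>
         (\<forall>z. q X (K_coset C z) = q_tilde C X z)) \<and>
    Module.module novikov_P (K_reversed C) \<and> Module.module novikov_P (K_module C) \<and>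
    (\<exists>\<kappa>. module_map novikov_P (tensor_module novikov_P (K_reversed C) (K_module C)) novikov_module \<kappa> \<and>
         (\<forall>X Y. \<kappa> (tensor_elem novikov_P (K_reversed C) (K_module C) (K_class C X) (K_class C Y)) =
                q X (K_class C Y)))"
proof -
  interpret tame_bounded_tpc C
    using assms by (simp add: tame_bounded_tpc_def tame_bounded_tpc_axioms_def)
  have "Module.module novikov_P (K_reversed C)" "Module.module novikov_P (K_module C)"
    unfolding K_reversed_eq K_module_eq by (rule KR.module_Q, rule KM.module_Q)
  then show ?thesis
    using q_map_hom q_map_coset module_map_kappa kappa_class
    by (intro exI[of _ q_map] conjI allI exI[of _ kappa])
qed

end
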